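(* The Temporal $\Delta$ Clique problem, restricted to input temporal graphs $\mathcal{G}=(V,\mathcal{E},\tau)$ that are temporal unit interval graphs, is solvable in $\mathcal{O}\bigl(2^{(k-2)(2\Delta)^{\tau-\Delta+1}}\, n\bigr)$ time, where $n=|V|$ and $k$ is the requested clique size.
   Context: A temporal graph $\mathcal{G}=(V,\mathcal{E},\tau)$ consists of a finite vertex set $V$, a lifetime $\tau\in\mathbb{N}$ and a set of time-edges $\mathcal{E}\subseteq\binom{V}{2}\times\{1,\dots,\tau\}$. Its $t$-th layer is the static graph $G_t=(V,E_t)$ with $E_t=\{\{u,v\}:(\{u,v\},t)\in\mathcal{E}\}$. A temporal unit interval graph is a temporal graph each of whose layers is a unit interval graph (intersection graph of intervals of equal length on the real line). Let $1\le\Delta\le\tau$ be an integer. The $\Delta$-association graph of $\mathcal{G}$ is the static graph $\bigl(V,\bigcap_{i=1}^{\tau-\Delta+1}\bigcup_{j=i}^{i+\Delta-1}E_j\bigr)$. Temporal $\Delta$ Clique: given a temporal graph $\mathcal{G}=(V,\mathcal{E},\tau)$ and $k\in\mathbb{N}$, decide whether there is $V'\subseteq V$ with $|V'|\ge k$ such that $V'$ is a clique in the $\Delta$-association graph of $\mathcal{G}$.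
   Formalization: The stated bound omits reading the input. Proved: the bound itself for k≥3 when each layer's unit intervals are given (for k≤2 the constant depends on Δ, τ); from edge lists, the bound plus a term linear in input size. The exponent k−2 is read as 0 for k<2. *)

theory Defs
  imports Complex_Main "HOL-Library.Landau_Symbols"
begin

section \<open>Temporal graphs\<close>

record 'a temporal_graph =
  verts :: "'a set"
  time_edges :: "('a set \<times> nat) set"
  lifetime :: nat

definition temporal_graph :: "'a temporal_graph \<Rightarrow> bool" where
  "temporal_graph G \<longleftrightarrow> finite (verts G) \<and>
     time_edges G \<subseteq> {e. e \<subseteq> verts G \<and> card e = 2} \<times> {1..lifetime G}"

definition layer :: "'a temporal_graph \<Rightarrow> nat \<Rightarrow> 'a set set" where
  "layer G t = {e. (e, t) \<in> time_edges G}"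

text \<open>Edge set of the intersection graph of the intervals \<open>[l v, l v + len]\<close>, \<open>v \<in> V\<close>.\<close>

definition interval_edges :: "'a set \<Rightarrow> ('a \<Rightarrow> real) \<Rightarrow> real \<Rightarrow> 'a set set" where
  "interval_edges V l len =
     {{u, v} | u v. u \<in> V \<and> v \<in> V \<and> u \<noteq> v \<and> {l u..l u + len} \<inter> {l v..l v + len} \<noteq> {}}"

definition unit_interval_graph :: "'a set \<Rightarrow> 'a set set \<Rightarrow> bool" where
  "unit_interval_graph V E \<longleftrightarrow> (\<exists>l len. len > 0 \<and> E = interval_edges V l len)"

definition temporal_unit_interval_graph :: "'a temporal_graph \<Rightarrow> bool" where
  "temporal_unit_interval_graph G \<longleftrightarrow> temporal_graph G \<and>
     (\<forall>t\<in>{1..lifetime G}. unit_interval_graph (verts G) (layer G t))"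

definition association_edges :: "'a temporal_graph \<Rightarrow> nat \<Rightarrow> 'a set set" where
  "association_edges G \<Delta> = (\<Inter>i\<in>{1..lifetime G - \<Delta> + 1}. \<Union>j\<in>{i..i + \<Delta> - 1}. layer G j)"

definition is_clique :: "'a set set \<Rightarrow> 'a set \<Rightarrow> bool" where
  "is_clique E C \<longleftrightarrow> (\<forall>u\<in>C. \<forall>v\<in>C. u \<noteq> v \<longrightarrow> {u, v} \<in> E)"

definition temporal_clique :: "nat \<Rightarrow> 'a temporal_graph \<Rightarrow> nat \<Rightarrow> bool" where
  "temporal_clique \<Delta> G k \<longleftrightarrow>
     (\<exists>V'. V' \<subseteq> verts G \<and> card V' \<ge> k \<and> is_clique (association_edges G \<Delta>) V')"


section \<open>Random access machine\<close>

text \<open>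
  A unit-cost random access machine over the natural numbers, with addition and truncated
  subtraction as its only arithmetic (no unit-cost multiplication, division or bit operations).
  A program mentions finitely many registers; the memory is reached only by indirect addressing.
  Control flow is structured; this agrees with jumps up to a constant factor in time.
\<close>

datatype com =
    Const nat nat        \<comment> \<open>\<open>R[i] := c\<close>\<close>
  | Add nat nat nat      \<comment> \<open>\<open>R[i] := R[j] + R[k]\<close>\<close>
  | Sub nat nat nat      \<comment> \<open>\<open>R[i] := R[j] - R[k]\<close>\<close>
  | Load nat nat         \<comment> \<open>\<open>R[i] := M[R[j]]\<close>\<close>
  | Store nat nat        \<comment> \<open>\<open>M[R[i]] := R[j]\<close>\<close>
  | Seq com com
  | If nat com com       \<comment> \<open>branch on \<open>R[i] \<noteq> 0\<close>\<close>
  | While nat com        \<comment> \<open>loop while \<open>R[i] \<noteq> 0\<close>\<close>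

type_synonym state = "(nat \<Rightarrow> nat) \<times> (nat \<Rightarrow> nat)"

text \<open>\<open>exec P s t s'\<close>: started in \<open>s\<close>, the program \<open>P\<close> halts in \<open>s'\<close> after exactly \<open>t\<close> steps.\<close>

inductive exec :: "com \<Rightarrow> state \<Rightarrow> nat \<Rightarrow> state \<Rightarrow> bool" where
  Const: "exec (Const i c) (R, M) 1 (R(i := c), M)"
| Add: "exec (Add i j k) (R, M) 1 (R(i := R j + R k), M)"
| Sub: "exec (Sub i j k) (R, M) 1 (R(i := R j - R k), M)"
| Load: "exec (Load i j) (R, M) 1 (R(i := M (R j)), M)"
| Store: "exec (Store i j) (R, M) 1 (R, M(R i := R j))"
| Seq: "exec P s t s' \<Longrightarrow> exec Q s' t' s'' \<Longrightarrow> exec (Seq P Q) s (t + t') s''"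
| IfTrue: "fst s i \<noteq> 0 \<Longrightarrow> exec P s t s' \<Longrightarrow> exec (If i P Q) s (Suc t) s'"
| IfFalse: "fst s i = 0 \<Longrightarrow> exec Q s t s' \<Longrightarrow> exec (If i P Q) s (Suc t) s'"
| WhileFalse: "fst s i = 0 \<Longrightarrow> exec (While i P) s 1 s"
| WhileTrue: "fst s i \<noteq> 0 \<Longrightarrow> exec P s t s' \<Longrightarrow> exec (While i P) s' t' s'' \<Longrightarrow>
    exec (While i P) s (Suc (t + t')) s''"

inductive_cases exec_elims:
  "exec (Const i c) s t s'" "exec (Add i j k) s t s'" "exec (Sub i j k) s t s'"
  "exec (Load i j) s t s'" "exec (Store i j) s t s'"
inductive_cases SeqE: "exec (Seq P Q) s t s'"
inductive_cases IfE: "exec (If i P Q) s t s'"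
inductive_cases WhileE: "exec (While i P) s t s'"

lemma exec_deterministic:
  "exec P s t s' \<Longrightarrow> exec P s u s'' \<Longrightarrow> t = u \<and> s' = s''"
proof (induction arbitrary: u s'' rule: exec.induct)
  case (Seq P s t s' Q t' s2)
  from Seq.prems show ?case
    by (rule SeqE) (simp, drule Seq.IH(1), elim conjE, hypsubst, drule Seq.IH(2), simp)
next
  case (IfTrue s i P t s' Q)
  from IfTrue.prems show ?case
    by (rule IfE) (use IfTrue.hyps(1) in \<open>simp_all, drule_tac IfTrue.IH, simp\<close>)
next
  case (IfFalse s i Q t s' P)
  from IfFalse.prems show ?case
    by (rule IfE) (use IfFalse.hyps(1) in \<open>simp_all, drule_tac IfFalse.IH, simp\<close>)
next
  case (WhileFalse s i P)
  from WhileFalse.prems show ?case by (rule WhileE) (use WhileFalse.hyps in simp_all)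
next
  case (WhileTrue s i P t s' t' s2)
  from WhileTrue.prems show ?case
    by (rule WhileE) (use WhileTrue.hyps(1) in
      \<open>simp_all, drule_tac WhileTrue.IH(1), elim conjE, hypsubst, drule_tac WhileTrue.IH(2), simp\<close>)
qed (elim exec_elims; simp)+

text \<open>The input word list is placed at memory addresses \<open>0, 1, \<dots>\<close>; everything else is \<open>0\<close>.\<close>

definition init_state :: "nat list \<Rightarrow> state" where
  "init_state xs = (\<lambda>_. 0, \<lambda>a. if a < length xs then xs ! a else 0)"


section \<open>Input encodings\<close>

text \<open>
  Both encodings number the vertices by a list \<open>vs\<close>. The first one gives a layer as the list of its
  edges, each edge once, as a pair of vertex numbers.
\<close>

definition edge_encoding :: "'a temporal_graph \<Rightarrow> nat \<Rightarrow> nat \<Rightarrow> nat list \<Rightarrow> bool" where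
  "edge_encoding G \<Delta> k xs \<longleftrightarrow> (\<exists>vs es.
     distinct vs \<and> set vs = verts G \<and>
     (\<forall>t\<in>{1..lifetime G}.
        set (es t) \<subseteq> {..<length vs} \<times> {..<length vs} \<and>
        distinct (map (\<lambda>(i, j). {vs ! i, vs ! j}) (es t)) \<and>
        layer G t = set (map (\<lambda>(i, j). {vs ! i, vs ! j}) (es t))) \<and>
     xs = [length vs, lifetime G, \<Delta>, k] @
       concat (map (\<lambda>t. length (es t) # concat (map (\<lambda>(i, j). [i, j]) (es t))) [1..<lifetime G + 1]))"

text \<open>
  The second one gives a layer by its intervals \<open>[x, x + 1]\<close>. The rational left end point
  \<open>x = q + r / d\<close> takes two words, its integer part \<open>q\<close> and the numerator \<open>r\<close> of its fractional
  part over a common denominator \<open>d\<close>. Lemma \<open>interval_encoding_exists\<close> below shows that every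
  temporal unit interval graph can be given in this way.
\<close>

definition interval_encoding :: "'a temporal_graph \<Rightarrow> nat \<Rightarrow> nat \<Rightarrow> nat list \<Rightarrow> bool" where
  "interval_encoding G \<Delta> k xs \<longleftrightarrow> (\<exists>vs d q r.
     distinct vs \<and> set vs = verts G \<and>
     (\<forall>t\<in>{1..lifetime G}.
        (\<forall>v\<in>verts G. r t v < d) \<and>
        layer G t = interval_edges (verts G) (\<lambda>v. real (q t v) + real (r t v) / real d) 1) \<and>
     xs = [length vs, lifetime G, \<Delta>, k, d] @
       concat (map (\<lambda>t. concat (map (\<lambda>v. [q t v, r t v]) vs)) [1..<lifetime G + 1]))"


section \<open>Solving Temporal Clique on temporal unit interval graphs\<close>

text \<open>
  \<open>P\<close> decides every instance whose graph is a temporal unit interval graph, in whichever of its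
  \<open>enc\<close>-encodings it is given, within \<open>T (\<Delta>, \<tau>, k, n, N)\<close> steps, where \<open>N\<close> is the number of
  words of the input. The answer is read off register \<open>0\<close>.
\<close>

definition solves_temporal_clique ::
  "com \<Rightarrow> (nat temporal_graph \<Rightarrow> nat \<Rightarrow> nat \<Rightarrow> nat list \<Rightarrow> bool) \<Rightarrow>
   (nat \<times> nat \<times> nat \<times> nat \<times> nat \<Rightarrow> nat) \<Rightarrow> bool" where
  "solves_temporal_clique P enc T \<longleftrightarrow>
     (\<forall>G \<Delta> k xs. temporal_unit_interval_graph G \<and> 1 \<le> \<Delta> \<and> \<Delta> \<le> lifetime G \<and> enc G \<Delta> k xs \<longrightarrow>
        (\<exists>t R M. exec P (init_state xs) t (R, M) \<and>
           t \<le> T (\<Delta>, lifetime G, k, card (verts G), length xs) \<and>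
           R 0 = (if temporal_clique \<Delta> G k then 1 else 0)))"

text \<open>For \<open>k < 2\<close> the truncated subtraction makes the exponent \<open>0\<close>.\<close>

definition clique_time :: "nat \<Rightarrow> nat \<Rightarrow> nat \<Rightarrow> nat \<Rightarrow> real" where
  "clique_time \<Delta> \<tau> k n = 2 ^ ((k - 2) * (2 * \<Delta>) ^ (\<tau> - \<Delta> + 1)) * real n"


section \<open>Every temporal unit interval graph has an interval encoding\<close>

lemma interval_edges_alt:
  assumes "len \<ge> 0"
  shows "interval_edges V l len = {{u, v} | u v. u \<in> V \<and> v \<in> V \<and> u \<noteq> v \<and> \<bar>l u - l v\<bar> \<le> len}"
proof -
  have "{l u..l u + len} \<inter> {l v..l v + len} \<noteq> {} \<longleftrightarrow> \<bar>l u - l v\<bar> \<le> len" for u v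
    using assms by auto
  then show ?thesis unfolding interval_edges_def by simp
qed

lemma unit_interval_graph_grid:
  assumes "finite V" and "unit_interval_graph V E"
  shows "\<exists>D. \<forall>d\<ge>D. \<exists>p :: 'a \<Rightarrow> nat. E = interval_edges V (\<lambda>v. real (p v) / real d) 1"
proof -
  obtain l0 len where len: "len > 0" and E: "E = interval_edges V l0 len"
    using assms(2) unfolding unit_interval_graph_def by blast
  define A where "A = insert 2 ((\<lambda>(u, v). \<bar>l0 u - l0 v\<bar> / len) ` (V \<times> V) \<inter> {1<..})"
  have "finite A" unfolding A_def using assms(1) by auto
  define g where "g = Min A"
  have "A \<noteq> {}" and "\<forall>a\<in>A. a > 1" unfolding A_def by auto
  then have g: "g > 1" unfolding g_def using \<open>finite A\<close> by simp
  have gap: "\<bar>l0 u - l0 v\<bar> / len \<ge> g" if "u \<in> V" "v \<in> V" "\<bar>l0 u - l0 v\<bar> > len" for u v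
  proof -
    have "\<bar>l0 u - l0 v\<bar> / len \<in> A" unfolding A_def using that len by force
    then show ?thesis unfolding g_def using \<open>finite A\<close> by simp
  qed
  define s where "s = 2 / (1 + g)"
  have s: "0 < s" "s < 1" "s * g > 1" using g unfolding s_def by (auto simp: field_simps)
  define e where "e = min (1 - s) (s * g - 1)"
  have e: "e > 0" using s unfolding e_def by simp
  define b where "b = Min (insert 0 (l0 ` V))"
  have b: "b \<le> l0 v" if "v \<in> V" for v unfolding b_def using that assms(1) by simp
  define l where "l v = s * ((l0 v - b) / len)" for v
  have l0: "l v \<ge> 0" if "v \<in> V" for v unfolding l_def using that b s len by simp
  have ldiff: "\<bar>l u - l v\<bar> = s * (\<bar>l0 u - l0 v\<bar> / len)" for u v
  proof -
    have "l u - l v = s * ((l0 u - l0 v) / len)" unfolding l_def using len by (simp add: field_simps)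
    then show ?thesis using s len by (simp add: abs_mult)
  qed
  have near: "\<bar>l u - l v\<bar> \<le> 1 - e" if "\<bar>l0 u - l0 v\<bar> \<le> len" for u v
  proof -
    have "\<bar>l0 u - l0 v\<bar> / len \<le> 1" using that len by simp
    then have "s * (\<bar>l0 u - l0 v\<bar> / len) \<le> s * 1" using s by (intro mult_left_mono) auto
    then show ?thesis unfolding ldiff e_def by linarith
  qed
  have far: "\<bar>l u - l v\<bar> \<ge> 1 + e" if "u \<in> V" "v \<in> V" "\<bar>l0 u - l0 v\<bar> > len" for u v
  proof -
    have "s * (\<bar>l0 u - l0 v\<bar> / len) \<ge> s * g" using gap[OF that] s by (intro mult_left_mono) auto
    then show ?thesis unfolding ldiff e_def by linarith
  qed
  obtain D :: nat where D: "real D > 1 / e" using reals_Archimedean2 by blast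
  have "\<exists>p :: 'a \<Rightarrow> nat. E = interval_edges V (\<lambda>v. real (p v) / real d) 1" if "d \<ge> D" for d
  proof -
    have "real d > 1 / e" using D that by linarith
    moreover have "1 / e > 0" using e by simp
    ultimately have d: "real d > 0" by linarith
    with \<open>real d > 1 / e\<close> e have de: "1 / real d < e" by (simp add: field_simps)
    define p where "p v = nat \<lfloor>l v * real d\<rfloor>" for v
    have approx: "real (p v) / real d \<le> l v" "l v < real (p v) / real d + 1 / real d" if "v \<in> V" for v
    proof -
      have "0 \<le> l v * real d" using l0[OF that] by simp
      then have "real (p v) = of_int \<lfloor>l v * real d\<rfloor>" unfolding p_def by simp
      then have "real (p v) \<le> l v * real d" "l v * real d < real (p v) + 1" by linarith+
      then show "real (p v) / real d \<le> l v" "l v < real (p v) / real d + 1 / real d"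
        using d by (auto simp: field_simps)
    qed
    have iff: "\<bar>l0 u - l0 v\<bar> \<le> len \<longleftrightarrow> \<bar>real (p u) / real d - real (p v) / real d\<bar> \<le> 1"
      if "u \<in> V" "v \<in> V" for u v
    proof (cases "\<bar>l0 u - l0 v\<bar> \<le> len")
      case True
      then show ?thesis using near[OF True] approx[OF that(1)] approx[OF that(2)] de by linarith
    next
      case False
      then have "\<bar>l u - l v\<bar> \<ge> 1 + e" using far that by simp
      then show ?thesis using False approx[OF that(1)] approx[OF that(2)] de by linarith
    qed
    have "E = interval_edges V (\<lambda>v. real (p v) / real d) 1"
      unfolding E using len by (simp add: interval_edges_alt) (use iff in blast)
    then show ?thesis by blast
  qed
  then show ?thesis by blast
qed

lemma interval_encoding_exists:
  assumes "temporal_unit_interval_graph G"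
  shows "\<exists>xs. interval_encoding G \<Delta> k xs"
proof -
  have fin: "finite (verts G)"
    using assms unfolding temporal_unit_interval_graph_def temporal_graph_def by simp
  have "\<forall>t\<in>{1..lifetime G}. \<exists>D. \<forall>d\<ge>D. \<exists>p :: 'a \<Rightarrow> nat.
      layer G t = interval_edges (verts G) (\<lambda>v. real (p v) / real d) 1"
    using assms unit_interval_graph_grid[OF fin]
    unfolding temporal_unit_interval_graph_def by blast
  then obtain D where D: "\<forall>t\<in>{1..lifetime G}. \<forall>d\<ge>D t. \<exists>p :: 'a \<Rightarrow> nat.
      layer G t = interval_edges (verts G) (\<lambda>v. real (p v) / real d) 1"
    by metis
  define d where "d = Suc (\<Sum>t\<in>{1..lifetime G}. D t)"
  have "D t \<le> d" if "t \<in> {1..lifetime G}" for t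
    unfolding d_def using member_le_sum[of t "{1..lifetime G}" D] that by simp
  then have "\<forall>t\<in>{1..lifetime G}. \<exists>p :: 'a \<Rightarrow> nat.
      layer G t = interval_edges (verts G) (\<lambda>v. real (p v) / real d) 1"
    using D by blast
  then obtain p :: "nat \<Rightarrow> 'a \<Rightarrow> nat" where p: "\<forall>t\<in>{1..lifetime G}.
      layer G t = interval_edges (verts G) (\<lambda>v. real (p t v) / real d) 1"
    by metis
  obtain vs where vs: "distinct vs" "set vs = verts G"
    using finite_distinct_list[OF fin] by blast
  have split: "real (m div d) + real (m mod d) / real d = real m / real d" for m
  proof -
    have "real m = real (m div d) * real d + real (m mod d)"
      by (metis div_mult_mod_eq of_nat_add of_nat_mult)
    moreover have "d > 0" unfolding d_def by simp
    ultimately show ?thesis by (simp add: field_simps)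
  qed
  have "\<forall>t\<in>{1..lifetime G}. (\<forall>v\<in>verts G. p t v mod d < d) \<and>
      layer G t = interval_edges (verts G)
        (\<lambda>v. real (p t v div d) + real (p t v mod d) / real d) 1"
    using p unfolding split by (simp add: d_def)
  with vs have "\<exists>vs d q r. distinct vs \<and> set vs = verts G \<and>
     (\<forall>t\<in>{1..lifetime G}. (\<forall>v\<in>verts G. r t v < d) \<and>
        layer G t = interval_edges (verts G) (\<lambda>v. real (q t v) + real (r t v) / real d) 1)"
    by (intro exI[of _ vs] exI[of _ d] exI[of _ "\<lambda>t v. p t v div d"]
      exI[of _ "\<lambda>t v. p t v mod d"] conjI)
  then show ?thesis unfolding interval_encoding_def by blast
qed

end

theory Submission
  imports Defs "HOL-Library.FuncSet"
begin

text \<open>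
  Let \<open>w = \<tau> - \<Delta> + 1\<close> be the number of windows. In a unit interval graph the left and the right
  neighbours of a vertex each form a clique. A neighbour of \<open>v\<close> in the association graph can choose for
  every window a layer containing the edge and a side of \<open>v\<close>; neighbours with equal choices form a
  clique. So a vertex with more than \<open>(k - 2) * (2 * \<Delta>) ^ w\<close> neighbours lies in a clique of size
  \<open>k\<close>, and otherwise all subsets of its neighbourhood can be inspected. Tabulating the cliques of the
  first \<open>i\<close> neighbours by doubling the table costs \<open>O (2 ^ i)\<close> in step \<open>i\<close>, hence \<open>O (2 ^ m)\<close>
  for \<open>m\<close> neighbours, with no polynomial factor.

  The association graph is found from edge lists in linear time, because memory is initially \<open>0\<close> and
  a quadratic table of last occurrences needs no initialisation. From interval lists, quadratically
  many pairs would be too expensive. Each vertex is entered into buckets, one for every choice of a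
  layer per window and of the integer part of the end point in this layer, rounded up or not.
  Adjacent vertices share a bucket. A bucket with \<open>k * (2 * \<Delta>) ^ w\<close> members contains a clique of
  size \<open>k\<close>, so only a bounded number of pairs per vertex has to be tested. The buckets are the leaves
  of a trie, since their keys are too large to be computed without multiplication.
\<close>

section \<open>A structured language with arrays, compiled to the machine\<close>

datatype exp =
    Lit nat
  | Reg nat
  | Inp exp
  | Ar nat exp
  | Plus exp exp  (infixl ".+" 65)
  | Minus exp exp  (infixl ".-" 65)

datatype cmd =
    Asg nat exp  (infix "::=" 61)
  | Put nat exp exp
  | Sq cmd cmd  (infixr ";;" 60)
  | Cond exp cmd cmd
  | Loop exp cmd

type_synonym regs = "nat \<Rightarrow> nat"
type_synonym arrays = "nat \<Rightarrow> nat \<Rightarrow> nat"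

primrec ev :: "(nat \<Rightarrow> nat) \<Rightarrow> exp \<Rightarrow> regs \<Rightarrow> arrays \<Rightarrow> nat" where
  "ev x (Lit c) R A = c"
| "ev x (Reg v) R A = R v"
| "ev x (Inp e) R A = x (ev x e R A)"
| "ev x (Ar a e) R A = A a (ev x e R A)"
| "ev x (e .+ f) R A = ev x e R A + ev x f R A"
| "ev x (e .- f) R A = ev x e R A - ev x f R A"

inductive big :: "(nat \<Rightarrow> nat) \<Rightarrow> cmd \<Rightarrow> regs \<times> arrays \<Rightarrow> nat \<Rightarrow> regs \<times> arrays \<Rightarrow> bool" for x where
  Asg: "big x (v ::= e) (R, A) 1 (R(v := ev x e R A), A)"
| Put: "big x (Put a i e) (R, A) 1 (R, A(a := (A a)(ev x i R A := ev x e R A)))"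
| Sq: "big x c s t s' \<Longrightarrow> big x d s' t' s'' \<Longrightarrow> big x (c ;; d) s (t + t') s''"
| CondT: "ev x e R A \<noteq> 0 \<Longrightarrow> big x c (R, A) t s' \<Longrightarrow> big x (Cond e c d) (R, A) (Suc t) s'"
| CondF: "ev x e R A = 0 \<Longrightarrow> big x d (R, A) t s' \<Longrightarrow> big x (Cond e c d) (R, A) (Suc t) s'"
| LoopF: "ev x e R A = 0 \<Longrightarrow> big x (Loop e c) (R, A) 1 (R, A)"
| LoopT: "ev x e R A \<noteq> 0 \<Longrightarrow> big x c (R, A) t s' \<Longrightarrow> big x (Loop e c) s' t' s'' \<Longrightarrow>
    big x (Loop e c) (R, A) (Suc (t + t')) s''"

inductive_cases AsgE: "big x (v ::= e) s t s'"
inductive_cases PutE: "big x (Put a i e) s t s'"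
inductive_cases SqE: "big x (c ;; d) s t s'"
inductive_cases CondE: "big x (Cond e c d) s t s'"

text \<open>
  Array \<open>a\<close> of the 16 arrays keeps entry \<open>i\<close> at address \<open>b + 16 * i + a\<close>, where the register \<open>T\<close>
  holds an address \<open>b\<close> behind the input. Registers above \<open>T\<close> are scratch space.
\<close>

definition slot :: "nat \<Rightarrow> nat \<Rightarrow> nat \<Rightarrow> com" where
  "slot T a r = Seq (Add r r r) (Seq (Add r r r) (Seq (Add r r r) (Seq (Add r r r)
     (Seq (Add r r T) (Seq (Const (Suc r) a) (Add r r (Suc r)))))))"

primrec ce :: "nat \<Rightarrow> exp \<Rightarrow> nat \<Rightarrow> com" where
  "ce T (Lit c) r = Const r c"
| "ce T (Reg v) r = Seq (Const r 0) (Add r r v)"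
| "ce T (Inp e) r = Seq (ce T e r) (Seq (Sub (Suc r) T r) (If (Suc r) (Load r r) (Const r 0)))"
| "ce T (Ar a e) r = Seq (ce T e r) (Seq (slot T a r) (Load r r))"
| "ce T (e .+ f) r = Seq (ce T e r) (Seq (ce T f (Suc r)) (Add r r (Suc r)))"
| "ce T (e .- f) r = Seq (ce T e r) (Seq (ce T f (Suc r)) (Sub r r (Suc r)))"

primrec ecost :: "exp \<Rightarrow> nat" where
  "ecost (Lit c) = 1"
| "ecost (Reg v) = 2"
| "ecost (Inp e) = ecost e + 3"
| "ecost (Ar a e) = ecost e + 8"
| "ecost (e .+ f) = ecost e + ecost f + 1"
| "ecost (e .- f) = ecost e + ecost f + 1"

primrec wfe :: "nat \<Rightarrow> exp \<Rightarrow> bool" where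
  "wfe T (Lit c) = True"
| "wfe T (Reg v) = (v < T)"
| "wfe T (Inp e) = wfe T e"
| "wfe T (Ar a e) = (a < 16 \<and> wfe T e)"
| "wfe T (e .+ f) = (wfe T e \<and> wfe T f)"
| "wfe T (e .- f) = (wfe T e \<and> wfe T f)"

primrec ccom :: "nat \<Rightarrow> cmd \<Rightarrow> com" where
  "ccom T (v ::= e) = Seq (ce T e (Suc T)) (Seq (Const v 0) (Add v v (Suc T)))"
| "ccom T (Put a i e) = Seq (ce T i (Suc T)) (Seq (slot T a (Suc T))
     (Seq (ce T e (Suc (Suc T))) (Store (Suc T) (Suc (Suc T)))))"
| "ccom T (c ;; d) = Seq (ccom T c) (ccom T d)"
| "ccom T (Cond e c d) = Seq (ce T e (Suc T)) (If (Suc T) (ccom T c) (ccom T d))"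
| "ccom T (Loop e c) = Seq (ce T e (Suc T)) (While (Suc T) (Seq (ccom T c) (ce T e (Suc T))))"

primrec wfc :: "nat \<Rightarrow> cmd \<Rightarrow> bool" where
  "wfc T (v ::= e) = (v < T \<and> wfe T e)"
| "wfc T (Put a i e) = (a < 16 \<and> wfe T i \<and> wfe T e)"
| "wfc T (c ;; d) = (wfc T c \<and> wfc T d)"
| "wfc T (Cond e c d) = (wfe T e \<and> wfc T c \<and> wfc T d)"
| "wfc T (Loop e c) = (wfe T e \<and> wfc T c)"

primrec ccost :: "cmd \<Rightarrow> nat" where
  "ccost (v ::= e) = ecost e + 2"
| "ccost (Put a i e) = ecost i + ecost e + 8"
| "ccost (c ;; d) = ccost c + ccost d"
| "ccost (Cond e c d) = ecost e + 1 + ccost c + ccost d"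
| "ccost (Loop e c) = ecost e + 1 + ccost c"

definition represents :: "(nat \<Rightarrow> nat) \<Rightarrow> nat \<Rightarrow> nat \<Rightarrow> regs \<times> arrays \<Rightarrow> state \<Rightarrow> bool" where
  "represents x b T s s' \<longleftrightarrow> (\<forall>v<T. fst s' v = fst s v) \<and> fst s' T = b \<and>
     (\<forall>p. snd s' p = (if p < b then x p else snd s ((p - b) mod 16) ((p - b) div 16))) \<and>
     (\<forall>p\<ge>b. x p = 0)"

lemma exec_simps:
  "exec (Const i c) (R, M) t s \<longleftrightarrow> t = 1 \<and> s = (R(i := c), M)"
  "exec (Add i j k) (R, M) t s \<longleftrightarrow> t = 1 \<and> s = (R(i := R j + R k), M)"
  "exec (Sub i j k) (R, M) t s \<longleftrightarrow> t = 1 \<and> s = (R(i := R j - R k), M)"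
  "exec (Load i j) (R, M) t s \<longleftrightarrow> t = 1 \<and> s = (R(i := M (R j)), M)"
  "exec (Store i j) (R, M) t s \<longleftrightarrow> t = 1 \<and> s = (R, M(R i := R j))"
  by (auto intro: exec.intros[unfolded One_nat_def] elim!: exec_elims)

lemma exec_Seq_step:
  assumes P: "\<And>t s. exec P (R, M) t s \<longleftrightarrow> t = 1 \<and> s = s1"
  shows "exec (Seq P Q) (R, M) (Suc t) s \<longleftrightarrow> exec Q s1 t s"
proof
  assume "exec (Seq P Q) (R, M) (Suc t) s"
  then show "exec Q s1 t s" by (rule SeqE) (simp add: P)
next
  assume "exec Q s1 t s"
  then have "exec (Seq P Q) (R, M) (1 + t) s" by (intro exec.Seq) (simp_all add: P)
  then show "exec (Seq P Q) (R, M) (Suc t) s" by simp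
qed

lemmas exec_Seq_simps =
  exec_simps(1)[THEN exec_Seq_step] exec_simps(2)[THEN exec_Seq_step]
  exec_simps(3)[THEN exec_Seq_step] exec_simps(4)[THEN exec_Seq_step]
  exec_simps(5)[THEN exec_Seq_step]

lemma exec_slot:
  assumes "T < r"
  shows "\<exists>R'. exec (slot T a r) (R, M) 7 (R', M) \<and> R' r = R T + 16 * R r + a \<and> (\<forall>v<r. R' v = R v)"
  using assms unfolding slot_def by (simp add: exec_Seq_simps exec_simps numeral_eq_Suc)

lemma represents_regs:
  assumes "represents x b T s (R, M)" and "\<forall>v\<le>T. R' v = R v"
  shows "represents x b T s (R', M)"
  using assms unfolding represents_def by auto

lemma represents_array:
  assumes "represents x b T (R, A) (R', M)" and "a < 16"
  shows "M (b + 16 * i + a) = A a i"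
  using assms unfolding represents_def by (simp add: add.assoc)

lemma exec_ce:
  assumes "represents x b T (R, A) (R', M)" and "wfe T e" and "T < r"
  shows "\<exists>R''. exec (ce T e r) (R', M) (ecost e) (R'', M) \<and> R'' r = ev x e R A \<and> (\<forall>v<r. R'' v = R' v)"
  using assms
proof (induction e arbitrary: r R')
  case (Lit c)
  then show ?case by (simp add: exec_simps)
next
  case (Reg v)
  then show ?case
    by (simp add: exec_Seq_simps exec_simps numeral_eq_Suc represents_def)
next
  case (Inp e)
  obtain R1 where R1: "exec (ce T e r) (R', M) (ecost e) (R1, M)" "R1 r = ev x e R A"
    "\<forall>v<r. R1 v = R' v" using Inp.IH[OF Inp.prems(1) _ Inp.prems(3)] Inp.prems(2) by auto
  let ?p = "ev x e R A"
  have T: "R1 T = b" using R1 Inp.prems unfolding represents_def by simp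
  have "\<exists>R2. exec (If (Suc r) (Load r r) (Const r 0)) (R1(Suc r := b - ?p), M) 2 (R2, M) \<and>
    R2 r = x ?p \<and> (\<forall>v<r. R2 v = R1 v)"
  proof (cases "?p < b")
    case True
    then have "exec (If (Suc r) (Load r r) (Const r 0)) (R1(Suc r := b - ?p), M) (Suc 1)
      (R1(Suc r := b - ?p, r := x ?p), M)"
      using R1 Inp.prems(1) by (intro exec.IfTrue) (auto simp: exec_simps represents_def)
    then show ?thesis unfolding One_nat_def numeral_2_eq_2 by (intro exI conjI) (assumption | simp)+
  next
    case False
    then have "exec (If (Suc r) (Load r r) (Const r 0)) (R1(Suc r := b - ?p), M) (Suc 1)
      (R1(Suc r := b - ?p, r := x ?p), M)"
      using R1 Inp.prems(1) by (intro exec.IfFalse) (auto simp: exec_simps represents_def)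
    then show ?thesis unfolding One_nat_def numeral_2_eq_2 by (intro exI conjI) (assumption | simp)+
  qed
  then obtain R2 where R2: "exec (If (Suc r) (Load r r) (Const r 0)) (R1(Suc r := b - ?p), M) 2 (R2, M)"
    "R2 r = x ?p" "\<forall>v<r. R2 v = R1 v" by blast
  have "exec (Seq (Sub (Suc r) T r) (If (Suc r) (Load r r) (Const r 0))) (R1, M) (1 + 2) (R2, M)"
    by (rule exec.Seq[OF exec.Sub]) (use R2(1) R1(2) T in simp)
  then have "exec (ce T (Inp e) r) (R', M) (ecost e + (1 + 2)) (R2, M)"
    unfolding ce.simps by (rule exec.Seq[OF R1(1)])
  then have "exec (ce T (Inp e) r) (R', M) (ecost (Inp e)) (R2, M)" by (simp add: numeral_3_eq_3)
  moreover have "R2 r = ev x (Inp e) R A" and "\<forall>v<r. R2 v = R' v" using R2 R1 by auto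
  ultimately show ?case by blast
next
  case (Ar a e)
  obtain R1 where R1: "exec (ce T e r) (R', M) (ecost e) (R1, M)" "R1 r = ev x e R A"
    "\<forall>v<r. R1 v = R' v" using Ar.IH[OF Ar.prems(1) _ Ar.prems(3)] Ar.prems(2) by auto
  obtain R2 where R2: "exec (slot T a r) (R1, M) 7 (R2, M)" "R2 r = R1 T + 16 * R1 r + a"
    "\<forall>v<r. R2 v = R1 v" using exec_slot Ar.prems(3) by blast
  have "R1 T = b" using R1 Ar.prems unfolding represents_def by simp
  then have "M (R2 r) = A a (ev x e R A)"
    using R2(2) R1(2) represents_array[OF Ar.prems(1)] Ar.prems(2) by simp
  moreover have "exec (ce T (Ar a e) r) (R', M) (ecost e + (7 + 1)) (R2(r := M (R2 r)), M)"
    unfolding ce.simps by (rule exec.Seq[OF R1(1) exec.Seq[OF R2(1) exec.Load]])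
  ultimately show ?case using R1 R2 by auto
next
  case (Plus e f)
  obtain R1 where R1: "exec (ce T e r) (R', M) (ecost e) (R1, M)" "R1 r = ev x e R A"
    "\<forall>v<r. R1 v = R' v" using Plus.IH(1)[OF Plus.prems(1) _ Plus.prems(3)] Plus.prems(2) by auto
  then have "represents x b T (R, A) (R1, M)"
    using represents_regs[OF Plus.prems(1)] Plus.prems(3) by simp
  then obtain R2 where R2: "exec (ce T f (Suc r)) (R1, M) (ecost f) (R2, M)" "R2 (Suc r) = ev x f R A"
    "\<forall>v<Suc r. R2 v = R1 v" using Plus.IH(2)[of R1 "Suc r"] Plus.prems(2,3) by auto
  have "exec (ce T (e .+ f) r) (R', M) (ecost e + (ecost f + 1)) (R2(r := R2 r + R2 (Suc r)), M)"
    unfolding ce.simps by (rule exec.Seq[OF R1(1) exec.Seq[OF R2(1) exec.Add]])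
  then show ?case using R1 R2 by auto
next
  case (Minus e f)
  obtain R1 where R1: "exec (ce T e r) (R', M) (ecost e) (R1, M)" "R1 r = ev x e R A"
    "\<forall>v<r. R1 v = R' v" using Minus.IH(1)[OF Minus.prems(1) _ Minus.prems(3)] Minus.prems(2) by auto
  then have "represents x b T (R, A) (R1, M)"
    using represents_regs[OF Minus.prems(1)] Minus.prems(3) by simp
  then obtain R2 where R2: "exec (ce T f (Suc r)) (R1, M) (ecost f) (R2, M)" "R2 (Suc r) = ev x f R A"
    "\<forall>v<Suc r. R2 v = R1 v" using Minus.IH(2)[of R1 "Suc r"] Minus.prems(2,3) by auto
  have "exec (ce T (e .- f) r) (R', M) (ecost e + (ecost f + 1)) (R2(r := R2 r - R2 (Suc r)), M)"
    unfolding ce.simps by (rule exec.Seq[OF R1(1) exec.Seq[OF R2(1) exec.Sub]])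
  then show ?case using R1 R2 by auto
qed

lemma exec_ce_represents:
  assumes "represents x b T (R, A) s" and "wfe T e"
  shows "\<exists>s'. exec (ce T e (Suc T)) s (ecost e) s' \<and> fst s' (Suc T) = ev x e R A \<and>
    represents x b T (R, A) s'"
proof -
  obtain R' M where s: "s = (R', M)" by (cases s)
  with assms exec_ce[of x b T R A R' M e "Suc T"] obtain R'' where
    "exec (ce T e (Suc T)) (R', M) (ecost e) (R'', M)" "R'' (Suc T) = ev x e R A"
    "\<forall>v<Suc T. R'' v = R' v" by auto
  moreover have "represents x b T (R, A) (R'', M)"
    by (rule represents_regs[OF assms(1)[unfolded s]]) (use calculation in auto)
  ultimately show ?thesis using s by force
qed

lemma slot_eq_iff:
  fixes b :: nat
  assumes "p \<ge> b" and "a < 16"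
  shows "p = b + 16 * i + a \<longleftrightarrow> (p - b) mod 16 = a \<and> (p - b) div 16 = i"
proof -
  have "p - b = 16 * ((p - b) div 16) + (p - b) mod 16" by simp
  with assms show ?thesis by auto
qed

lemma exec_comp:
  assumes "big x c s t s'" and "represents x b T s r" and "wfc T c"
  shows "\<exists>t' r'. exec (ccom T c) r t' r' \<and> t' \<le> ccost c * t \<and> represents x b T s' r'"
  using assms
proof (induction arbitrary: r rule: big.induct)
  case (Asg v e R A)
  obtain R' M where r: "exec (ce T e (Suc T)) r (ecost e) (R', M)" "R' (Suc T) = ev x e R A"
    "represents x b T (R, A) (R', M)"
    using exec_ce_represents[OF Asg(1)] Asg(2) by fastforce
  have "exec (ccom T (v ::= e)) r (ecost e + (1 + 1))
      (R'(v := 0, v := (R'(v := 0)) v + (R'(v := 0)) (Suc T)), M)"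
    unfolding ccom.simps by (rule exec.Seq[OF r(1) exec.Seq[OF exec.Const exec.Add]])
  then have "exec (ccom T (v ::= e)) r (ecost e + 2) (R'(v := 0, v := 0 + R' (Suc T)), M)"
    using Asg(2) by simp
  moreover have "represents x b T (R(v := ev x e R A), A) (R'(v := 0, v := 0 + R' (Suc T)), M)"
    using r Asg(2) unfolding represents_def by auto
  moreover have "ecost e + 2 \<le> ccost (v ::= e) * 1" by simp
  ultimately show ?case by blast
next
  case (Put a i e R A)
  obtain R1 M where r: "exec (ce T i (Suc T)) r (ecost i) (R1, M)" "R1 (Suc T) = ev x i R A"
    "represents x b T (R, A) (R1, M)"
    using exec_ce_represents[OF Put(1)] Put(2) by fastforce
  obtain R2 where R2: "exec (slot T a (Suc T)) (R1, M) 7 (R2, M)"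
    "R2 (Suc T) = R1 T + 16 * R1 (Suc T) + a" "\<forall>v<Suc T. R2 v = R1 v"
    using exec_slot[of T "Suc T"] by blast
  have "represents x b T (R, A) (R2, M)"
    by (rule represents_regs[OF r(3)]) (use R2 in auto)
  then obtain R3 where R3: "exec (ce T e (Suc (Suc T))) (R2, M) (ecost e) (R3, M)"
    "R3 (Suc (Suc T)) = ev x e R A" "\<forall>v<Suc (Suc T). R3 v = R2 v"
    using exec_ce[of x b T R A R2 M e "Suc (Suc T)"] Put(2) by auto
  let ?M = "M(R3 (Suc T) := R3 (Suc (Suc T)))"
  have "exec (ccom T (Put a i e)) r (ecost i + (7 + (ecost e + 1))) (R3, ?M)"
    unfolding ccom.simps by (rule exec.Seq[OF r(1) exec.Seq[OF R2(1) exec.Seq[OF R3(1) exec.Store]]])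
  moreover have "R3 (Suc T) = b + 16 * ev x i R A + a"
    using R3 R2 r unfolding represents_def by simp
  then have "represents x b T (R, A(a := (A a)(ev x i R A := ev x e R A))) (R3, ?M)"
    using r(3) R2 R3 Put(2) slot_eq_iff[of b _ a "ev x i R A"] unfolding represents_def
    by auto
  moreover have "ecost i + (7 + (ecost e + 1)) \<le> ccost (Put a i e) * 1" by simp
  ultimately show ?case by blast
next
  case (Sq c s t s' d t' s'')
  obtain u r' where 1: "exec (ccom T c) r u r'" "u \<le> ccost c * t" "represents x b T s' r'"
    using Sq.IH(1)[OF Sq.prems(1)] Sq.prems(2) by auto
  obtain u' r'' where 2: "exec (ccom T d) r' u' r''" "u' \<le> ccost d * t'" "represents x b T s'' r''"
    using Sq.IH(2)[OF 1(3)] Sq.prems(2) by auto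
  have "exec (ccom T (c ;; d)) r (u + u') r''" using 1 2 by (auto intro: exec.Seq)
  moreover have "u + u' \<le> ccost (c ;; d) * (t + t')"
    using 1(2) 2(2) by (simp add: algebra_simps)
  ultimately show ?case using 2(3) by blast
next
  case (CondT e R A c t s' d)
  obtain r1 where r: "exec (ce T e (Suc T)) r (ecost e) r1" "fst r1 (Suc T) = ev x e R A"
    "represents x b T (R, A) r1"
    using exec_ce_represents[OF CondT.prems(1)] CondT.prems(2) by fastforce
  obtain u r' where 1: "exec (ccom T c) r1 u r'" "u \<le> ccost c * t" "represents x b T s' r'"
    using CondT.IH[OF r(3)] CondT.prems(2) by auto
  have "exec (ccom T (Cond e c d)) r (ecost e + Suc u) r'"
    unfolding ccom.simps using r(2) CondT.hyps(1) by (intro exec.Seq[OF r(1)] exec.IfTrue 1(1)) simp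
  moreover have "ecost e + Suc u \<le> ccost (Cond e c d) * Suc t" using 1(2) by (simp add: algebra_simps)
  ultimately show ?case using 1(3) by blast
next
  case (CondF e R A d t s' c)
  obtain r1 where r: "exec (ce T e (Suc T)) r (ecost e) r1" "fst r1 (Suc T) = ev x e R A"
    "represents x b T (R, A) r1"
    using exec_ce_represents[OF CondF.prems(1)] CondF.prems(2) by fastforce
  obtain u r' where 1: "exec (ccom T d) r1 u r'" "u \<le> ccost d * t" "represents x b T s' r'"
    using CondF.IH[OF r(3)] CondF.prems(2) by auto
  have "exec (ccom T (Cond e c d)) r (ecost e + Suc u) r'"
    unfolding ccom.simps using r(2) CondF.hyps(1) by (intro exec.Seq[OF r(1)] exec.IfFalse 1(1)) simp
  moreover have "ecost e + Suc u \<le> ccost (Cond e c d) * Suc t" using 1(2) by (simp add: algebra_simps)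
  ultimately show ?case using 1(3) by blast
next
  case (LoopF e R A c)
  obtain r1 where r: "exec (ce T e (Suc T)) r (ecost e) r1" "fst r1 (Suc T) = ev x e R A"
    "represents x b T (R, A) r1"
    using exec_ce_represents[OF LoopF.prems(1)] LoopF.prems(2) by fastforce
  have "exec (ccom T (Loop e c)) r (ecost e + 1) r1"
    unfolding ccom.simps using r(2) LoopF.hyps(1) by (intro exec.Seq[OF r(1)] exec.WhileFalse) simp
  moreover have "ecost e + 1 \<le> ccost (Loop e c) * 1" by simp
  ultimately show ?case using r(3) by blast
next
  case (LoopT e R A c t s' t' s'')
  obtain r1 where r: "exec (ce T e (Suc T)) r (ecost e) r1" "fst r1 (Suc T) = ev x e R A"
    "represents x b T (R, A) r1"
    using exec_ce_represents[OF LoopT.prems(1)] LoopT.prems(2) by fastforce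
  obtain u r2 where 1: "exec (ccom T c) r1 u r2" "u \<le> ccost c * t" "represents x b T s' r2"
    using LoopT.IH(1)[OF r(3)] LoopT.prems(2) by auto
  obtain u' r' where 2: "exec (ccom T (Loop e c)) r2 u' r'" "u' \<le> ccost (Loop e c) * t'"
    "represents x b T s'' r'"
    using LoopT.IH(2)[OF 1(3)] LoopT.prems(2) by auto
  from 2(1) obtain u1 u2 r3 where 3: "u' = u1 + u2" "exec (ce T e (Suc T)) r2 u1 r3"
    "exec (While (Suc T) (Seq (ccom T c) (ce T e (Suc T)))) r3 u2 r'"
    by (auto elim: SeqE)
  have "exec (ccom T (Loop e c)) r (ecost e + Suc ((u + u1) + u2)) r'"
    unfolding ccom.simps using r(2) LoopT.hyps(1)
    by (intro exec.Seq[OF r(1)] exec.WhileTrue[OF _ exec.Seq[OF 1(1) 3(2)] 3(3)]) simp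
  moreover have "ecost e + Suc ((u + u1) + u2) \<le> ccost (Loop e c) * Suc (t + t')"
    using 1(2) 2(2) 3(1) by (simp add: algebra_simps)
  ultimately show ?case using 2(3) by blast
qed


section \<open>Total correctness with a step bound\<close>

definition runs :: "(nat \<Rightarrow> nat) \<Rightarrow> cmd \<Rightarrow> regs \<Rightarrow> arrays \<Rightarrow> nat \<Rightarrow> (regs \<Rightarrow> arrays \<Rightarrow> bool) \<Rightarrow> bool" where
  "runs x c R A t Q \<longleftrightarrow> (\<exists>t' R' A'. big x c (R, A) t' (R', A') \<and> t' \<le> t \<and> Q R' A')"

primrec mods :: "cmd \<Rightarrow> nat set" where
  "mods (v ::= e) = {v}"
| "mods (Put a i e) = {}"
| "mods (c ;; d) = mods c \<union> mods d"
| "mods (Cond e c d) = mods c \<union> mods d"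
| "mods (Loop e c) = mods c"

primrec amods :: "cmd \<Rightarrow> nat set" where
  "amods (v ::= e) = {}"
| "amods (Put a i e) = {a}"
| "amods (c ;; d) = amods c \<union> amods d"
| "amods (Cond e c d) = amods c \<union> amods d"
| "amods (Loop e c) = amods c"

lemma big_frame:
  assumes "big x c s t s'"
  shows "(\<forall>v. v \<notin> mods c \<longrightarrow> fst s' v = fst s v) \<and> (\<forall>a. a \<notin> amods c \<longrightarrow> snd s' a = snd s a)"
  using assms by induction auto

lemma runs_conseq:
  assumes "runs x c R A t Q" and "t \<le> t'"
    and "\<And>R' A'. Q R' A' \<Longrightarrow> (\<And>v. v \<notin> mods c \<Longrightarrow> R' v = R v) \<Longrightarrow>
      (\<And>a. a \<notin> amods c \<Longrightarrow> A' a = A a) \<Longrightarrow> Q' R' A'"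
  shows "runs x c R A t' Q'"
proof -
  obtain u R' A' where b: "big x c (R, A) u (R', A')" "u \<le> t" "Q R' A'"
    using assms(1) unfolding runs_def by blast
  have "Q' R' A'" using big_frame[OF b(1)] assms(3)[OF b(3)] by simp
  with b assms(2) show ?thesis unfolding runs_def by (meson order_trans)
qed

lemma runs_Sq:
  assumes "runs x c R A t Q"
    and "\<And>R' A'. Q R' A' \<Longrightarrow> (\<And>v. v \<notin> mods c \<Longrightarrow> R' v = R v) \<Longrightarrow>
      (\<And>a. a \<notin> amods c \<Longrightarrow> A' a = A a) \<Longrightarrow> runs x d R' A' t' Q'"
    and "t + t' \<le> t''"
  shows "runs x (c ;; d) R A t'' Q'"
proof -
  obtain u R' A' where b: "big x c (R, A) u (R', A')" "u \<le> t" "Q R' A'"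
    using assms(1) unfolding runs_def by blast
  have "runs x d R' A' t' Q'" using big_frame[OF b(1)] assms(2)[OF b(3)] by simp
  then obtain u' R'' A'' where b': "big x d (R', A') u' (R'', A'')" "u' \<le> t'" "Q' R'' A''"
    unfolding runs_def by blast
  have "big x (c ;; d) (R, A) (u + u') (R'', A'')" by (rule big.Sq[OF b(1) b'(1)])
  moreover have "u + u' \<le> t''" using b(2) b'(2) assms(3) by simp
  ultimately show ?thesis using b'(3) unfolding runs_def by blast
qed

lemma runs_Asg: "runs x (v ::= e) R A t Q \<longleftrightarrow> 1 \<le> t \<and> Q (R(v := ev x e R A)) A"
  unfolding runs_def by (auto elim!: AsgE intro: big.Asg[unfolded One_nat_def])

lemma runs_Put:
  "runs x (Put a i e) R A t Q \<longleftrightarrow> 1 \<le> t \<and> Q R (A(a := (A a)(ev x i R A := ev x e R A)))"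
  unfolding runs_def by (auto elim!: PutE intro: big.Put[unfolded One_nat_def])

lemma runs_Asg_Sq:
  "runs x (v ::= e ;; c) R A t Q \<longleftrightarrow> 1 \<le> t \<and> runs x c (R(v := ev x e R A)) A (t - 1) Q"
proof
  assume "runs x (v ::= e ;; c) R A t Q"
  then show "1 \<le> t \<and> runs x c (R(v := ev x e R A)) A (t - 1) Q"
    unfolding runs_def by (auto elim!: SqE AsgE) fastforce
next
  assume "1 \<le> t \<and> runs x c (R(v := ev x e R A)) A (t - 1) Q"
  then show "runs x (v ::= e ;; c) R A t Q"
    by (intro runs_Sq[where t = 1 and t' = "t - 1" and
      Q = "\<lambda>R' A'. R' = R(v := ev x e R A) \<and> A' = A"]) (auto simp: runs_Asg)
qed

lemma runs_Put_Sq: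
  "runs x (Put a i e ;; c) R A t Q \<longleftrightarrow>
     1 \<le> t \<and> runs x c R (A(a := (A a)(ev x i R A := ev x e R A))) (t - 1) Q"
proof
  assume "runs x (Put a i e ;; c) R A t Q"
  then show "1 \<le> t \<and> runs x c R (A(a := (A a)(ev x i R A := ev x e R A))) (t - 1) Q"
    unfolding runs_def by (auto elim!: SqE PutE) fastforce
next
  assume "1 \<le> t \<and> runs x c R (A(a := (A a)(ev x i R A := ev x e R A))) (t - 1) Q"
  then show "runs x (Put a i e ;; c) R A t Q"
    by (intro runs_Sq[where t = 1 and t' = "t - 1" and
      Q = "\<lambda>R' A'. R' = R \<and> A' = A(a := (A a)(ev x i R A := ev x e R A))"]) (auto simp: runs_Put)
qed

lemma runs_Cond:
  assumes "ev x e R A \<noteq> 0 \<Longrightarrow> runs x c R A t Q" and "ev x e R A = 0 \<Longrightarrow> runs x d R A t Q"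
    and "Suc t \<le> t'"
  shows "runs x (Cond e c d) R A t' Q"
  using assms big.CondT[of x e R A c] big.CondF[of x e R A d] unfolding runs_def
  by (metis (no_types, opaque_lifting) Suc_le_mono order_trans)

definition For :: "nat \<Rightarrow> nat \<Rightarrow> cmd \<Rightarrow> cmd" where
  "For i m c = (i ::= Lit 0 ;; Loop (Reg m .- Reg i) (c ;; i ::= Reg i .+ Lit 1))"

lemma mods_For [simp]: "mods (For i m c) = insert i (mods c)"
  and amods_For [simp]: "amods (For i m c) = amods c"
  and wfc_For [simp]: "wfc T (For i m c) \<longleftrightarrow> i < T \<and> m < T \<and> wfc T c"
  unfolding For_def by auto

text \<open>The loop rule supplies the frame of the whole loop to the body, so \<open>I\<close> only mentions what changes.\<close>

lemma runs_For:
  assumes im: "i \<notin> mods c" "m \<notin> mods c" "i \<noteq> m"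
    and init: "I 0 (R(i := 0)) A"
    and body: "\<And>j R' A'. j < R m \<Longrightarrow> I j R' A' \<Longrightarrow> R' i = j \<Longrightarrow>
      (\<And>v. v \<notin> insert i (mods c) \<Longrightarrow> R' v = R v) \<Longrightarrow> (\<And>a. a \<notin> amods c \<Longrightarrow> A' a = A a) \<Longrightarrow>
      runs x c R' A' (f j) (\<lambda>R'' A''. I (Suc j) (R''(i := Suc j)) A'')"
    and t: "2 + (\<Sum>j<R m. f j + 2) \<le> t"
    and post: "\<And>R' A'. I (R m) R' A' \<Longrightarrow> R' i = R m \<Longrightarrow>
      (\<And>v. v \<notin> insert i (mods c) \<Longrightarrow> R' v = R v) \<Longrightarrow> (\<And>a. a \<notin> amods c \<Longrightarrow> A' a = A a) \<Longrightarrow> Q R' A'"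
  shows "runs x (For i m c) R A t Q"
proof -
  let ?L = "Loop (Reg m .- Reg i) (c ;; i ::= Reg i .+ Lit 1)"
  have loop: "runs x ?L R' A' (1 + (\<Sum>j\<in>{k..<R m}. f j + 2)) Q"
    if "k \<le> R m" "I k R' A'" "R' i = k" "\<And>v. v \<notin> insert i (mods c) \<Longrightarrow> R' v = R v"
      "\<And>a. a \<notin> amods c \<Longrightarrow> A' a = A a" for k R' A'
    using that
  proof (induction "R m - k" arbitrary: k R' A')
    case 0
    then have "k = R m" by simp
    moreover have "R' m = R m" using 0 im by simp
    ultimately have "big x ?L (R', A') 1 (R', A')" using 0 by (intro big.LoopF) simp
    moreover have "Q R' A'" using post[of R' A'] 0 \<open>k = R m\<close> by simp
    ultimately show ?case unfolding runs_def by fastforce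
  next
    case (Suc d)
    then have k: "k < R m" by simp
    have R'm: "R' m = R m" using Suc.prems im by simp
    obtain u R1 A1 where b: "big x c (R', A') u (R1, A1)" "u \<le> f k" "I (Suc k) (R1(i := Suc k)) A1"
      using body[OF k Suc.prems(2-5)] unfolding runs_def by blast
    note fr = big_frame[OF b(1)]
    have R1i: "R1 i = k" using fr im Suc.prems by simp
    then have b1: "big x (c ;; i ::= Reg i .+ Lit 1) (R', A') (u + 1) (R1(i := Suc k), A1)"
      using big.Sq[OF b(1) big.Asg[of x i "Reg i .+ Lit 1" R1 A1]] by simp
    have "runs x ?L (R1(i := Suc k)) A1 (1 + (\<Sum>j\<in>{Suc k..<R m}. f j + 2)) Q"
      by (rule Suc.hyps(1)) (use Suc.hyps(2) Suc.prems k b fr in auto)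
    then obtain u' R2 A2 where b2: "big x ?L (R1(i := Suc k), A1) u' (R2, A2)"
      "u' \<le> 1 + (\<Sum>j\<in>{Suc k..<R m}. f j + 2)" "Q R2 A2"
      unfolding runs_def by blast
    have "big x ?L (R', A') (Suc ((u + 1) + u')) (R2, A2)"
      by (rule big.LoopT[OF _ b1 b2(1)]) (use k R'm Suc.prems in simp)
    moreover have "Suc ((u + 1) + u') \<le> 1 + (\<Sum>j\<in>{k..<R m}. f j + 2)"
      using b(2) b2(2) k by (simp add: sum.atLeast_Suc_lessThan)
    ultimately show ?case using b2(3) unfolding runs_def by blast
  qed
  have "runs x ?L (R(i := 0)) A (1 + (\<Sum>j\<in>{0..<R m}. f j + 2)) Q"
    by (rule loop) (use init in auto)
  moreover have "1 + (\<Sum>j\<in>{0..<R m}. f j + 2) \<le> t - 1"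
    using t by (simp add: atLeast0LessThan)
  ultimately have "runs x ?L (R(i := 0)) A (t - 1) Q" by (rule runs_conseq)
  then show ?thesis unfolding For_def using t by (simp add: runs_Asg_Sq)
qed

lemma runs_compiled:
  assumes "wfc T c" and "runs x c R A t Q" and "represents x b T (R, A) r" and "0 < T"
  shows "\<exists>u r' R' A'. exec (ccom T c) r u r' \<and> u \<le> ccost c * t \<and> fst r' 0 = R' 0 \<and> Q R' A'"
proof -
  obtain u R' A' where b: "big x c (R, A) u (R', A')" "u \<le> t" "Q R' A'"
    using assms(2) unfolding runs_def by blast
  obtain u' r' where "exec (ccom T c) r u' r'" "u' \<le> ccost c * u" "represents x b T (R', A') r'"
    using exec_comp[OF b(1) assms(3,1)] by blast
  moreover have "ccost c * u \<le> ccost c * t" using b(2) by simp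
  ultimately show ?thesis using b(3) assms(4) unfolding represents_def
    by (metis fst_conv order_trans)
qed

section \<open>Cliques in association graphs\<close>

lemma large_fiber:
  assumes "finite S" and "finite C" and "g ` S \<subseteq> C" and "m * card C < card S"
  shows "\<exists>c\<in>C. m < card {u \<in> S. g u = c}"
proof (rule ccontr)
  assume "\<not> ?thesis"
  then have "(\<Sum>c\<in>C. card {u \<in> S. g u = c}) \<le> (\<Sum>c\<in>C. m)" by (intro sum_mono) auto
  moreover have "(\<Sum>c\<in>C. card {u \<in> S. g u = c}) = card S"
    using sum.group[OF assms(1,2,3), of "\<lambda>_. 1::nat"] by simp
  ultimately show False using assms(4) by (simp add: mult.commute)
qed

lemma association_edges_iff:
  "e \<in> association_edges G \<Delta> \<longleftrightarrow> (\<forall>i\<in>{1..lifetime G - \<Delta> + 1}. \<exists>j\<in>{i..i + \<Delta> - 1}. e \<in> layer G j)"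
  unfolding association_edges_def by blast

lemma doubleton_interval_edges:
  assumes "len \<ge> 0"
  shows "{u, v} \<in> interval_edges V l len \<longleftrightarrow> u \<in> V \<and> v \<in> V \<and> u \<noteq> v \<and> \<bar>l u - l v\<bar> \<le> len"
  unfolding interval_edges_alt[OF assms] by (auto simp: doubleton_eq_iff abs_minus_commute)

lemma association_edge_card:
  assumes "temporal_graph G" and "1 \<le> \<Delta>" and "e \<in> association_edges G \<Delta>"
  shows "e \<subseteq> verts G \<and> card e = 2"
proof -
  obtain j where "e \<in> layer G j" using assms(2,3) unfolding association_edges_iff by fastforce
  then show ?thesis using assms(1) unfolding temporal_graph_def layer_def by auto
qed

text \<open>
  In a unit interval graph the neighbours of \<open>v\<close> to the left of \<open>v\<close> form a clique, and so do those to
  the right. Hence choosing, for every window, a layer with the edge and a side of \<open>v\<close> splits the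
  neighbourhood of \<open>v\<close> in the association graph into \<open>(2 * \<Delta>) ^ (\<tau> - \<Delta> + 1)\<close> cliques.
\<close>

lemma large_degree_clique:
  assumes G: "temporal_unit_interval_graph G" and \<Delta>: "1 \<le> \<Delta>" "\<Delta> \<le> lifetime G"
    and S: "finite S" "\<forall>u\<in>S. {v, u} \<in> association_edges G \<Delta>" and k: "2 \<le> k"
    and card: "(k - 2) * (2 * \<Delta>) ^ (lifetime G - \<Delta> + 1) < card S"
  shows "temporal_clique \<Delta> G k"
proof -
  define w where "w = lifetime G - \<Delta> + 1"
  have tg: "temporal_graph G" using G unfolding temporal_unit_interval_graph_def by simp
  have "\<forall>t\<in>{1..lifetime G}. \<exists>l len. len > 0 \<and> layer G t = interval_edges (verts G) l len"
    using G unfolding temporal_unit_interval_graph_def unit_interval_graph_def by blast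
  then obtain l len where L: "\<And>t. t \<in> {1..lifetime G} \<Longrightarrow>
      len t > 0 \<and> layer G t = interval_edges (verts G) (l t) (len t)" by metis
  have "\<forall>u\<in>S. \<forall>i\<in>{1..w}. \<exists>j\<in>{i..i + \<Delta> - 1}. {v, u} \<in> layer G j"
    using S(2) unfolding association_edges_iff w_def by blast
  then obtain f where f: "\<And>u i. u \<in> S \<Longrightarrow> i \<in> {1..w} \<Longrightarrow>
      f u i \<in> {i..i + \<Delta> - 1} \<and> {v, u} \<in> layer G (f u i)" by metis
  define g where "g u = (\<lambda>i\<in>{1..w}. (f u i - i, l (f u i) u \<le> l (f u i) v))" for u
  define C where "C = ({1..w} \<rightarrow>\<^sub>E {..<\<Delta>} \<times> (UNIV :: bool set))"
  have "g ` S \<subseteq> C"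
    unfolding g_def C_def restrict_PiE_iff by (rule image_subsetI) (use f \<Delta> in fastforce)
  moreover have "finite C" unfolding C_def by (intro finite_PiE) auto
  moreover have "card C = (2 * \<Delta>) ^ w"
    unfolding C_def by (simp add: card_PiE mult.commute)
  ultimately obtain c where c: "k - 2 < card {u \<in> S. g u = c}"
    using large_fiber[OF S(1), of C g "k - 2"] card unfolding w_def by auto
  define X where "X = {u \<in> S. g u = c}"
  have sub: "{v, u} \<subseteq> verts G" "u \<noteq> v" if "u \<in> S" for u
    using association_edge_card[OF tg \<Delta>(1)] S(2) that by fastforce+
  have "{u, u'} \<in> association_edges G \<Delta>" if u: "u \<in> X" "u' \<in> X" "u \<noteq> u'" for u u'
    unfolding association_edges_iff
  proof
    fix i assume "i \<in> {1..lifetime G - \<Delta> + 1}"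
    then have i: "i \<in> {1..w}" unfolding w_def .
    have uS: "u \<in> S" "u' \<in> S" and "g u = g u'" using u unfolding X_def by auto
    then have "g u i = g u' i" by simp
    then have e: "f u i - i = f u' i - i"
        "(l (f u i) u \<le> l (f u i) v) = (l (f u' i) u' \<le> l (f u' i) v)"
      unfolding g_def using i by auto
    define j where "j = f u i"
    have j: "j \<in> {i..i + \<Delta> - 1}" "f u' i = j"
      unfolding j_def using f[OF uS(1) i] f[OF uS(2) i] e(1) by auto
    have jl: "j \<in> {1..lifetime G}" using j(1) i \<Delta> unfolding w_def by auto
    have E: "{a, b} \<in> layer G j \<longleftrightarrow> a \<in> verts G \<and> b \<in> verts G \<and> a \<noteq> b \<and> \<bar>l j a - l j b\<bar> \<le> len j"
      for a b
      using L[OF jl] doubleton_interval_edges[of "len j" a b "verts G" "l j"] by simp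
    have "\<bar>l j v - l j u\<bar> \<le> len j" "\<bar>l j v - l j u'\<bar> \<le> len j"
      using f[OF uS(1) i] f[OF uS(2) i] j(2) E unfolding j_def by simp_all
    moreover have "(l j u \<le> l j v) = (l j u' \<le> l j v)" using e(2) j(2) unfolding j_def by simp
    ultimately have "\<bar>l j u - l j u'\<bar> \<le> len j" by linarith
    then have "{u, u'} \<in> layer G j" unfolding E using sub uS u(3) by auto
    then show "\<exists>j\<in>{i..i + \<Delta> - 1}. {u, u'} \<in> layer G j" using j by blast
  qed
  moreover have "{v, u} \<in> association_edges G \<Delta>" "{u, v} \<in> association_edges G \<Delta>" if "u \<in> X" for u
    using S(2) that unfolding X_def by (auto simp: insert_commute)
  ultimately have "is_clique (association_edges G \<Delta>) (insert v X)"
    unfolding is_clique_def by blast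
  moreover have "finite X" unfolding X_def using S(1) by simp
  moreover have "v \<notin> X" using sub(2) unfolding X_def by blast
  moreover have "k \<le> Suc (card X)" using c k unfolding X_def by simp
  moreover have "insert v X \<subseteq> verts G"
  proof -
    have "X \<noteq> {}" using c unfolding X_def[symmetric] by auto
    then show ?thesis using sub(1) unfolding X_def by blast
  qed
  ultimately show ?thesis unfolding temporal_clique_def by (intro exI[of _ "insert v X"]) simp
qed

definition vclique :: "(nat \<Rightarrow> nat \<Rightarrow> bool) \<Rightarrow> nat set \<Rightarrow> bool" where
  "vclique E S \<longleftrightarrow> (\<forall>u\<in>S. \<forall>v\<in>S. u \<noteq> v \<longrightarrow> E u v)"

definition assoc :: "'a temporal_graph \<Rightarrow> nat \<Rightarrow> 'a list \<Rightarrow> nat \<Rightarrow> nat \<Rightarrow> bool" where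
  "assoc G \<Delta> vs i j \<longleftrightarrow> {vs ! i, vs ! j} \<in> association_edges G \<Delta>"

lemma assoc_sym: "assoc G \<Delta> vs i j \<longleftrightarrow> assoc G \<Delta> vs j i"
  unfolding assoc_def by (simp add: insert_commute)

lemma assoc_irrefl:
  assumes "temporal_graph G" and "1 \<le> \<Delta>"
  shows "\<not> assoc G \<Delta> vs i i"
  unfolding assoc_def using association_edge_card[OF assms] by force

lemma temporal_clique_iff:
  assumes "distinct vs" and "set vs = verts G"
  shows "temporal_clique \<Delta> G k \<longleftrightarrow> (\<exists>S\<subseteq>{..<length vs}. k \<le> card S \<and> vclique (assoc G \<Delta> vs) S)"
proof
  assume "temporal_clique \<Delta> G k"
  then obtain C where C: "C \<subseteq> set vs" "k \<le> card C" "is_clique (association_edges G \<Delta>) C"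
    unfolding temporal_clique_def assms(2) by blast
  define S where "S = {i. i < length vs \<and> vs ! i \<in> C}"
  have "C = (!) vs ` S" unfolding S_def using C(1) by (auto simp: image_iff) (metis in_set_conv_nth subsetD)
  moreover have "inj_on ((!) vs) S"
    using assms(1) unfolding S_def by (auto simp: inj_on_def nth_eq_iff_index_eq)
  ultimately have "card S = card C" by (simp add: card_image)
  moreover have "vclique (assoc G \<Delta> vs) S"
    using C(3) assms(1) unfolding vclique_def assoc_def is_clique_def S_def
    by (auto simp: nth_eq_iff_index_eq)
  ultimately show "\<exists>S\<subseteq>{..<length vs}. k \<le> card S \<and> vclique (assoc G \<Delta> vs) S"
    using C(2) by (intro exI[of _ S]) (auto simp: S_def)
next
  assume "\<exists>S\<subseteq>{..<length vs}. k \<le> card S \<and> vclique (assoc G \<Delta> vs) S"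
  then obtain S where S: "S \<subseteq> {..<length vs}" "k \<le> card S" "vclique (assoc G \<Delta> vs) S" by blast
  have "inj_on ((!) vs) S"
    using S(1) assms(1) by (auto simp: inj_on_def nth_eq_iff_index_eq subset_iff)
  then have "card ((!) vs ` S) = card S" by (rule card_image)
  moreover have "is_clique (association_edges G \<Delta>) ((!) vs ` S)"
    using S(3) unfolding is_clique_def vclique_def assoc_def by auto
  moreover have "(!) vs ` S \<subseteq> verts G" using S(1) assms(2) by (auto simp: subset_iff)
  ultimately show "temporal_clique \<Delta> G k" unfolding temporal_clique_def using S(2) by metis
qed

lemma large_degree_temporal_clique:
  assumes "temporal_unit_interval_graph G" and "1 \<le> \<Delta>" "\<Delta> \<le> lifetime G" and "2 \<le> k"
    and vs: "distinct vs" "set vs = verts G" and "v < length vs"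
    and "(k - 2) * (2 * \<Delta>) ^ (lifetime G - \<Delta> + 1) < card {u. u < length vs \<and> assoc G \<Delta> vs v u}"
  shows "temporal_clique \<Delta> G k"
proof (rule large_degree_clique[OF assms(1-3) _ _ assms(4)])
  let ?S = "{u. u < length vs \<and> assoc G \<Delta> vs v u}"
  have "inj_on ((!) vs) ?S" using vs(1) by (auto simp: inj_on_def nth_eq_iff_index_eq)
  then show "(k - 2) * (2 * \<Delta>) ^ (lifetime G - \<Delta> + 1) < card ((!) vs ` ?S)"
    using assms(8) by (simp add: card_image)
qed (auto simp: assoc_def)

section \<open>Windows and gaps\<close>

primrec lastp :: "(nat \<Rightarrow> bool) \<Rightarrow> nat \<Rightarrow> nat" where
  "lastp P 0 = 0"
| "lastp P (Suc t) = (if P (Suc t) then Suc t else lastp P t)"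

primrec gapless :: "nat \<Rightarrow> (nat \<Rightarrow> bool) \<Rightarrow> nat \<Rightarrow> bool" where
  "gapless \<Delta> P 0 = True"
| "gapless \<Delta> P (Suc t) = (gapless \<Delta> P t \<and> (P (Suc t) \<longrightarrow> Suc t - lastp P t \<le> \<Delta>))"

lemma lastp_le: "lastp P t \<le> t"
  by (induction t) auto

lemma lastp_holds: "0 < lastp P t \<Longrightarrow> P (lastp P t)"
  by (induction t) (auto split: if_splits)

lemma le_lastp: "P j \<Longrightarrow> 1 \<le> j \<Longrightarrow> j \<le> t \<Longrightarrow> j \<le> lastp P t"
  by (induction t) (auto simp: le_Suc_eq)

lemma gapless_iff:
  assumes "1 \<le> \<Delta>"
  shows "gapless \<Delta> P t \<longleftrightarrow> (\<forall>i. 1 \<le> i \<and> i \<le> lastp P t \<longrightarrow> (\<exists>j\<in>{i..i + \<Delta> - 1}. P j))"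
proof (induction t)
  case 0
  then show ?case by simp
next
  case (Suc t)
  let ?hit = "\<lambda>i. \<exists>j\<in>{i..i + \<Delta> - 1}. P j"
  show ?case
  proof (cases "P (Suc t)")
    case False
    then show ?thesis using Suc by simp
  next
    case True
    have 1: "?hit i" if "Suc t \<le> lastp P t + \<Delta>" "lastp P t < i" "i \<le> Suc t" for i
      using True that by (intro bexI[of _ "Suc t"]) auto
    have 2: "Suc t \<le> lastp P t + \<Delta>" if hit: "?hit (Suc (lastp P t))"
    proof -
      obtain j where j: "Suc (lastp P t) \<le> j" "j \<le> lastp P t + \<Delta>" "P j" using hit assms by auto
      then have "\<not> j \<le> t" using le_lastp[of P j t] by auto
      with j show ?thesis by simp
    qed
    have "(\<forall>i. 1 \<le> i \<and> i \<le> Suc t \<longrightarrow> ?hit i) \<longleftrightarrow>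
        (\<forall>i. 1 \<le> i \<and> i \<le> lastp P t \<longrightarrow> ?hit i) \<and> Suc t \<le> lastp P t + \<Delta>" (is "?l \<longleftrightarrow> ?r1 \<and> ?r2")
    proof
      assume l: ?l
      have "?hit (Suc (lastp P t))"
        using l[rule_format, of "Suc (lastp P t)"] lastp_le[of P t] by simp
      then show "?r1 \<and> ?r2" using l lastp_le[of P t] 2 by auto
    next
      assume "?r1 \<and> ?r2"
      then show ?l using 1 by (metis not_le)
    qed
    then show ?thesis using Suc True by (auto simp: le_diff_conv)
  qed
qed

lemma windows_iff:
  assumes "1 \<le> \<Delta>" and "\<Delta> \<le> \<tau>"
  shows "(\<forall>i\<in>{1..\<tau> - \<Delta> + 1}. \<exists>j\<in>{i..i + \<Delta> - 1}. P j) \<longleftrightarrow>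
    gapless \<Delta> P \<tau> \<and> \<tau> - \<Delta> + 1 \<le> lastp P \<tau>" (is "?l \<longleftrightarrow> ?r")
proof
  assume l: ?l
  then obtain j where "j \<in> {\<tau> - \<Delta> + 1..\<tau> - \<Delta> + 1 + \<Delta> - 1}" "P j" by fastforce
  then have last: "\<tau> - \<Delta> + 1 \<le> lastp P \<tau>" using le_lastp[of P j \<tau>] assms by auto
  moreover have "\<exists>j\<in>{i..i + \<Delta> - 1}. P j" if "1 \<le> i" "i \<le> lastp P \<tau>" for i
  proof (cases "i \<le> \<tau> - \<Delta> + 1")
    case True
    then show ?thesis using l that by auto
  next
    case False
    then show ?thesis using that assms lastp_le[of P \<tau>] lastp_holds[of P \<tau>]
      by (intro bexI[of _ "lastp P \<tau>"]) auto
  qed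
  ultimately show ?r using gapless_iff[OF assms(1)] by blast
next
  assume ?r
  then show ?l using gapless_iff[OF assms(1)] by auto
qed

lemma assoc_iff_gapless:
  assumes "1 \<le> \<Delta>" and "\<Delta> \<le> lifetime G"
  shows "assoc G \<Delta> vs i j \<longleftrightarrow> gapless \<Delta> (\<lambda>t. {vs ! i, vs ! j} \<in> layer G t) (lifetime G) \<and>
    lifetime G - \<Delta> + 1 \<le> lastp (\<lambda>t. {vs ! i, vs ! j} \<in> layer G t) (lifetime G)"
  unfolding assoc_def association_edges_iff using windows_iff[OF assms] by blast

lemma windows_le_power:
  fixes w \<Delta> :: nat
  assumes "1 \<le> \<Delta>" and "1 \<le> w"
  shows "w * \<Delta> \<le> (2 * \<Delta>) ^ w"
proof -
  have "\<Delta> \<le> \<Delta> ^ w" using assms by (intro self_le_power) auto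
  then show ?thesis unfolding power_mult_distrib by (intro mult_le_mono less_imp_le[OF less_exp])
qed

lemma lifetime_le_power:
  fixes \<Delta> \<tau> :: nat
  assumes "1 \<le> \<Delta>" and "\<Delta> \<le> \<tau>"
  shows "\<tau> \<le> (2 * \<Delta>) ^ (\<tau> - \<Delta> + 1)"
proof -
  obtain b where "\<tau> = \<Delta> + b" using assms(2) le_Suc_ex by blast
  moreover obtain a where "\<Delta> = Suc a" using assms(1) by (cases \<Delta>) auto
  ultimately have "\<tau> \<le> (\<tau> - \<Delta> + 1) * \<Delta>" by simp
  also have "\<dots> \<le> (2 * \<Delta>) ^ (\<tau> - \<Delta> + 1)" by (rule windows_le_power[OF assms(1)]) simp
  finally show ?thesis .
qed

section \<open>Subset lists\<close>

primrec subsets :: "(nat \<Rightarrow> nat) \<Rightarrow> nat \<Rightarrow> nat set list" where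
  "subsets c 0 = [{}]"
| "subsets c (Suc i) = subsets c i @ map (insert (c i)) (subsets c i)"

lemma length_subsets [simp]: "length (subsets c i) = 2 ^ i"
  by (induction i) auto

lemma set_subsets: "set (subsets c i) = Pow (c ` {..<i})"
  by (induction i) (simp_all add: lessThan_Suc Pow_insert)

lemma nth_subsets_Suc:
  "s < 2 ^ i \<Longrightarrow> subsets c (Suc i) ! s = subsets c i ! s"
  "s < 2 ^ i \<Longrightarrow> subsets c (Suc i) ! (2 ^ i + s) = insert (c i) (subsets c i ! s)"
  by (simp_all add: nth_append)

lemma nth_subsets_subset:
  "s < 2 ^ i \<Longrightarrow> subsets c i ! s \<subseteq> c ` {..<i}"
  using set_subsets[of c i] by (metis PowD length_subsets nth_mem)

section \<open>Searching the neighbourhoods\<close>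

abbreviation (input) r_found :: nat where "r_found \<equiv> 0"
abbreviation (input) r_n :: nat where "r_n \<equiv> 1"
abbreviation (input) r_tau :: nat where "r_tau \<equiv> 2"
abbreviation (input) r_Delta :: nat where "r_Delta \<equiv> 3"
abbreviation (input) r_k :: nat where "r_k \<equiv> 4"
abbreviation (input) r_w :: nat where "r_w \<equiv> 5"
abbreviation (input) r_y :: nat where "r_y \<equiv> 6"
abbreviation (input) r_D :: nat where "r_D \<equiv> 7"
abbreviation (input) r_v :: nat where "r_v \<equiv> 10"
abbreviation (input) r_m :: nat where "r_m \<equiv> 11"
abbreviation (input) r_lp :: nat where "r_lp \<equiv> 12"
abbreviation (input) r_i :: nat where "r_i \<equiv> 13"
abbreviation (input) r_cr :: nat where "r_cr \<equiv> 14"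
abbreviation (input) r_h :: nat where "r_h \<equiv> 15"
abbreviation (input) r_a :: nat where "r_a \<equiv> 16"
abbreviation (input) r_s :: nat where "r_s \<equiv> 17"
abbreviation (input) r_bs :: nat where "r_bs \<equiv> 18"
abbreviation (input) r_size :: nat where "r_size \<equiv> 19"
abbreviation (input) r_u :: nat where "r_u \<equiv> 20"

abbreviation (input) a_row :: nat where "a_row \<equiv> 0"
abbreviation (input) a_adj :: nat where "a_adj \<equiv> 1"
abbreviation (input) a_nb :: nat where "a_nb \<equiv> 2"
abbreviation (input) a_deg :: nat where "a_deg \<equiv> 3"
abbreviation (input) a_W :: nat where "a_W \<equiv> 4"
abbreviation (input) a_B :: nat where "a_B \<equiv> 5"

definition rows :: "nat \<Rightarrow> arrays \<Rightarrow> bool" where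
  "rows n A \<longleftrightarrow> (\<forall>u<n. A a_row u = u * n)"

definition represents_graph :: "nat \<Rightarrow> arrays \<Rightarrow> (nat \<Rightarrow> nat \<Rightarrow> bool) \<Rightarrow> bool" where
  "represents_graph n A E \<longleftrightarrow>
     (\<forall>u<n. \<forall>v<n. A a_adj (u * n + v) = of_bool (E u v)) \<and>
     (\<exists>nb. \<forall>u<n. distinct (nb u) \<and> set (nb u) = {v. v < n \<and> E u v} \<and> A a_deg u = length (nb u) \<and>
        (\<forall>i<length (nb u). A a_nb (u * n + i) = nb u ! i))"

definition clique_weight :: "(nat \<Rightarrow> nat \<Rightarrow> bool) \<Rightarrow> nat set \<Rightarrow> nat" where
  "clique_weight E S = (if vclique E S then Suc (card S) else 0)"

lemma clique_weight_insert:
  assumes "symp E" and "finite S" and "c \<notin> S"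
  shows "clique_weight E (insert c S) =
    (if S \<subseteq> {u. E c u} \<and> 0 < clique_weight E S then Suc (clique_weight E S) else 0)"
  using assms unfolding clique_weight_def vclique_def by (auto dest: sympD)

lemma sum_affine_power2: "(\<Sum>j<i. a + b * 2 ^ j) + b = a * i + b * (2::nat) ^ i"
  by (induction i) (auto simp: algebra_simps)

text \<open>
  With \<open>c\<close> the list of neighbours, entry \<open>s\<close> of \<open>a_B\<close> says whether the subset number \<open>s\<close> of the
  first \<open>i\<close> neighbours lies in the neighbourhood of neighbour number \<open>i\<close>. Both tables grow by
  doubling, which keeps the total work at \<open>O (2 ^ m)\<close> without a polynomial factor.
\<close>

definition inside_table :: cmd where
  "inside_table =
     (Put a_B (Lit 0) (Lit 1) ;;
      r_bs ::= Lit 1 ;;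
      For r_h r_i
        (r_a ::= Ar a_adj (Reg r_cr .+ Ar a_nb (Reg r_lp .+ Reg r_h)) ;;
         For r_s r_bs
           (Put a_B (Reg r_bs .+ Reg r_s) (Ar a_B (Reg r_s) .- (Lit 1 .- Reg r_a))) ;;
         r_bs ::= Reg r_bs .+ Reg r_bs))"

lemma inside_table_frame [simp]:
  "mods inside_table = {r_h, r_a, r_s, r_bs}" "amods inside_table = {a_B}"
  by (simp_all add: inside_table_def insert_commute)

lemma runs_inside_table:
  assumes adj: "\<And>h. h < R r_i \<Longrightarrow> A a_adj (R r_cr + A a_nb (R r_lp + h)) = of_bool (E z (c h))"
  shows "runs x inside_table R A (4 + 6 * R r_i + 3 * 2 ^ R r_i)
    (\<lambda>R' A'. \<forall>s<2 ^ R r_i. A' a_B s = of_bool (subsets c (R r_i) ! s \<subseteq> {u. E z u}))"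
proof -
  let ?B = "\<lambda>i A'. \<forall>s<2 ^ i. A' a_B s = of_bool (subsets c i ! s \<subseteq> {u. E z u})"
  let ?A = "A(a_B := (A a_B)(0 := 1))"
  have "runs x (For r_h r_i
        (r_a ::= Ar a_adj (Reg r_cr .+ Ar a_nb (Reg r_lp .+ Reg r_h)) ;;
         For r_s r_bs
           (Put a_B (Reg r_bs .+ Reg r_s) (Ar a_B (Reg r_s) .- (Lit 1 .- Reg r_a))) ;;
         r_bs ::= Reg r_bs .+ Reg r_bs)) (R(r_bs := 1)) ?A (2 + 6 * R r_i + 3 * 2 ^ R r_i)
        (\<lambda>R' A'. ?B (R r_i) A')" (is "runs x (For _ _ ?body) _ _ _ _")
  proof (rule runs_For[where I = "\<lambda>h R' A'. R' r_bs = 2 ^ h \<and> ?B h A'" and f = "\<lambda>h. 4 + 3 * 2 ^ h"])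
    fix h R1 A1
    assume h: "h < (R(r_bs := 1)) r_i" and I: "R1 r_bs = 2 ^ h \<and> ?B h A1" and R1: "R1 r_h = h"
      "\<And>v. v \<notin> insert r_h (mods ?body) \<Longrightarrow> R1 v = (R(r_bs := 1)) v"
      "\<And>a. a \<notin> amods ?body \<Longrightarrow> A1 a = ?A a"
    define b where "b = (of_bool (E z (c h)) :: nat)"
    have a: "A1 a_adj (R1 r_cr + A1 a_nb (R1 r_lp + R1 r_h)) = b"
      using R1 h adj unfolding b_def by simp
    let ?R = "R1(r_a := b)"
    have inner: "runs x (For r_s r_bs
           (Put a_B (Reg r_bs .+ Reg r_s) (Ar a_B (Reg r_s) .- (Lit 1 .- Reg r_a)))) ?R A1 (2 + 3 * 2 ^ h)
        (\<lambda>R' A'. R' r_bs = 2 ^ h \<and> ?B (Suc h) A')"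
    proof (rule runs_For[where I = "\<lambda>j R' A'. (\<forall>s<2 ^ h. A' a_B s = A1 a_B s) \<and>
          (\<forall>s<j. A' a_B (2 ^ h + s) = A1 a_B s - (1 - b))" and f = "\<lambda>_. 1"])
      fix j R2 A2
      assume "j < ?R r_bs"
        "(\<forall>s<2 ^ h. A2 a_B s = A1 a_B s) \<and> (\<forall>s<j. A2 a_B (2 ^ h + s) = A1 a_B s - (1 - b))"
        "R2 r_s = j"
        "\<And>v. v \<notin> insert r_s (mods (Put a_B (Reg r_bs .+ Reg r_s) (Ar a_B (Reg r_s) .- (Lit 1 .- Reg r_a)))) \<Longrightarrow>
          R2 v = ?R v"
      then show "runs x (Put a_B (Reg r_bs .+ Reg r_s) (Ar a_B (Reg r_s) .- (Lit 1 .- Reg r_a))) R2 A2 1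
         (\<lambda>R'' A''. (\<forall>s<2 ^ h. A'' a_B s = A1 a_B s) \<and>
           (\<forall>s<Suc j. A'' a_B (2 ^ h + s) = A1 a_B s - (1 - b)))"
        using I by (auto simp: runs_Put less_Suc_eq)
    next
      fix R2 A2
      assume 2: "(\<forall>s<2 ^ h. A2 a_B s = A1 a_B s) \<and>
          (\<forall>s<?R r_bs. A2 a_B (2 ^ h + s) = A1 a_B s - (1 - b))" and
        fr: "\<And>v. v \<notin> insert r_s (mods (Put a_B (Reg r_bs .+ Reg r_s) (Ar a_B (Reg r_s) .- (Lit 1 .- Reg r_a)))) \<Longrightarrow>
          R2 v = ?R v"
      have "A2 a_B s = of_bool (subsets c (Suc h) ! s \<subseteq> {u. E z u})" if s: "s < 2 ^ Suc h" for s
      proof (cases "s < 2 ^ h")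
        case True
        then show ?thesis using 2 I by (simp add: nth_subsets_Suc del: subsets.simps)
      next
        case False
        then obtain s' where s': "s = 2 ^ h + s'" using le_Suc_ex not_less by blast
        then have "s' < 2 ^ h" using s by simp
        then show ?thesis using 2 I s' b_def by (auto simp: nth_subsets_Suc simp del: subsets.simps)
      qed
      then show "R2 r_bs = 2 ^ h \<and> ?B (Suc h) A2" using fr[of r_bs] I by simp
    qed (use I in auto)
    let ?Q = "\<lambda>R'' A''. (R''(r_h := Suc h)) r_bs = 2 ^ Suc h \<and> ?B (Suc h) A''"
    have "runs x (For r_s r_bs
           (Put a_B (Reg r_bs .+ Reg r_s) (Ar a_B (Reg r_s) .- (Lit 1 .- Reg r_a))) ;;
         r_bs ::= Reg r_bs .+ Reg r_bs) ?R A1 (3 + 3 * 2 ^ h) ?Q"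
      by (rule runs_Sq[OF inner, where t' = 1]) (auto simp: runs_Asg simp del: subsets.simps)
    then show "runs x ?body R1 A1 (4 + 3 * 2 ^ h) ?Q"
      by (simp only: runs_Asg_Sq ev.simps a) simp
  next
    show "2 + (\<Sum>j<(R(r_bs := 1)) r_i. 4 + 3 * 2 ^ j + 2) \<le> 2 + 6 * R r_i + 3 * 2 ^ R r_i"
      using sum_affine_power2[of 6 3 "R r_i"] by (simp add: add.commute add.left_commute)
  qed auto
  then show ?thesis unfolding inside_table_def
    by (simp add: runs_Put_Sq runs_Asg_Sq)
qed


definition extend_weights :: cmd where
  "extend_weights =
     For r_s r_size
       (Cond (Ar a_B (Reg r_s) .- (Lit 1 .- Ar a_W (Reg r_s)))
          (Put a_W (Reg r_size .+ Reg r_s) (Ar a_W (Reg r_s) .+ Lit 1))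
          (Put a_W (Reg r_size .+ Reg r_s) (Lit 0)) ;;
        r_found ::= Reg r_found .+ (Lit 1 .- (Reg r_k .- Ar a_W (Reg r_size .+ Reg r_s))))"

lemma extend_weights_frame [simp]:
  "mods extend_weights = {r_s, r_found}" "amods extend_weights = {a_W}"
  by (simp_all add: extend_weights_def insert_commute)

lemma runs_extend_weights:
  assumes E: "symp E" and c: "inj_on c {..i}" and size: "R r_size = 2 ^ i"
    and B: "\<forall>s<2 ^ i. A a_B s = of_bool (subsets c i ! s \<subseteq> {u. E (c i) u})"
    and W: "\<forall>s<2 ^ i. A a_W s = clique_weight E (subsets c i ! s)"
    and found: "R r_found \<noteq> 0 \<longleftrightarrow> p \<or> (\<exists>s<2 ^ i. R r_k \<le> clique_weight E (subsets c i ! s))"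
  shows "runs x extend_weights R A (2 + 5 * 2 ^ i)
    (\<lambda>R' A'. (\<forall>s<2 ^ Suc i. A' a_W s = clique_weight E (subsets c (Suc i) ! s)) \<and>
      (R' r_found \<noteq> 0 \<longleftrightarrow> p \<or> (\<exists>s<2 ^ Suc i. R r_k \<le> clique_weight E (subsets c (Suc i) ! s))))"
  unfolding extend_weights_def
proof (rule runs_For[where f = "\<lambda>_. 3" and I = "\<lambda>j R' A'.
      (\<forall>s<2 ^ i + j. A' a_W s = clique_weight E (subsets c (Suc i) ! s)) \<and>
      (R' r_found \<noteq> 0 \<longleftrightarrow> p \<or> (\<exists>s<2 ^ i + j. R r_k \<le> clique_weight E (subsets c (Suc i) ! s)))"],
    goal_cases)
  case (5 j R' A')
  let ?S = "subsets c i ! j"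
  have j: "j < 2 ^ i" using 5(1) size by simp
  have S: "?S \<subseteq> c ` {..<i}" by (rule nth_subsets_subset[OF j])
  have "c i \<notin> c ` {..<i}" using c by (force simp: inj_on_def)
  then have "c i \<notin> ?S" "finite ?S" using S finite_subset[OF S] by auto
  then have w: "clique_weight E (subsets c (Suc i) ! (2 ^ i + j)) =
      (if ?S \<subseteq> {u. E (c i) u} \<and> 0 < clique_weight E ?S then Suc (clique_weight E ?S) else 0)"
    using nth_subsets_Suc(2)[OF j] clique_weight_insert[OF E] by simp
  define z where "z = clique_weight E (subsets c (Suc i) ! (2 ^ i + j))"
  have eq: "A' a_B = A a_B" "R' r_size = 2 ^ i" "R' r_k = R r_k" using 5 size by auto
  define q where "q \<longleftrightarrow> ?S \<subseteq> {u. E (c i) u}"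
  define wt where "wt = clique_weight E ?S"
  have "A' a_W j = wt"
    using 5(2) j nth_subsets_Suc(1)[OF j] unfolding wt_def by simp
  moreover have "A' a_B j = of_bool q" using B j eq(1) unfolding q_def by simp
  moreover have "z = (if q \<and> 0 < wt then Suc wt else 0)"
    using w unfolding z_def q_def wt_def .
  ultimately have "runs x (Cond (Ar a_B (Reg r_s) .- (Lit 1 .- Ar a_W (Reg r_s)))
          (Put a_W (Reg r_size .+ Reg r_s) (Ar a_W (Reg r_s) .+ Lit 1))
          (Put a_W (Reg r_size .+ Reg r_s) (Lit 0))) R' A' 2
      (\<lambda>R'' A''. R'' = R' \<and> A'' = A'(a_W := (A' a_W)(2 ^ i + j := z)))"
    using eq 5(3) by (intro runs_Cond[where t = 1]; cases q) (auto simp: runs_Put)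
  then show ?case
  proof (rule runs_Sq[where t' = 1], goal_cases)
    case (1 R2 A2)
    then show ?case using 5(2,3) eq unfolding runs_Asg z_def
      by (auto simp add: less_Suc_eq simp del: subsets.simps)
  qed simp
next
  case 4
  then show ?case using W found nth_subsets_Suc(1) by (simp del: subsets.simps cong: conj_cong)
next
  case (7 R' A')
  then show ?case using size by (simp add: mult_2 del: subsets.simps)
qed (use size in auto)


definition search :: cmd where
  "search =
     (Put a_W (Lit 0) (Lit 1) ;;
      r_size ::= Lit 1 ;;
      For r_i r_m
        (r_cr ::= Ar a_row (Ar a_nb (Reg r_lp .+ Reg r_i)) ;;
         inside_table ;;
         extend_weights ;;
         r_size ::= Reg r_size .+ Reg r_size))"

lemma search_frame [simp]:
  "mods search = {r_found, r_i, r_cr, r_h, r_a, r_s, r_bs, r_size}" "amods search = {a_W, a_B}"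
  by (simp_all add: search_def insert_commute)

lemma runs_search:
  assumes E: "symp E" and c: "inj_on c {..<R r_m}" and k: "2 \<le> R r_k"
    and c_def: "\<And>i. i < R r_m \<Longrightarrow> A a_nb (R r_lp + i) = c i"
    and adj: "\<And>i j. i < R r_m \<Longrightarrow> j < R r_m \<Longrightarrow> A a_adj (A a_row (c i) + c j) = of_bool (E (c i) (c j))"
  shows "runs x search R A (28 * 2 ^ R r_m)
    (\<lambda>R' A'. R' r_found \<noteq> 0 \<longleftrightarrow> R r_found \<noteq> 0 \<or> (\<exists>S\<subseteq>c ` {..<R r_m}. R r_k \<le> clique_weight E S))"
proof -
  let ?m = "R r_m" and ?k = "R r_k"
  let ?W = "\<lambda>i A'. \<forall>s<2 ^ i. A' a_W s = clique_weight E (subsets c i ! s)"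
  let ?F = "\<lambda>i R'. R' r_found \<noteq> 0 \<longleftrightarrow> R r_found \<noteq> 0 \<or>
    (\<exists>s<2 ^ i. ?k \<le> clique_weight E (subsets c i ! s))"
  let ?I = "\<lambda>i R' A'. R' r_size = 2 ^ i \<and> ?W i A' \<and> ?F i R'"
  let ?R = "R(r_size := 1)" and ?A = "A(a_W := (A a_W)(0 := 1))"
  let ?b2 = "extend_weights ;; r_size ::= Reg r_size .+ Reg r_size"
  let ?b1 = "inside_table ;; ?b2"
  let ?body = "r_cr ::= Ar a_row (Ar a_nb (Reg r_lp .+ Reg r_i)) ;; ?b1"
  have "runs x (For r_i r_m ?body) ?R ?A (28 * 2 ^ ?m - 2)
    (\<lambda>R' A'. R' r_found \<noteq> 0 \<longleftrightarrow> R r_found \<noteq> 0 \<or> (\<exists>S\<subseteq>c ` {..<?m}. ?k \<le> clique_weight E S))"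
  proof (rule runs_For[where I = ?I and f = "\<lambda>j. 8 + 14 * 2 ^ j"], goal_cases)
    case 4
    then show ?case using k by (auto simp: clique_weight_def vclique_def)
  next
    case (5 i R1 A1)
    then have i: "i < ?m" by simp
    note I = 5(2) and fr = 5(4,5)
    have A1: "A1 a_row = A a_row" "A1 a_nb = A a_nb" "A1 a_adj = A a_adj" using fr by auto
    have R1: "R1 r_lp = R r_lp" "R1 r_k = ?k" using fr by auto
    let ?R1 = "R1(r_cr := A a_row (c i))"
    have inside: "runs x inside_table ?R1 A1 (4 + 6 * i + 3 * 2 ^ i)
        (\<lambda>R' A'. \<forall>s<2 ^ i. A' a_B s = of_bool (subsets c i ! s \<subseteq> {u. E (c i) u}))"
      using runs_inside_table[of ?R1 A1 E "c i" c x] A1 R1 5(3) i adj c_def by simp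
    have "runs x ?b1 ?R1 A1 (7 + 6 * i + 8 * 2 ^ i) (\<lambda>R' A'. ?I (Suc i) (R'(r_i := Suc i)) A')"
    proof (rule runs_Sq[OF inside, where t' = "3 + 5 * 2 ^ i"], goal_cases)
      case (1 R2 A2)
      have ext: "runs x extend_weights R2 A2 (2 + 5 * 2 ^ i)
        (\<lambda>R' A'. ?W (Suc i) A' \<and> ?F (Suc i) R')"
      proof (rule runs_conseq[OF runs_extend_weights[OF E, where i = i and p = "R r_found \<noteq> 0" and c = c]],
          goal_cases)
        case 1
        then show ?case using c i by (auto simp: inj_on_def)
      next
        case 2
        then show ?case using 1(2) I by simp
      next
        case 3
        then show ?case using 1(1) by simp
      next
        case 4
        then show ?case using 1(3) I by simp
      next
        case 5
        then show ?case using 1(2) I R1 by simp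
      next
        case (7 R' A')
        then show ?case using 1(2) R1 by (simp del: subsets.simps)
      qed simp
      then show ?case
        by (rule runs_Sq[where t' = 1]) (use 1(2) I in \<open>auto simp: runs_Asg simp del: subsets.simps\<close>)
    qed simp
    moreover have "7 + 6 * i + 8 * 2 ^ i \<le> 7 + 14 * 2 ^ i" using less_exp[of i] by simp
    ultimately have "runs x ?b1 ?R1 A1 (7 + 14 * 2 ^ i) (\<lambda>R' A'. ?I (Suc i) (R'(r_i := Suc i)) A')"
      by (rule runs_conseq)
    moreover have "ev x (Ar a_row (Ar a_nb (Reg r_lp .+ Reg r_i))) R1 A1 = A a_row (c i)"
      using A1 R1 5(3) c_def i by simp
    ultimately show ?case unfolding runs_Asg_Sq by (simp del: subsets.simps)
  next
    case 6
    have "(\<Sum>j<?m. 8 + 14 * 2 ^ j + 2) + 14 = 10 * ?m + 14 * 2 ^ ?m"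
      using sum_affine_power2[of 10 14 ?m] by (simp add: add.commute)
    then have "2 + (\<Sum>j<?m. 8 + 14 * 2 ^ j + 2) \<le> (28::nat) * 2 ^ ?m - 2"
      using less_exp[of ?m] by linarith
    then show ?case by simp
  next
    case (7 R' A')
    have "(\<exists>s<2 ^ ?m. ?k \<le> clique_weight E (subsets c ?m ! s)) \<longleftrightarrow>
        (\<exists>S\<in>set (subsets c ?m). ?k \<le> clique_weight E S)"
      by (metis in_set_conv_nth length_subsets)
    with 7 show ?case by (auto simp: set_subsets)
  qed auto
  moreover have "28 * 2 ^ ?m - 1 - 1 = 28 * (2::nat) ^ ?m - 2" by simp
  moreover have "1 \<le> 28 * (2::nat) ^ ?m" "1 \<le> 28 * (2::nat) ^ ?m - 1"
    using one_le_power[of "2::nat" ?m] by linarith+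
  ultimately show ?thesis by (simp only: search_def runs_Put_Sq runs_Asg_Sq ev.simps simp_thms)
qed

definition search_all :: cmd where
  "search_all =
     For r_v r_n
       (r_m ::= Ar a_deg (Reg r_v) ;;
        r_lp ::= Ar a_row (Reg r_v) ;;
        Cond (Reg r_m .- Reg r_D) (r_found ::= Lit 1) search)"

lemma search_all_frame [simp]:
  "mods search_all = {r_found, r_v, r_m, r_lp, r_i, r_cr, r_h, r_a, r_s, r_bs, r_size}"
  "amods search_all = {a_W, a_B}"
  by (simp_all add: search_all_def insert_commute)

definition hit :: "nat \<Rightarrow> nat \<Rightarrow> nat \<Rightarrow> (nat \<Rightarrow> nat \<Rightarrow> bool) \<Rightarrow> nat \<Rightarrow> bool" where
  "hit n D k E v \<longleftrightarrow> (let N = {u. u < n \<and> E v u} in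
     D < card N \<or> card N \<le> D \<and> (\<exists>S\<subseteq>N. k \<le> clique_weight E S))"

lemma runs_search_all:
  assumes E: "symp E" and k: "2 \<le> R r_k" and rep: "rows (R r_n) A" "represents_graph (R r_n) A E"
  shows "runs x search_all R A (2 + R r_n * (33 * 2 ^ R r_D))
    (\<lambda>R' A'. R' r_found \<noteq> 0 \<longleftrightarrow> R r_found \<noteq> 0 \<or> (\<exists>v<R r_n. hit (R r_n) (R r_D) (R r_k) E v))"
  unfolding search_all_def
proof (rule runs_For[where f = "\<lambda>_. 3 + 28 * 2 ^ R r_D" and I = "\<lambda>j R' A'. R' r_found \<noteq> 0 \<longleftrightarrow>
    R r_found \<noteq> 0 \<or> (\<exists>v<j. hit (R r_n) (R r_D) (R r_k) E v)"], goal_cases)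
  case (5 v R1 A1)
  let ?n = "R r_n"
  let ?N = "{u. u < ?n \<and> E v u}"
  have R1: "R1 r_n = ?n" "R1 r_D = R r_D" "R1 r_k = R r_k" "R1 r_v = v" using 5 by auto
  have A1: "A1 a_row = A a_row" "A1 a_adj = A a_adj" "A1 a_nb = A a_nb" "A1 a_deg = A a_deg"
    using 5 by auto
  from rep(2) obtain nbs where "\<forall>u<?n. distinct (nbs u) \<and> set (nbs u) = {v. v < ?n \<and> E u v} \<and>
      A a_deg u = length (nbs u) \<and> (\<forall>i<length (nbs u). A a_nb (u * ?n + i) = nbs u ! i)"
    unfolding represents_graph_def by (elim conjE exE) (rule that)
  moreover define nb where "nb = nbs v"
  ultimately have nb: "distinct nb" "set nb = ?N" "A a_deg v = length nb"
      "\<forall>i<length nb. A a_nb (v * ?n + i) = nb ! i"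
    using 5(1) by simp_all
  have adj: "A a_adj (A a_row (nb ! i) + nb ! j) = of_bool (E (nb ! i) (nb ! j))"
    if "i < length nb" "j < length nb" for i j
  proof -
    have "nb ! i < ?n" "nb ! j < ?n" using nth_mem[OF that(1)] nth_mem[OF that(2)] nb(2) by auto
    then show ?thesis using rep unfolding rows_def represents_graph_def by simp
  qed
  have img: "(!) nb ` {..<length nb} = ?N"
    using nth_image[of "length nb" nb] nb(2) by (simp add: atLeast0LessThan)
  have inj: "inj_on ((!) nb) {..<length nb}" using nb(1) by (simp add: inj_on_nth)
  have card: "length nb = card ?N" using nb distinct_card by metis
  let ?R = "R1(r_m := length nb, r_lp := v * ?n)"
  have main: "runs x (Cond (Reg r_m .- Reg r_D) (r_found ::= Lit 1) search) ?R A1 (1 + 28 * 2 ^ R r_D)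
    (\<lambda>R' A'. R' r_found \<noteq> 0 \<longleftrightarrow> R1 r_found \<noteq> 0 \<or> hit ?n (R r_D) (R r_k) E v)"
    unfolding hit_def Let_def
  proof (rule runs_Cond[where t = "28 * 2 ^ R r_D"], goal_cases)
    case 1
    then show ?case using R1 card by (simp add: runs_Asg Suc_le_eq)
  next
    case 2
    then have le: "length nb \<le> R r_D" using R1 by simp
    show ?case
    proof (rule runs_conseq[OF runs_search[OF E, where c = "(!) nb"]], goal_cases)
      case 5
      then show ?case using le by simp
    qed (use inj k R1 A1 nb(4) adj img le card in auto)
  qed simp
  have ev: "ev x (Ar a_deg (Reg r_v)) R1 A1 = length nb"
      "ev x (Ar a_row (Reg r_v)) (R1(r_m := length nb)) A1 = v * ?n"
    using R1 A1 nb(3) rep(1) 5(1) unfolding rows_def by simp_all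
  show ?case
  proof (simp only: runs_Asg_Sq ev, intro conjI, simp, simp, rule runs_conseq[OF main], goal_cases)
    case (2 R' A')
    from 5(2) 2(1) show ?case by (auto simp: less_Suc_eq)
  qed simp
qed (auto simp: algebra_simps)

lemma search_criterion:
  assumes "symp E" and irr: "\<And>u. \<not> E u u" and k: "1 \<le> k"
    and deg: "\<And>v. v < n \<Longrightarrow> D < card {u. u < n \<and> E v u} \<Longrightarrow> \<exists>S\<subseteq>{..<n}. k \<le> card S \<and> vclique E S"
  shows "(\<exists>v<n. hit n D k E v) \<longleftrightarrow>
       (\<exists>S\<subseteq>{..<n}. k \<le> card S \<and> vclique E S)" (is "?l \<longleftrightarrow> ?r")
proof
  assume ?l
  then obtain v where v: "v < n" "D < card {u. u < n \<and> E v u} \<or>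
      (\<exists>S\<subseteq>{u. u < n \<and> E v u}. k \<le> clique_weight E S)"
    unfolding hit_def Let_def by blast
  from v(2) show ?r
  proof
    assume "\<exists>S\<subseteq>{u. u < n \<and> E v u}. k \<le> clique_weight E S"
    then obtain S where S: "S \<subseteq> {u. u < n \<and> E v u}" "k \<le> clique_weight E S" by blast
    then have c: "vclique E S" "k \<le> Suc (card S)" using k unfolding clique_weight_def
      by (auto split: if_splits)
    have "v \<notin> S" "finite S" using S irr finite_subset by (auto intro: finite_subset[OF S(1)])
    then have "k \<le> card (insert v S)" using c by simp
    moreover have "vclique E (insert v S)"
      using c(1) S(1) assms(1) unfolding vclique_def by (auto dest: sympD)
    moreover have "insert v S \<subseteq> {..<n}" using S(1) v(1) by auto
    ultimately show ?r by blast
  qed (use deg[OF v(1)] in blast)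
next
  assume ?r
  then obtain S where S: "S \<subseteq> {..<n}" "k \<le> card S" "vclique E S" by blast
  then have fin: "finite S" using finite_subset by blast
  obtain v where v: "v \<in> S" using S(2) k by (cases "S = {}") auto
  have "S - {v} \<subseteq> {u. u < n \<and> E v u}" using S v unfolding vclique_def by auto
  moreover have "k \<le> clique_weight E (S - {v})"
    using S fin v k unfolding clique_weight_def vclique_def by auto
  moreover have "v < n" using S v by auto
  ultimately show ?l unfolding hit_def Let_def by (meson not_le)
qed

abbreviation (input) r_x :: nat where "r_x \<equiv> 21"

definition power_prog :: cmd where
  "power_prog =
     (r_y ::= Lit 1 ;;
      For r_i r_w
        (r_a ::= Lit 0 ;;
         For r_h r_Delta (r_a ::= Reg r_a .+ Reg r_y .+ Reg r_y) ;;
         r_y ::= Reg r_a))"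

lemma power_prog_frame [simp]:
  "mods power_prog = {r_y, r_i, r_a, r_h}" "amods power_prog = {}"
  by (simp_all add: power_prog_def insert_commute)

lemma runs_power_prog:
  "runs x power_prog R A (3 + R r_w * (6 + 3 * R r_Delta)) (\<lambda>R' A'. R' r_y = (2 * R r_Delta) ^ R r_w)"
proof -
  let ?d = "R r_Delta"
  let ?b = "r_a ::= Reg r_a .+ Reg r_y .+ Reg r_y"
  let ?body = "r_a ::= Lit 0 ;; For r_h r_Delta ?b ;; r_y ::= Reg r_a"
  have "runs x (For r_i r_w ?body) (R(r_y := 1)) A (2 + R r_w * (6 + 3 * ?d))
    (\<lambda>R' A'. R' r_y = (2 * ?d) ^ R r_w)"
  proof (rule runs_For[where I = "\<lambda>j R' A'. R' r_y = (2 * ?d) ^ j" and f = "\<lambda>_. 4 + 3 * ?d"], goal_cases)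
    case (5 j R1 A1)
    have "runs x (For r_h r_Delta ?b) (R1(r_a := 0)) A1 (2 + 3 * ?d)
      (\<lambda>R' A'. R' r_a = 2 * ?d * R1 r_y)"
      by (rule runs_For[where I = "\<lambda>j R' A'. R' r_a = 2 * j * R1 r_y" and f = "\<lambda>_. 1"])
        (use 5 in \<open>auto simp: runs_Asg algebra_simps\<close>)
    then have "runs x (For r_h r_Delta ?b ;; r_y ::= Reg r_a) (R1(r_a := 0)) A1 (3 + 3 * ?d)
      (\<lambda>R' A'. (R'(r_i := Suc j)) r_y = (2 * ?d) ^ Suc j)"
      by (rule runs_Sq[where t' = 1]) (use 5(2) in \<open>auto simp: runs_Asg\<close>)
    then show ?case unfolding runs_Asg_Sq ev.simps by simp
  qed (auto simp: algebra_simps)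
  then show ?thesis unfolding power_prog_def runs_Asg_Sq ev.simps by simp
qed

definition degree_bound :: cmd where
  "degree_bound =
     (r_D ::= Lit 0 ;;
      r_m ::= Reg r_k .- Lit 2 ;;
      For r_i r_m (r_D ::= Reg r_D .+ Reg r_y))"

lemma degree_bound_frame [simp]:
  "mods degree_bound = {r_D, r_m, r_i}" "amods degree_bound = {}"
  by (simp_all add: degree_bound_def insert_commute)

lemma runs_degree_bound:
  "runs x degree_bound R A (4 + 3 * (R r_k - 2)) (\<lambda>R' A'. R' r_D = (R r_k - 2) * R r_y)"
proof -
  have "runs x (For r_i r_m (r_D ::= Reg r_D .+ Reg r_y)) (R(r_D := 0, r_m := R r_k - 2)) A
    (2 + 3 * (R r_k - 2)) (\<lambda>R' A'. R' r_D = (R r_k - 2) * R r_y)"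
    by (rule runs_For[where I = "\<lambda>j R' A'. R' r_D = j * R r_y" and f = "\<lambda>_. 1"])
      (auto simp: runs_Asg)
  then show ?thesis unfolding degree_bound_def runs_Asg_Sq ev.simps by simp
qed

definition setup_rows :: cmd where
  "setup_rows =
     (r_x ::= Lit 0 ;;
      For r_v r_n (Put a_row (Reg r_v) (Reg r_x) ;; r_x ::= Reg r_x .+ Reg r_n))"

lemma setup_rows_frame [simp]:
  "mods setup_rows = {r_x, r_v}" "amods setup_rows = {a_row}"
  by (simp_all add: setup_rows_def insert_commute)

lemma runs_setup_rows:
  "runs x setup_rows R A (3 + 4 * R r_n) (\<lambda>R' A'. rows (R r_n) A')"
proof -
  have "runs x (For r_v r_n (Put a_row (Reg r_v) (Reg r_x) ;; r_x ::= Reg r_x .+ Reg r_n)) (R(r_x := 0)) A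
    (2 + 4 * R r_n) (\<lambda>R' A'. rows (R r_n) A')"
    by (rule runs_For[where I = "\<lambda>j R' A'. R' r_x = j * R r_n \<and> (\<forall>u<j. A' a_row u = u * R r_n)" and
        f = "\<lambda>_. 2"]) (auto simp: runs_Asg runs_Put_Sq rows_def less_Suc_eq)
  then show ?thesis unfolding setup_rows_def runs_Asg_Sq ev.simps by simp
qed

definition add_edge :: cmd where
  "add_edge =
     (Put a_adj (Ar a_row (Reg r_u) .+ Reg r_v) (Lit 1) ;;
      Put a_adj (Ar a_row (Reg r_v) .+ Reg r_u) (Lit 1) ;;
      Put a_nb (Ar a_row (Reg r_u) .+ Ar a_deg (Reg r_u)) (Reg r_v) ;;
      Put a_nb (Ar a_row (Reg r_v) .+ Ar a_deg (Reg r_v)) (Reg r_u) ;;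
      Put a_deg (Reg r_u) (Ar a_deg (Reg r_u) .+ Lit 1) ;;
      Put a_deg (Reg r_v) (Ar a_deg (Reg r_v) .+ Lit 1))"

lemma add_edge_frame [simp]: "mods add_edge = {}" "amods add_edge = {a_adj, a_nb, a_deg}"
  by (simp_all add: add_edge_def insert_commute)

lemma row_index_eq:
  fixes n :: nat
  assumes "v < n" and "v' < n"
  shows "u * n + v = u' * n + v' \<longleftrightarrow> u = u' \<and> v = v'"
proof
  assume "u * n + v = u' * n + v'"
  then have "(u * n + v) div n = (u' * n + v') div n" "(u * n + v) mod n = (u' * n + v') mod n" by simp_all
  then show "u = u' \<and> v = v'" using assms by simp
qed simp

lemma represents_graph_cong:
  assumes "represents_graph n A E" and "\<And>u v. u < n \<Longrightarrow> v < n \<Longrightarrow> E u v \<longleftrightarrow> E' u v"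
    and "\<And>a. a \<in> {a_adj, a_nb, a_deg} \<Longrightarrow> A a = A' a"
  shows "represents_graph n A' E'"
proof -
  have "{v. v < n \<and> E u v} = {v. v < n \<and> E' u v}" if "u < n" for u using assms(2)[OF that] by blast
  then show ?thesis using assms unfolding represents_graph_def by simp
qed

lemma represents_graph_empty:
  "(\<And>i. A a_adj i = 0) \<Longrightarrow> (\<And>i. A a_deg i = 0) \<Longrightarrow> represents_graph n A (\<lambda>u v. False)"
  unfolding represents_graph_def by (auto intro!: exI[of _ "\<lambda>_. []"])

definition plus_edge :: "(nat \<Rightarrow> nat \<Rightarrow> bool) \<Rightarrow> nat \<Rightarrow> nat \<Rightarrow> nat \<Rightarrow> nat \<Rightarrow> bool" where
  "plus_edge E u v a b \<longleftrightarrow> E a b \<or> a = u \<and> b = v \<or> a = v \<and> b = u"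

lemma symp_plus_edge: "symp E \<Longrightarrow> symp (plus_edge E u v)"
  unfolding plus_edge_def symp_def by blast

lemma represents_graph_plus_edge:
  assumes rep: "represents_graph n A E" and uv: "u < n" "v < n" "u \<noteq> v" and new: "\<not> E u v" "\<not> E v u"
    and A': "A' a_adj = (A a_adj)(u * n + v := 1, v * n + u := 1)"
      "A' a_nb = (A a_nb)(u * n + A a_deg u := v, v * n + A a_deg v := u)"
      "A' a_deg = (A a_deg)(u := A a_deg u + 1, v := A a_deg v + 1)"
  shows "represents_graph n A' (plus_edge E u v)"
proof -
  from rep obtain nb where nb: "\<forall>u<n. distinct (nb u) \<and> set (nb u) = {v. v < n \<and> E u v} \<and>
      A a_deg u = length (nb u) \<and> (\<forall>i<length (nb u). A a_nb (u * n + i) = nb u ! i)"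
    unfolding represents_graph_def by (elim conjE exE) (rule that)
  have len: "length (nb a) < n" if "a < n" "b < n" "\<not> E a b" for a b
  proof -
    have "length (nb a) = card (set (nb a))" using nb that distinct_card by metis
    also have "\<dots> < card {..<n}" using nb that by (intro psubset_card_mono) auto
    finally show ?thesis by simp
  qed
  have len': "length (nb a) \<le> n" if "a < n" for a
  proof -
    have "length (nb a) = card (set (nb a))" using nb that distinct_card by metis
    also have "\<dots> \<le> card {..<n}" using nb that by (intro card_mono) auto
    finally show ?thesis by simp
  qed
  have du: "A a_deg u = length (nb u)" "A a_deg v = length (nb v)" using nb uv by auto
  have lu: "length (nb u) < n" "length (nb v) < n" using len uv new by auto
  define nb' where "nb' = nb(u := nb u @ [v], v := nb v @ [u])"
  have "A' a_adj (a * n + b) = of_bool (plus_edge E u v a b)" if "a < n" "b < n" for a b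
    using that uv rep row_index_eq[of b n v a u] row_index_eq[of b n u a v]
    unfolding A' represents_graph_def plus_edge_def by auto
  moreover have "distinct (nb' a) \<and> set (nb' a) = {b. b < n \<and> plus_edge E u v a b} \<and>
      A' a_deg a = length (nb' a) \<and> (\<forall>i<length (nb' a). A' a_nb (a * n + i) = nb' a ! i)" if a: "a < n" for a
  proof (intro conjI allI impI)
    show "distinct (nb' a)" using nb a uv new unfolding nb'_def by auto
    show "set (nb' a) = {b. b < n \<and> plus_edge E u v a b}"
      using nb a uv unfolding nb'_def plus_edge_def by auto
    show "A' a_deg a = length (nb' a)" using nb a uv unfolding nb'_def A' by auto
    fix i assume i: "i < length (nb' a)"
    have "i < n" using i lu len'[OF a] uv(3) unfolding nb'_def by (auto split: if_splits)
    then have eq: "a * n + i = u * n + length (nb u) \<longleftrightarrow> a = u \<and> i = length (nb u)"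
      "a * n + i = v * n + length (nb v) \<longleftrightarrow> a = v \<and> i = length (nb v)"
      using row_index_eq lu by auto
    consider "a = u" | "a = v" | "a \<noteq> u" "a \<noteq> v" by blast
    then show "A' a_nb (a * n + i) = nb' a ! i"
    proof cases
      case 1
      then show ?thesis using i nb uv eq unfolding A' du nb'_def
        by (auto simp: nth_append less_Suc_eq)
    next
      case 2
      then show ?thesis using i nb uv eq unfolding A' du nb'_def
        by (auto simp: nth_append less_Suc_eq)
    next
      case 3
      then show ?thesis using i nb a eq unfolding A' du nb'_def by auto
    qed
  qed
  ultimately show ?thesis unfolding represents_graph_def by blast
qed

lemma runs_add_edge:
  assumes "rows n A" and "represents_graph n A E" and "symp E" and "R r_u < n" "R r_v < n" "R r_u \<noteq> R r_v"
    and "\<not> E (R r_u) (R r_v)"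
  shows "runs x add_edge R A 6 (\<lambda>R' A'. R' = R \<and> represents_graph n A' (plus_edge E (R r_u) (R r_v)))"
proof -
  have "\<not> E (R r_v) (R r_u)" using assms(3,7) by (auto dest: sympD)
  then show ?thesis unfolding add_edge_def runs_Put_Sq runs_Put
    by (intro conjI represents_graph_plus_edge[OF assms(2,4,5,6,7)])
      (use assms(1,4-6) in \<open>auto simp: rows_def\<close>)
qed

section \<open>Association graphs from edge lists\<close>

definition input :: "nat list \<Rightarrow> nat \<Rightarrow> nat" where
  "input xs p = (if p < length xs then xs ! p else 0)"

lemma length_concat_upt: "length (concat (map g [0..<t])) = (\<Sum>s<t. length (g s))"
  by (induction t) auto

lemma nth_concat_upt:
  assumes "t < m" and "i < length (g t)"
  shows "concat (map g [0..<m]) ! ((\<Sum>s<t. length (g s)) + i) = g t ! i"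
proof -
  have "[0..<m] = [0..<t] @ t # [Suc t..<m]"
    using upt_add_eq_append[of 0 t "m - t"] assms(1) by (simp add: upt_conv_Cons)
  then have "concat (map g [0..<m]) = concat (map g [0..<t]) @ g t @ concat (map g [Suc t..<m])"
    by simp
  then show ?thesis using assms(2)
    by (simp add: nth_append length_concat_upt[symmetric])
qed

lemma nth_concat_pairs:
  assumes "z < length l"
  shows "concat (map (\<lambda>(i, j). [i, j]) l) ! (2 * z) = fst (l ! z)"
    and "concat (map (\<lambda>(i, j). [i, j]) l) ! Suc (2 * z) = snd (l ! z)"
proof -
  have "concat (map (\<lambda>(i, j). [i, j]) l) ! (2 * z) = fst (l ! z) \<and>
      concat (map (\<lambda>(i, j). [i, j]) l) ! Suc (2 * z) = snd (l ! z)"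
    using assms
  proof (induction l arbitrary: z)
    case (Cons p l)
    then show ?case by (cases z; cases p) auto
  qed simp
  then show "concat (map (\<lambda>(i, j). [i, j]) l) ! (2 * z) = fst (l ! z)"
    and "concat (map (\<lambda>(i, j). [i, j]) l) ! Suc (2 * z) = snd (l ! z)" by auto
qed

lemma length_concat_pairs: "length (concat (map (\<lambda>(i, j). [i, j]) l)) = 2 * length l"
  by (induction l) auto

abbreviation (input) r_p :: nat where "r_p \<equiv> 22"
abbreviation (input) r_t :: nat where "r_t \<equiv> 23"
abbreviation (input) r_e :: nat where "r_e \<equiv> 24"
abbreviation (input) r_z :: nat where "r_z \<equiv> 25"
abbreviation (input) a_last :: nat where "a_last \<equiv> 6"
abbreviation (input) a_bad :: nat where "a_bad \<equiv> 7"

definition touch :: "nat \<Rightarrow> nat \<Rightarrow> cmd" where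
  "touch u v =
     (r_x ::= Ar a_row (Reg u) .+ Reg v ;;
      Put a_bad (Reg r_x) (Ar a_bad (Reg r_x) .+
        (Reg r_t .+ Lit 1 .- Ar a_last (Reg r_x) .- Reg r_Delta)) ;;
      Put a_last (Reg r_x) (Reg r_t .+ Lit 1))"

lemma touch_frame [simp]: "mods (touch u v) = {r_x}" "amods (touch u v) = {a_last, a_bad}"
  by (simp_all add: touch_def insert_commute)

text \<open>The pairs in \<open>T\<close> have already been seen in layer \<open>t + 1\<close>; the others are up to date for layer \<open>t\<close>.\<close>

definition marked :: "(nat \<Rightarrow> nat \<Rightarrow> nat \<Rightarrow> bool) \<Rightarrow> nat \<Rightarrow> nat \<Rightarrow> nat \<Rightarrow> (nat \<times> nat) set \<Rightarrow> arrays \<Rightarrow> bool" where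
  "marked P \<Delta> n t T A \<longleftrightarrow> (\<forall>a<n. \<forall>b<n.
     A a_last (a * n + b) = (if (a, b) \<in> T then Suc t else lastp (P a b) t) \<and>
     (A a_bad (a * n + b) = 0 \<longleftrightarrow>
        gapless \<Delta> (P a b) t \<and> ((a, b) \<in> T \<longrightarrow> Suc t - lastp (P a b) t \<le> \<Delta>)))"

lemma marked_Suc:
  assumes "marked P \<Delta> n t T A" and "\<And>a b. a < n \<Longrightarrow> b < n \<Longrightarrow> (a, b) \<in> T \<longleftrightarrow> P a b (Suc t)"
  shows "marked P \<Delta> n (Suc t) {} A"
  using assms unfolding marked_def by simp

lemma runs_touch:
  assumes "rows n A" and m: "marked P (R r_Delta) n (R r_t) T A" and uv: "R u < n" "R v < n"
    and "u \<noteq> r_x" "v \<noteq> r_x"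
  shows "runs x (touch u v) R A 3 (\<lambda>R' A'. marked P (R r_Delta) n (R r_t) (insert (R u, R v) T) A')"
proof -
  let ?i = "R u * n + R v"
  have "A a_row (R u) = R u * n" using assms(1,3) unfolding rows_def by simp
  moreover have "marked P (R r_Delta) n (R r_t) (insert (R u, R v) T)
      (A(a_bad := (A a_bad)(?i := A a_bad ?i + (R r_t + 1 - A a_last ?i - R r_Delta)),
         a_last := (A a_last)(?i := R r_t + 1)))"
    unfolding marked_def
  proof (intro allI impI)
    fix a b assume ab: "a < n" "b < n"
    have "a * n + b = ?i \<longleftrightarrow> a = R u \<and> b = R v" using row_index_eq ab uv by blast
    then show "(A(a_bad := (A a_bad)(?i := A a_bad ?i + (R r_t + 1 - A a_last ?i - R r_Delta)),
         a_last := (A a_last)(?i := R r_t + 1))) a_last (a * n + b) =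
         (if (a, b) \<in> insert (R u, R v) T then Suc (R r_t) else lastp (P a b) (R r_t)) \<and>
       ((A(a_bad := (A a_bad)(?i := A a_bad ?i + (R r_t + 1 - A a_last ?i - R r_Delta)),
         a_last := (A a_last)(?i := R r_t + 1))) a_bad (a * n + b) = 0 \<longleftrightarrow>
        gapless (R r_Delta) (P a b) (R r_t) \<and>
        ((a, b) \<in> insert (R u, R v) T \<longrightarrow> Suc (R r_t) - lastp (P a b) (R r_t) \<le> R r_Delta))"
      using m[unfolded marked_def, rule_format, OF ab] by auto
  qed
  ultimately show ?thesis using assms(5,6) unfolding touch_def runs_Asg_Sq runs_Put_Sq runs_Put
    by (simp add: fun_upd_twist[of a_last a_bad])
qed

definition scan_edges :: "cmd \<Rightarrow> cmd" where
  "scan_edges c =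
     (r_p ::= Lit 4 ;;
      For r_t r_tau
        (r_e ::= Inp (Reg r_p) ;;
         r_p ::= Reg r_p .+ Lit 1 ;;
         For r_z r_e
           (r_u ::= Inp (Reg r_p) ;;
            r_v ::= Inp (Reg r_p .+ Lit 1) ;;
            r_p ::= Reg r_p .+ Lit 2 ;;
            c)))"

lemma scan_edges_frame [simp]:
  "mods (scan_edges c) = {r_p, r_t, r_e, r_z, r_u, r_v} \<union> mods c" "amods (scan_edges c) = amods c"
  by (auto simp: scan_edges_def)

definition mark_edge :: cmd where
  "mark_edge = (touch r_u r_v ;; touch r_v r_u)"

definition insert_edge :: cmd where
  "insert_edge =
     (r_x ::= Ar a_row (Reg r_u) .+ Reg r_v ;;
      Cond (Ar a_adj (Reg r_x) .+ Ar a_bad (Reg r_x) .+ (Reg r_w .- Ar a_last (Reg r_x)))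
        (r_a ::= Lit 0) add_edge)"

lemma edge_frames [simp]:
  "mods mark_edge = {r_x}" "amods mark_edge = {a_last, a_bad}"
  "mods insert_edge = {r_x, r_a}" "amods insert_edge = {a_adj, a_nb, a_deg}"
  by (simp_all add: mark_edge_def insert_edge_def insert_commute)

definition edge_main :: cmd where
  "edge_main =
     (r_w ::= Reg r_tau .+ Lit 1 .- Reg r_Delta ;;
      Cond (Reg r_k .- Lit 2) (power_prog ;; degree_bound) (r_D ::= Lit 0) ;;
      setup_rows ;;
      scan_edges mark_edge ;;
      scan_edges insert_edge ;;
      r_found ::= Lit 0 ;;
      search_all ;;
      r_found ::= Lit 1 .- (Lit 1 .- Reg r_found))"

definition with_params :: "cmd \<Rightarrow> cmd" where
  "with_params c =
     (r_n ::= Inp (Lit 0) ;;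
      r_tau ::= Inp (Lit 1) ;;
      r_Delta ::= Inp (Lit 2) ;;
      r_k ::= Inp (Lit 3) ;;
      Cond (Reg r_k .- Reg r_n) (r_found ::= Lit 0)
        (Cond (Lit 2 .- Reg r_k) (r_found ::= Lit 1) c))"

lemma symp_assoc: "symp (assoc G \<Delta> vs)"
  by (rule sympI) (metis assoc_sym)

locale edge_input =
  fixes G :: "nat temporal_graph" and \<Delta> k :: nat and xs :: "nat list" and vs es
  assumes G: "temporal_unit_interval_graph G" and \<Delta>: "1 \<le> \<Delta>" "\<Delta> \<le> lifetime G"
    and vs: "distinct vs" "set vs = verts G"
    and es: "\<And>t. t \<in> {1..lifetime G} \<Longrightarrow> set (es t) \<subseteq> {..<length vs} \<times> {..<length vs} \<and>
      layer G t = set (map (\<lambda>(i, j). {vs ! i, vs ! j}) (es t))"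
    and xs: "xs = [length vs, lifetime G, \<Delta>, k] @
       concat (map (\<lambda>t. length (es t) # concat (map (\<lambda>(i, j). [i, j]) (es t))) [1..<lifetime G + 1])"
begin

abbreviation n where "n \<equiv> length vs"
abbreviation \<tau> where "\<tau> \<equiv> lifetime G"

abbreviation x where "x \<equiv> input xs"

definition pos where "pos t = 4 + (\<Sum>s<t. 1 + 2 * length (es (Suc s)))"

lemma pos_Suc: "pos (Suc t) = pos t + 1 + 2 * length (es (Suc t))"
  unfolding pos_def by simp

abbreviation P where "P a b s \<equiv> {vs ! a, vs ! b} \<in> layer G s"

lemma xs_alt: "xs = [n, \<tau>, \<Delta>, k] @
    concat (map (\<lambda>t. length (es (Suc t)) # concat (map (\<lambda>(i, j). [i, j]) (es (Suc t)))) [0..<\<tau>])"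
proof -
  have "[1..<\<tau> + 1] = map Suc [0..<\<tau>]" by (simp add: map_Suc_upt)
  then show ?thesis unfolding xs by (simp add: comp_def del: upt_Suc)
qed

lemma length_xs: "length xs = pos \<tau>"
  unfolding xs_alt pos_def by (simp add: length_concat_upt length_concat_pairs)

lemma pos_less: "t < \<tau> \<Longrightarrow> pos t + 2 * length (es (Suc t)) < pos \<tau>"
proof -
  assume "t < \<tau>"
  then have "(\<Sum>s<Suc t. 1 + 2 * length (es (Suc s))) \<le> (\<Sum>s<\<tau>. 1 + 2 * length (es (Suc s)))"
    by (intro sum_mono2) auto
  then show ?thesis unfolding pos_def by simp
qed

lemma x_params: "x 0 = n" "x 1 = \<tau>" "x 2 = \<Delta>" "x 3 = k"
  unfolding input_def by (simp_all add: xs_alt)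

lemma x_pos:
  assumes "t < \<tau>" and "i < 1 + 2 * length (es (Suc t))"
  shows "x (pos t + i) = (length (es (Suc t)) # concat (map (\<lambda>(i, j). [i, j]) (es (Suc t)))) ! i"
proof -
  let ?g = "\<lambda>t. length (es (Suc t)) # concat (map (\<lambda>(i, j). [i, j]) (es (Suc t)))"
  have "pos t + i < length xs" using assms pos_less[of t] length_xs by simp
  moreover have "pos t + i = 4 + ((\<Sum>s<t. length (?g s)) + i)"
    unfolding pos_def by (simp add: length_concat_pairs)
  moreover have "xs ! (4 + ((\<Sum>s<t. length (?g s)) + i)) = ?g t ! i"
    unfolding xs_alt using nth_concat_upt[of t \<tau> i ?g] assms
    by (subst nth_append) (simp add: length_concat_pairs)
  ultimately show ?thesis unfolding input_def by metis
qed

lemma x_edges: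
  assumes "t < \<tau>"
  shows "x (pos t) = length (es (Suc t))"
    and "z < length (es (Suc t)) \<Longrightarrow> x (pos t + 1 + 2 * z) = fst (es (Suc t) ! z)"
    and "z < length (es (Suc t)) \<Longrightarrow> x (pos t + 1 + 2 * z + 1) = snd (es (Suc t) ! z)"
  using x_pos[OF assms, of 0] x_pos[OF assms, of "1 + 2 * z"] x_pos[OF assms, of "1 + 2 * z + 1"]
  by (simp_all add: nth_concat_pairs)

lemma tg: "temporal_graph G" using G unfolding temporal_unit_interval_graph_def by simp

lemma edge_bounds:
  assumes "t < \<tau>" and "(u, v) \<in> set (es (Suc t))"
  shows "u < n" "v < n" "u \<noteq> v" "P u v (Suc t)"
proof -
  have t: "Suc t \<in> {1..\<tau>}" using assms(1) by simp
  show "u < n" "v < n" using es[OF t] assms(2) by auto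
  show P: "P u v (Suc t)" using es[OF t] assms(2) by force
  then have "card {vs ! u, vs ! v} = 2" using tg unfolding temporal_graph_def layer_def by blast
  then show "u \<noteq> v" by auto
qed

lemma P_iff:
  assumes "t < \<tau>" and "a < n" "b < n"
  shows "P a b (Suc t) \<longleftrightarrow> (a, b) \<in> set (es (Suc t)) \<or> (b, a) \<in> set (es (Suc t))"
proof
  assume "P a b (Suc t)"
  then obtain i j where ij: "(i, j) \<in> set (es (Suc t))" "{vs ! a, vs ! b} = {vs ! i, vs ! j}"
    using es[of "Suc t"] assms(1) by auto
  have "i < n" "j < n" using edge_bounds[OF assms(1) ij(1)] by auto
  then show "(a, b) \<in> set (es (Suc t)) \<or> (b, a) \<in> set (es (Suc t))"
    using ij assms vs(1) by (auto simp: doubleton_eq_iff nth_eq_iff_index_eq)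
next
  assume "(a, b) \<in> set (es (Suc t)) \<or> (b, a) \<in> set (es (Suc t))"
  then show "P a b (Suc t)" using edge_bounds(4)[OF assms(1)] by (metis insert_commute)
qed

text \<open>\<open>J t z\<close> holds when \<open>z\<close> edges of layer \<open>t + 1\<close> and all edges of the layers before have been processed.\<close>

lemma runs_scan_edges:
  assumes mods: "mods c \<inter> {r_p, r_t, r_e, r_z, r_tau} = {}" and tau: "R r_tau = \<tau>"
    and init: "J 0 0 A"
    and step: "\<And>t z R' A'. t < \<tau> \<Longrightarrow> z < length (es (Suc t)) \<Longrightarrow> J t z A' \<Longrightarrow> R' r_t = t \<Longrightarrow>
      (R' r_u, R' r_v) = es (Suc t) ! z \<Longrightarrow>
      (\<And>v. v \<notin> {r_p, r_t, r_e, r_z, r_u, r_v} \<union> mods c \<Longrightarrow> R' v = R v) \<Longrightarrow>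
      (\<And>a. a \<notin> amods c \<Longrightarrow> A' a = A a) \<Longrightarrow> runs x c R' A' m (\<lambda>R'' A''. J t (Suc z) A'')"
    and nxt: "\<And>t A'. t < \<tau> \<Longrightarrow> J t (length (es (Suc t))) A' \<Longrightarrow> J (Suc t) 0 A'"
  shows "runs x (scan_edges c) R A ((m + 6) * length xs) (\<lambda>R' A'. J \<tau> 0 A')"
proof -
  let ?c = "r_u ::= Inp (Reg r_p) ;; r_v ::= Inp (Reg r_p .+ Lit 1) ;; r_p ::= Reg r_p .+ Lit 2 ;; c"
  let ?body = "r_e ::= Inp (Reg r_p) ;; r_p ::= Reg r_p .+ Lit 1 ;; For r_z r_e ?c"
  let ?l = "\<lambda>t. length (es (Suc t))"
  have md: "r_p \<notin> mods c" "r_t \<notin> mods c" "r_e \<notin> mods c" "r_z \<notin> mods c" "r_tau \<notin> mods c"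
    using mods by auto
  have "runs x (For r_t r_tau ?body) (R(r_p := 4)) A ((m + 6) * length xs - 1) (\<lambda>R' A'. J \<tau> 0 A')"
  proof (rule runs_For[where I = "\<lambda>t R' A'. R' r_p = pos t \<and> J t 0 A'" and f = "\<lambda>t. 4 + (m + 5) * ?l t"],
      goal_cases)
    case (5 t R1 A1)
    have t: "t < \<tau>" using 5(1) tau by simp
    have e: "ev x (Inp (Reg r_p)) R1 A1 = ?l t" using 5(2) x_edges(1)[OF t] by simp
    let ?R = "R1(r_e := ?l t, r_p := pos t + 1)"
    have "runs x (For r_z r_e ?c) ?R A1 (2 + (m + 5) * ?l t)
        (\<lambda>R' A'. R' r_p = pos (Suc t) \<and> J (Suc t) 0 A')"
    proof (rule runs_For[where I = "\<lambda>z R' A'. R' r_p = pos t + 1 + 2 * z \<and> J t z A'" and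
          f = "\<lambda>_. m + 3"], goal_cases)
      case (5 z R2 A2)
      note o = \<open>\<And>v. v \<notin> insert r_t (mods ?body) \<Longrightarrow> R1 v = (R(r_p := 4)) v\<close>
      note oa = \<open>\<And>a. a \<notin> amods ?body \<Longrightarrow> A1 a = A a\<close>
      have z: "z < ?l t" using 5(1) by simp
      let ?R2 = "R2(r_u := fst (es (Suc t) ! z), r_v := snd (es (Suc t) ! z), r_p := pos t + 1 + 2 * z + 2)"
      have e2: "ev x (Inp (Reg r_p)) R2 A2 = fst (es (Suc t) ! z)"
        using 5(2) x_edges(2)[OF t z] by simp
      have e3: "ev x (Inp (Reg r_p .+ Lit 1)) (R2(r_u := fst (es (Suc t) ! z))) A2 = snd (es (Suc t) ! z)"
        using 5(2) x_edges(3)[OF t z] by simp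
      have "runs x c ?R2 A2 m (\<lambda>R'' A''. J t (Suc z) A'')"
      proof (rule step[OF t z], goal_cases)
        case 2
        have "R2 r_t = R1 r_t" using 5(4)[of r_t] md by simp
        then show ?case using \<open>R1 r_t = t\<close> by simp
      next
        case (4 v)
        then show ?case using 5(4)[of v] o[of v] by simp
      next
        case (5 a)
        then show ?case using \<open>\<And>a. a \<notin> amods ?c \<Longrightarrow> A2 a = A1 a\<close> oa by simp
      qed (use 5(2) in simp_all)
      then have "runs x c ?R2 A2 m (\<lambda>R'' A''. (R''(r_z := Suc z)) r_p = pos t + 1 + 2 * Suc z \<and> J t (Suc z) A'')"
        by (rule runs_conseq) (use md in simp_all)
      then show ?case using 5(2) by (simp only: runs_Asg_Sq e2 e3) simp
    next
      case (7 R' A')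
      then show ?case using nxt[OF t] pos_Suc by simp
    qed (use md 5(2) in auto)
    then show ?case using 5(2) by (simp only: runs_Asg_Sq e) simp
  next
    case 6
    have "(\<Sum>t<\<tau>. 4 + (m + 5) * ?l t + 2) \<le> (\<Sum>t<\<tau>. (m + 6) * (1 + 2 * ?l t))"
      by (intro sum_mono) (simp add: algebra_simps)
    also have "\<dots> = (m + 6) * (length xs - 4)"
      unfolding length_xs pos_def by (simp add: sum_distrib_left)
    finally have "2 + (\<Sum>t<\<tau>. 4 + (m + 5) * ?l t + 2) \<le> 2 + (m + 6) * (length xs - 4)" by simp
    also have "\<dots> \<le> (m + 6) * length xs - 1"
    proof -
      obtain d where "length xs = 4 + d" using length_xs unfolding pos_def by simp
      then show ?thesis by (simp add: algebra_simps)
    qed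
    finally show ?case using tau by simp
  qed (use md tau init pos_def in auto)
  moreover have "1 \<le> (m + 6) * length xs" using length_xs unfolding pos_def by simp
  ultimately show ?thesis unfolding scan_edges_def runs_Asg_Sq ev.simps by simp
qed

lemma runs_mark_edges:
  assumes "R r_tau = \<tau>" "R r_Delta = \<Delta>" and "rows n A" and "\<And>i. A a_last i = 0" "\<And>i. A a_bad i = 0"
  shows "runs x (scan_edges mark_edge) R A (12 * length xs) (\<lambda>R' A'. marked P \<Delta> n \<tau> {} A')"
proof -
  let ?T = "\<lambda>t z. {(a, b). \<exists>y<z. es (Suc t) ! y = (a, b) \<or> es (Suc t) ! y = (b, a)}"
  have "runs x (scan_edges mark_edge) R A ((6 + 6) * length xs) (\<lambda>R' A'. marked P \<Delta> n \<tau> (?T \<tau> 0) A')"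
  proof (rule runs_scan_edges[where J = "\<lambda>t z. marked P \<Delta> n t (?T t z)"], goal_cases)
    case (4 t z R1 A1)
    have "(R1 r_u, R1 r_v) \<in> set (es (Suc t))" using 4(2,5) by simp
    note b = edge_bounds[OF 4(1) this]
    have r: "rows n A1" using 4(7)[of a_row] assms(3) unfolding rows_def by simp
    have d: "R1 r_Delta = \<Delta>" using 4(6) assms(2) by simp
    have "runs x (touch r_u r_v) R1 A1 3
      (\<lambda>R' A'. marked P \<Delta> n t (insert (R1 r_u, R1 r_v) (?T t z)) A')"
      using runs_touch[OF r, of P R1 "?T t z" r_u r_v x] 4(3,4) b d by simp
    then show ?case unfolding mark_edge_def
    proof (rule runs_Sq[where t' = 3], goal_cases)
      case (1 R2 A2)
      have r2: "rows n A2" using 1(3)[of a_row] r unfolding rows_def by simp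
      have "insert (R1 r_v, R1 r_u) (insert (R1 r_u, R1 r_v) (?T t z)) = ?T t (Suc z)"
        using 4(5)[symmetric] by (auto simp: less_Suc_eq)
      then show ?case using runs_touch[OF r2, of P R2 "insert (R1 r_u, R1 r_v) (?T t z)" r_v r_u x]
          1(1,2) 4(4) b d by simp
    qed simp
  next
    case (5 t A1)
    have "marked P \<Delta> n (Suc t) {} A1"
    proof (rule marked_Suc[OF 5(2)])
      fix a b assume "a < n" "b < n"
      then show "(a, b) \<in> ?T t (length (es (Suc t))) \<longleftrightarrow> P a b (Suc t)"
        unfolding P_iff[OF 5(1) \<open>a < n\<close> \<open>b < n\<close>] by (auto simp: in_set_conv_nth)
    qed
    then show ?case by simp
  qed (use assms in \<open>auto simp: marked_def\<close>)
  then show ?thesis by simp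
qed

lemma represents_assoc:
  assumes "represents_graph n A E" and "symp E" and "\<And>a b. E a b \<Longrightarrow> assoc G \<Delta> vs a b"
    and "\<And>s u v. s < \<tau> \<Longrightarrow> (u, v) \<in> set (es (Suc s)) \<Longrightarrow> assoc G \<Delta> vs u v \<Longrightarrow> E u v"
  shows "represents_graph n A (assoc G \<Delta> vs)"
proof (rule represents_graph_cong[OF assms(1)])
  fix u v assume uv: "u < n" "v < n"
  show "E u v \<longleftrightarrow> assoc G \<Delta> vs u v"
  proof
    assume a: "assoc G \<Delta> vs u v"
    then have "\<exists>j\<in>{1..1 + \<Delta> - 1}. P u v j"
      unfolding assoc_def association_edges_iff by (rule bspec) simp
    then obtain j where "j \<in> {1..1 + \<Delta> - 1}" "P u v j" by blast
    then have "j - 1 < \<tau>" "P u v (Suc (j - 1))" using \<Delta> by auto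
    then show "E u v" using P_iff[of "j - 1" u v] uv assms(4)[of "j - 1"] a assms(2) assoc_sym
      by (metis sympD)
  qed (rule assms(3))
qed simp

lemma runs_insert_edges:
  assumes "R r_tau = \<tau>" "R r_w = \<tau> - \<Delta> + 1" and "rows n A" and m: "marked P \<Delta> n \<tau> {} A"
    and "\<And>i. A a_adj i = 0" "\<And>i. A a_deg i = 0"
  shows "runs x (scan_edges insert_edge) R A (14 * length xs)
    (\<lambda>R' A'. represents_graph n A' (assoc G \<Delta> vs))"
proof -
  let ?new = "\<lambda>t z s u v. s < t \<and> (u, v) \<in> set (es (Suc s)) \<or> s = t \<and> (\<exists>y<z. es (Suc s) ! y = (u, v))"
  let ?J = "\<lambda>t z A. \<exists>E. represents_graph n A E \<and> symp E \<and> (\<forall>a b. E a b \<longrightarrow> assoc G \<Delta> vs a b) \<and>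
    (\<forall>s u v. ?new t z s u v \<longrightarrow> assoc G \<Delta> vs u v \<longrightarrow> E u v)"
  have "runs x (scan_edges insert_edge) R A ((8 + 6) * length xs) (\<lambda>R' A'. ?J \<tau> 0 A')"
  proof (rule runs_scan_edges[where J = ?J], goal_cases)
    case 3
    show ?case using represents_graph_empty[of A n] assms(5,6)
      by (intro exI[of _ "\<lambda>_ _. False"]) (auto simp: symp_def)
  next
    case (4 t z R1 A1)
    let ?u = "R1 r_u" and ?v = "R1 r_v"
    obtain E where E: "represents_graph n A1 E" "symp E" "\<And>a b. E a b \<Longrightarrow> assoc G \<Delta> vs a b"
      "\<And>s u v. ?new t z s u v \<Longrightarrow> assoc G \<Delta> vs u v \<Longrightarrow> E u v" using 4(3) by blast
    have "(?u, ?v) \<in> set (es (Suc t))" using 4(2,5) by simp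
    note b = edge_bounds[OF 4(1) this]
    have r: "rows n A1" using 4(7)[of a_row] assms(3) unfolding rows_def by simp
    let ?i = "?u * n + ?v"
    let ?R = "R1(r_x := ?i)"
    have row: "ev x (Ar a_row (Reg r_u) .+ Reg r_v) R1 A1 = ?i" using r b unfolding rows_def by simp
    have good: "A1 a_bad ?i + (R1 r_w - A1 a_last ?i) = 0 \<longleftrightarrow> assoc G \<Delta> vs ?u ?v"
      using m b 4(6)[of r_w] 4(7)[of a_bad] 4(7)[of a_last] assms(2) assoc_iff_gapless[OF \<Delta>, of vs ?u ?v]
      unfolding marked_def by simp
    have adj: "A1 a_adj ?i = of_bool (E ?u ?v)" using E(1) b unfolding represents_graph_def by simp
    have new: "?new t (Suc z) s u v \<longleftrightarrow> ?new t z s u v \<or> s = t \<and> u = ?u \<and> v = ?v" for s u v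
      using 4(5) by (auto simp: less_Suc_eq)
    have "runs x (Cond (Ar a_adj (Reg r_x) .+ Ar a_bad (Reg r_x) .+ (Reg r_w .- Ar a_last (Reg r_x)))
        (r_a ::= Lit 0) add_edge) ?R A1 7 (\<lambda>R' A'. ?J t (Suc z) A')"
    proof (rule runs_Cond[where t = 6], goal_cases)
      case 1
      then have "E ?u ?v \<or> \<not> assoc G \<Delta> vs ?u ?v" using good adj by auto
      then have "?J t (Suc z) A1" unfolding new using E by blast
      then show ?case by (simp add: runs_Asg)
    next
      case 2
      then have "\<not> E ?u ?v" "assoc G \<Delta> vs ?u ?v" using good adj by auto
      note add = runs_add_edge[OF r E(1,2), of ?R x]
      show ?case
      proof (rule runs_conseq[OF add], goal_cases)
        case (6 R' A')
        then have "represents_graph n A' (plus_edge E ?u ?v)" by simp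
        moreover have "plus_edge E ?u ?v a b \<longrightarrow> assoc G \<Delta> vs a b" for a b
          using E(3) \<open>assoc G \<Delta> vs ?u ?v\<close> assoc_sym unfolding plus_edge_def by blast
        moreover have "?new t (Suc z) s u v \<longrightarrow> assoc G \<Delta> vs u v \<longrightarrow> plus_edge E ?u ?v u v" for s u v
          unfolding new using E(4) unfolding plus_edge_def by blast
        ultimately show ?case using symp_plus_edge[OF E(2)] by blast
      qed (use b \<open>\<not> E ?u ?v\<close> in auto)
    qed simp
    then show ?case unfolding insert_edge_def runs_Asg_Sq row by simp
  next
    case (5 t A1)
    obtain E where E: "represents_graph n A1 E" "symp E" "\<forall>a b. E a b \<longrightarrow> assoc G \<Delta> vs a b"
      "\<And>s u v. ?new t (length (es (Suc t))) s u v \<Longrightarrow> assoc G \<Delta> vs u v \<Longrightarrow> E u v"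
      using 5(2) by blast
    have "?new (Suc t) 0 s u v \<Longrightarrow> ?new t (length (es (Suc t))) s u v" for s u v
      by (auto simp: less_Suc_eq in_set_conv_nth)
    then have "\<forall>s u v. ?new (Suc t) 0 s u v \<longrightarrow> assoc G \<Delta> vs u v \<longrightarrow> E u v"
      using E(4) by metis
    then show ?case using E(1-3) by (intro exI[of _ E] conjI)
  qed (use assms in auto)
  then have "runs x (scan_edges insert_edge) R A (14 * length xs) (\<lambda>R' A'. ?J \<tau> 0 A')" by simp
  then show ?thesis
  proof (rule runs_conseq, goal_cases)
    case (2 R' A')
    then obtain E where E: "represents_graph n A' E" "symp E" "\<And>a b. E a b \<Longrightarrow> assoc G \<Delta> vs a b"
      "\<And>s u v. ?new \<tau> 0 s u v \<Longrightarrow> assoc G \<Delta> vs u v \<Longrightarrow> E u v" by blast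
    show ?case by (rule represents_assoc[OF E(1-3) E(4)]) auto
  qed simp
qed

lemma runs_edge_main:
  assumes R: "R r_n = n" "R r_tau = \<tau>" "R r_Delta = \<Delta>" "R r_k = k" and k: "2 \<le> k" "k \<le> n"
  shows "runs x edge_main R (\<lambda>_ _. 0) (65 * (2 ^ ((k - 2) * (2 * \<Delta>) ^ (\<tau> - \<Delta> + 1)) * n) + 26 * length xs)
    (\<lambda>R' A'. R' r_found = (if temporal_clique \<Delta> G k then 1 else 0))"
proof -
  define w where "w = \<tau> - \<Delta> + 1"
  define D where "D = (k - 2) * (2 * \<Delta>) ^ w"
  let ?A = "\<lambda>_ _. 0 :: nat"
  let ?F = "\<lambda>R'. R' r_found = (if temporal_clique \<Delta> G k then 1 else 0)"
  let ?c7 = "r_found ::= Lit 1 .- (Lit 1 .- Reg r_found)"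
  let ?c6 = "search_all ;; ?c7"
  let ?c5 = "r_found ::= Lit 0 ;; ?c6"
  let ?c4 = "scan_edges insert_edge ;; ?c5"
  let ?c3 = "scan_edges mark_edge ;; ?c4"
  let ?c2 = "setup_rows ;; ?c3"
  let ?t = "33 * (2 ^ D * n)"
  have n: "1 \<le> n" using k by simp
  have wD: "w + \<Delta> - 1 = \<tau>" "\<tau> + 1 - \<Delta> = w" using \<Delta> unfolding w_def by auto
  have le: "w * \<Delta> \<le> (2 * \<Delta>) ^ w" by (rule windows_le_power[OF \<Delta>(1)]) (simp add: w_def)
  have c7: "runs x ?c6 R' A' (3 + ?t) (\<lambda>R' A'. ?F R')"
    if "represents_graph n A' (assoc G \<Delta> vs)" "rows n A'" "R' r_found = 0" "R' r_n = n" "R' r_k = k"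
      "R' r_D = D" for R' A'
  proof (rule runs_Sq[OF runs_search_all[of "assoc G \<Delta> vs"], where t' = 1], goal_cases)
    case 1
    show ?case by (rule symp_assoc)
  next
    case (5 R2 A2)
    have "(\<exists>v<n. hit n D k (assoc G \<Delta> vs) v) \<longleftrightarrow> temporal_clique \<Delta> G k"
      unfolding temporal_clique_iff[OF vs]
    proof (rule search_criterion)
      fix v assume "v < n" "D < card {u. u < n \<and> assoc G \<Delta> vs v u}"
      then show "\<exists>S\<subseteq>{..<n}. k \<le> card S \<and> vclique (assoc G \<Delta> vs) S"
        using large_degree_temporal_clique[OF G \<Delta> k(1) vs, of v] temporal_clique_iff[OF vs]
        unfolding D_def w_def by blast
    qed (use symp_assoc assoc_irrefl[OF tg \<Delta>(1)] k in auto)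
    then show ?case using 5(1) that by (auto simp: runs_Asg)
  qed (use that k in \<open>auto simp: algebra_simps\<close>)
  have c4: "runs x ?c4 R' A' (4 + ?t + 14 * length xs) (\<lambda>R' A'. ?F R')"
    if "marked P \<Delta> n \<tau> {} A'" "rows n A'" "R' r_n = n" "R' r_k = k" "R' r_D = D" "R' r_tau = \<tau>" "R' r_w = w"
      "\<And>i. A' a_adj i = 0" "\<And>i. A' a_deg i = 0" for R' A'
  proof (rule runs_Sq[OF runs_insert_edges[of R' A'], where t' = "4 + ?t"], goal_cases)
    case (7 R2 A2)
    have "rows n A2" using 7(3)[of a_row] that(2) unfolding rows_def by simp
    then show ?case unfolding runs_Asg_Sq using c7[of A2 "R2(r_found := 0)"] 7 that by simp
  qed (use that in \<open>auto simp: w_def\<close>)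
  have c3: "runs x ?c3 R' A' (4 + ?t + 26 * length xs) (\<lambda>R' A'. ?F R')"
    if "rows n A'" "R' r_n = n" "R' r_k = k" "R' r_D = D" "R' r_tau = \<tau>" "R' r_w = w" "R' r_Delta = \<Delta>"
      "\<And>a i. a \<noteq> a_row \<Longrightarrow> A' a i = 0" for R' A'
  proof (rule runs_Sq[OF runs_mark_edges[of R' A'], where t' = "4 + ?t + 14 * length xs"], goal_cases)
    case (6 R2 A2)
    have "rows n A2" using 6(3)[of a_row] that(1) unfolding rows_def by simp
    then show ?case using c4[of A2 R2] 6 that by simp
  qed (use that in auto)
  have c2: "runs x ?c2 R' ?A (7 + 4 * n + ?t + 26 * length xs) (\<lambda>R' A'. ?F R')"
    if "R' r_n = n" "R' r_k = k" "R' r_D = D" "R' r_tau = \<tau>" "R' r_w = w" "R' r_Delta = \<Delta>" for R'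
  proof (rule runs_Sq[OF runs_setup_rows[of x R'], where t' = "4 + ?t + 26 * length xs"], goal_cases)
    case (1 R2 A2)
    then show ?case using c3[of A2 R2] that by simp
  qed (use that in auto)
  have pow: "1 \<le> (2::nat) ^ D" by simp
  let ?R = "R(r_w := w)"
  have cond: "runs x (Cond (Reg r_k .- Lit 2) (power_prog ;; degree_bound) (r_D ::= Lit 0)) ?R ?A (20 * 2 ^ D)
      (\<lambda>R' A'. R' r_D = D)"
  proof (rule runs_Cond[where t = "20 * 2 ^ D - 1"], goal_cases)
    case 1
    then have k3: "3 \<le> k" using R by simp
    have D: "(2 * \<Delta>) ^ w \<le> D" "k - 2 \<le> D" unfolding D_def using k3 \<Delta> by auto
    have "w \<le> w * \<Delta>" using \<Delta> by simp
    moreover have "w * (6 + 3 * \<Delta>) = 6 * w + 3 * (w * \<Delta>)" by (simp add: algebra_simps)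
    ultimately have "w * (6 + 3 * \<Delta>) \<le> 9 * D" using le D(1) by linarith
    then have "3 + w * (6 + 3 * \<Delta>) + (4 + 3 * (k - 2)) \<le> 7 + 12 * D" using D(2) by simp
    also have "\<dots> \<le> 20 * 2 ^ D - 1" using less_exp[of D] by linarith
    finally have t: "3 + w * (6 + 3 * \<Delta>) + (4 + 3 * (k - 2)) \<le> 20 * 2 ^ D - 1" .
    show ?case
    proof (rule runs_Sq[OF runs_power_prog, where t' = "4 + 3 * (k - 2)"], goal_cases)
      case (1 R2 A2)
      show ?case by (rule runs_conseq[OF runs_degree_bound]) (use 1 R in \<open>auto simp: D_def\<close>)
    qed (use t R in auto)
  next
    case 2
    then have "k = 2" using R k by simp
    then have "D = 0" unfolding D_def by simp
    then show ?case by (simp add: runs_Asg)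
  qed (use pow in linarith)
  have "runs x (Cond (Reg r_k .- Lit 2) (power_prog ;; degree_bound) (r_D ::= Lit 0) ;; ?c2) ?R ?A
      (20 * 2 ^ D + (7 + 4 * n + ?t + 26 * length xs)) (\<lambda>R' A'. ?F R')"
  proof (rule runs_Sq[OF cond, where t' = "7 + 4 * n + ?t + 26 * length xs"], goal_cases)
    case (1 R2 A2)
    then have "A2 = ?A" by auto
    then show ?case using c2[of R2] 1 R by simp
  qed simp
  then have "runs x (Cond (Reg r_k .- Lit 2) (power_prog ;; degree_bound) (r_D ::= Lit 0) ;; ?c2) ?R ?A
      (65 * (2 ^ D * n) + 26 * length xs - 1) (\<lambda>R' A'. ?F R')"
  proof (rule runs_conseq)
    have "1 * n \<le> 2 ^ D * n" "2 ^ D * 1 \<le> 2 ^ D * n" using n by (intro mult_le_mono; simp)+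
    then show "20 * 2 ^ D + (7 + 4 * n + ?t + 26 * length xs) \<le> 65 * (2 ^ D * n) + 26 * length xs - 1"
      using n by linarith
  qed
  moreover have "1 \<le> 65 * (2 ^ D * n) + 26 * length xs" using length_xs unfolding pos_def by simp
  ultimately show ?thesis
    using R wD unfolding edge_main_def runs_Asg_Sq D_def[symmetric] w_def[symmetric] by simp
qed

end

lemma runs_with_params:
  assumes x: "x 0 = card (verts G)" "x 1 = lifetime G" "x 2 = \<Delta>" "x 3 = k" and fin: "finite (verts G)"
    and main: "\<And>R. R r_n = card (verts G) \<Longrightarrow> R r_tau = lifetime G \<Longrightarrow> R r_Delta = \<Delta> \<Longrightarrow> R r_k = k \<Longrightarrow>
      2 \<le> k \<Longrightarrow> k \<le> card (verts G) \<Longrightarrow>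
      runs x c R A t (\<lambda>R' A'. R' r_found = (if temporal_clique \<Delta> G k then 1 else 0))"
  shows "runs x (with_params c) R A (7 + t) (\<lambda>R' A'. R' r_found = (if temporal_clique \<Delta> G k then 1 else 0))"
proof -
  let ?R = "R(r_n := card (verts G), r_tau := lifetime G, r_Delta := \<Delta>, r_k := k)"
  have large: "\<not> temporal_clique \<Delta> G k" if "card (verts G) < k"
  proof
    assume "temporal_clique \<Delta> G k"
    then obtain V' where "V' \<subseteq> verts G" "k \<le> card V'" unfolding temporal_clique_def by blast
    with card_mono[OF fin this(1)] that show False by simp
  qed
  have small: "temporal_clique \<Delta> G k" if k: "k < 2" "k \<le> card (verts G)"
  proof -
    obtain S where "S \<subseteq> verts G" "card S = k" using k(2) by (meson obtain_subset_with_card_n)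
    moreover have "\<forall>u\<in>S. \<forall>v\<in>S. u = v"
      using k(1) \<open>card S = k\<close> card_le_Suc0_iff_eq[OF finite_subset[OF \<open>S \<subseteq> verts G\<close> fin]] by simp
    then have "is_clique E S" for E unfolding is_clique_def by blast
    ultimately show ?thesis unfolding temporal_clique_def by (intro exI[of _ S]) simp
  qed
  have "runs x (Cond (Reg r_k .- Reg r_n) (r_found ::= Lit 0)
        (Cond (Lit 2 .- Reg r_k) (r_found ::= Lit 1) c)) ?R A (3 + t)
        (\<lambda>R' A'. R' r_found = (if temporal_clique \<Delta> G k then 1 else 0))"
    by (rule runs_Cond[where t = "2 + t"]; (rule runs_Cond[where t = "1 + t"])?)
      (use large small main[of ?R] in \<open>auto simp: runs_Asg elim!: runs_conseq\<close>)
  then show ?thesis using x unfolding with_params_def runs_Asg_Sq by simp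
qed

section \<open>Locating the end of the input\<close>

lemma exec_While_count:
  assumes body: "\<And>j R. j < m \<Longrightarrow> I j R \<Longrightarrow> \<exists>R'. exec P (R, M) c (R', M) \<and> I (Suc j) R'"
    and guard: "\<And>j R. I j R \<Longrightarrow> R i = m - j" and "I j R" and "j \<le> m"
  shows "\<exists>R'. exec (While i P) (R, M) ((m - j) * Suc c + 1) (R', M) \<and> I m R'"
  using assms(3,4)
proof (induction "m - j" arbitrary: j R)
  case 0
  then have "j = m" by simp
  moreover have "exec (While i P) (R, M) 1 (R, M)"
    using guard[OF 0(2)] \<open>j = m\<close> by (intro exec.WhileFalse) simp
  ultimately show ?case using 0 by auto
next
  case (Suc d)
  then have j: "j < m" by simp
  obtain R1 where 1: "exec P (R, M) c (R1, M)" "I (Suc j) R1" using body[OF j Suc.prems(1)] by blast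
  obtain R2 where 2: "exec (While i P) (R1, M) ((m - Suc j) * Suc c + 1) (R2, M)" "I m R2"
    using Suc.hyps(1)[OF _ 1(2)] Suc.hyps(2) j by fastforce
  have "exec (While i P) (R, M) (Suc (c + ((m - Suc j) * Suc c + 1))) (R2, M)"
    using guard[OF Suc.prems(1)] j by (intro exec.WhileTrue[OF _ 1(1) 2(1)]) simp
  moreover have "Suc (c + ((m - Suc j) * Suc c + 1)) = (m - j) * Suc c + 1"
    using j by (simp add: Suc_diff_Suc[symmetric])
  ultimately show ?case using 2(2) by auto
qed

definition locate_edges :: "nat \<Rightarrow> com" where
  "locate_edges T =
     Seq (Const (T + 1) 1) (Seq (Load (T + 2) (T + 1)) (Seq (Const T 4)
       (While (T + 2) (Seq (Load (T + 3) T) (Seq (Add T T (T + 3)) (Seq (Add T T (T + 3))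
         (Seq (Add T T (T + 1)) (Sub (T + 2) (T + 2) (T + 1)))))))))"

lemma (in edge_input) exec_locate_edges:
  "\<exists>R t. exec (locate_edges T) (init_state xs) t (R, x) \<and> t \<le> 6 * length xs \<and> R T = length xs"
proof -
  let ?P = "Seq (Load (T + 3) T) (Seq (Add T T (T + 3)) (Seq (Add T T (T + 3))
         (Seq (Add T T (T + 1)) (Sub (T + 2) (T + 2) (T + 1)))))"
  let ?I = "\<lambda>j R. R T = pos j \<and> R (T + 1) = 1 \<and> R (T + 2) = \<tau> - j"
  define Z where "Z = (\<lambda>_::nat. 0::nat)"
  let ?R = "Z(T + 1 := 1, T + 2 := \<tau>, T := 4)"
  have init: "init_state xs = (Z, x)" unfolding init_state_def input_def Z_def by auto
  have "\<exists>R'. exec (While (T + 2) ?P) (?R, x) ((\<tau> - 0) * Suc 5 + 1) (R', x) \<and> ?I \<tau> R'"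
  proof (rule exec_While_count[where I = ?I and m = \<tau> and c = 5])
    fix j R assume j: "j < \<tau>" and I: "?I j R"
    show "\<exists>R'. exec ?P (R, x) 5 (R', x) \<and> ?I (Suc j) R'"
      using I x_edges(1)[OF j] pos_Suc[of j] j
      by (simp add: numeral_eq_Suc exec_Seq_simps exec_simps)
  qed (simp_all add: pos_def)
  then obtain R' where R': "exec (While (T + 2) ?P) (?R, x) (\<tau> * 6 + 1) (R', x)" "?I \<tau> R'" by auto
  have "exec (locate_edges T) (init_state xs) (Suc (Suc (Suc (\<tau> * 6 + 1)))) (R', x)"
  proof -
    have "x ((Z(T + 1 := 1)) (T + 1)) = \<tau>" using x_params(2) by simp
    then show ?thesis using R'(1) by (simp only: locate_edges_def init exec_Seq_simps)
  qed
  moreover have "\<tau> + 4 \<le> pos \<tau>"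
  proof -
    have "(\<Sum>s<\<tau>. 1) \<le> (\<Sum>s<\<tau>. 1 + 2 * length (es (Suc s)))" by (intro sum_mono) simp
    then show ?thesis unfolding pos_def by simp
  qed
  ultimately show ?thesis using R'(2) length_xs by (intro exI[of _ R'] exI[of _ "Suc (Suc (Suc (\<tau> * 6 + 1)))"]) simp
qed

lemma exec_located:
  assumes wf: "wfc T c" "0 < T"
    and locate: "\<exists>R t. exec P (init_state xs) t (R, input xs) \<and> t \<le> p \<and> R T = length xs"
    and runs: "\<And>R. runs (input xs) c R (\<lambda>_ _. 0) q (\<lambda>R' A'. R' 0 = y)"
  shows "\<exists>t R M. exec (Seq P (ccom T c)) (init_state xs) t (R, M) \<and> t \<le> p + ccost c * q \<and> R 0 = y"
proof -
  obtain R t where 1: "exec P (init_state xs) t (R, input xs)" "t \<le> p" "R T = length xs"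
    using locate by blast
  have "represents (input xs) (length xs) T (R, \<lambda>_ _. 0) (R, input xs)"
    unfolding represents_def input_def using 1(3) by simp
  from runs_compiled[OF wf(1) runs this wf(2)] obtain u r' where 2: "exec (ccom T c) (R, input xs) u r'"
    "u \<le> ccost c * q" "fst r' 0 = y" by auto
  have "exec (Seq P (ccom T c)) (init_state xs) (t + u) r'" by (rule exec.Seq[OF 1(1) 2(1)])
  moreover have "t + u \<le> p + ccost c * q" using 1(2) 2(2) by simp
  ultimately show ?thesis using 2(3) by (metis prod.collapse)
qed

theorem edge_encoding_solvable:
  "\<exists>P T. solves_temporal_clique P edge_encoding T \<and>
        (\<lambda>(\<Delta>, \<tau>, k, n, N). real (T (\<Delta>, \<tau>, k, n, N)))
          \<in> O[principal {(\<Delta>, \<tau>, k, n, N). 1 \<le> \<Delta> \<and> \<Delta> \<le> \<tau>}](\<lambda>(\<Delta>, \<tau>, k, n, N). clique_time \<Delta> \<tau> k n + real N)"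
proof -
  let ?c = "with_params edge_main"
  let ?K = "6 + 65 * ccost ?c"
  let ?P = "Seq (locate_edges 30) (ccom 30 ?c)"
  let ?T = "\<lambda>(\<Delta>, \<tau>, k, n, N). ?K * (2 ^ ((k - 2) * (2 * \<Delta>) ^ (\<tau> - \<Delta> + 1)) * n + N)"
  have wf: "wfc 30 ?c"
    unfolding with_params_def edge_main_def power_prog_def degree_bound_def setup_rows_def scan_edges_def
      mark_edge_def insert_edge_def touch_def add_edge_def search_all_def search_def inside_table_def
      extend_weights_def by simp
  have "solves_temporal_clique ?P edge_encoding ?T"
    unfolding solves_temporal_clique_def
  proof (intro allI impI, elim conjE)
    fix G :: "nat temporal_graph" and \<Delta> k xs
    assume G: "temporal_unit_interval_graph G" and \<Delta>: "1 \<le> \<Delta>" "\<Delta> \<le> lifetime G" and "edge_encoding G \<Delta> k xs"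
    then obtain vs es where e: "distinct vs" "set vs = verts G"
      "\<forall>t\<in>{1..lifetime G}.
        set (es t) \<subseteq> {..<length vs} \<times> {..<length vs} \<and>
        distinct (map (\<lambda>(i, j). {vs ! i, vs ! j}) (es t)) \<and>
        layer G t = set (map (\<lambda>(i, j). {vs ! i, vs ! j}) (es t))"
      "xs = [length vs, lifetime G, \<Delta>, k] @
        concat (map (\<lambda>t. length (es t) # concat (map (\<lambda>(i, j). [i, j]) (es t))) [1..<lifetime G + 1])"
      unfolding edge_encoding_def by blast
    interpret edge_input G \<Delta> k xs vs es
      by unfold_locales (use G \<Delta> e in blast)+
    let ?X = "2 ^ ((k - 2) * (2 * \<Delta>) ^ (\<tau> - \<Delta> + 1)) * n"
    let ?y = "if temporal_clique \<Delta> G k then 1 else 0 :: nat"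
    have card: "card (verts G) = n" using vs distinct_card by metis
    have "runs x ?c R (\<lambda>_ _. 0) (7 + (65 * ?X + 26 * length xs)) (\<lambda>R' A'. R' 0 = ?y)" for R
    proof (rule runs_with_params[OF _ x_params(2-4)])
      show "finite (verts G)" using vs(2) by (metis List.finite_set)
    qed (use card x_params(1) runs_edge_main in simp_all)
    from exec_located[OF wf _ exec_locate_edges this]
    obtain t R M where tRM: "exec ?P (init_state xs) t (R, M)"
      "t \<le> 6 * length xs + ccost ?c * (7 + (65 * ?X + 26 * length xs))" "R 0 = ?y" by auto
    have "4 \<le> length xs" unfolding length_xs pos_def by simp
    then have "7 + (65 * ?X + 26 * length xs) \<le> 65 * (?X + length xs)" by simp
    then have "ccost ?c * (7 + (65 * ?X + 26 * length xs)) \<le> ccost ?c * (65 * (?X + length xs))"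
      by (rule mult_le_mono2)
    also have "6 * length xs + \<dots> \<le> ?K * (?X + length xs)" by (simp add: algebra_simps)
    finally have "t \<le> ?T (\<Delta>, \<tau>, k, card (verts G), length xs)" using tRM(2) card by simp
    then show "\<exists>t R M. exec ?P (init_state xs) t (R, M) \<and>
           t \<le> ?T (\<Delta>, \<tau>, k, card (verts G), length xs) \<and> R 0 = ?y"
      using tRM(1,3) by blast
  qed
  moreover have "(\<lambda>(\<Delta>, \<tau>, k, n, N). real (?T (\<Delta>, \<tau>, k, n, N)))
          \<in> O[principal {(\<Delta>, \<tau>, k, n, N). 1 \<le> \<Delta> \<and> \<Delta> \<le> \<tau>}](\<lambda>(\<Delta>, \<tau>, k, n, N). clique_time \<Delta> \<tau> k n + real N)"
    by (rule bigoI[where c = "real ?K"]) (auto simp: eventually_principal clique_time_def)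
  ultimately show ?thesis by blast
qed

section \<open>Candidate edges from interval lists\<close>

lemma interval_close_iff:
  fixes q q' r r' d :: nat
  assumes "r < d" and "r' < d"
  shows "\<bar>(real q + real r / real d) - (real q' + real r' / real d)\<bar> \<le> 1 \<longleftrightarrow>
    (if q' < q then (q - q' - 1) + (r - r') else if q < q' then (q' - q - 1) + (r' - r) else 0) = 0"
proof -
  define f f' where "f = real r / real d" and "f' = real r' / real d"
  have f: "0 \<le> f" "f < 1" "0 \<le> f'" "f' < 1" and rf: "r \<le> r' \<longleftrightarrow> f \<le> f'" "r' \<le> r \<longleftrightarrow> f' \<le> f"
    using assms unfolding f_def f'_def by (auto simp: field_simps)
  consider "q = q'" | "q = q' + 1" | "q' + 2 \<le> q" | "q' = q + 1" | "q + 2 \<le> q'" by linarith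
  then show ?thesis
  proof cases
    case 1
    then show ?thesis using f unfolding f_def[symmetric] f'_def[symmetric] by simp
  next
    case 2
    then show ?thesis using f rf unfolding f_def[symmetric] f'_def[symmetric] by auto
  next
    case 3
    then have "real q' + 2 \<le> real q" by simp
    then show ?thesis using 3 f unfolding f_def[symmetric] f'_def[symmetric] by auto
  next
    case 4
    then show ?thesis using f rf unfolding f_def[symmetric] f'_def[symmetric] by auto
  next
    case 5
    then have "real q + 2 \<le> real q'" by simp
    then show ?thesis using 5 f unfolding f_def[symmetric] f'_def[symmetric] by auto
  qed
qed

locale interval_input =
  fixes G :: "nat temporal_graph" and \<Delta> k :: nat and xs :: "nat list" and vs d q r
  assumes G: "temporal_unit_interval_graph G" and \<Delta>: "1 \<le> \<Delta>" "\<Delta> \<le> lifetime G"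
    and vs: "distinct vs" "set vs = verts G"
    and qr: "\<And>t. t \<in> {1..lifetime G} \<Longrightarrow> (\<forall>v\<in>verts G. r t v < d) \<and>
        layer G t = interval_edges (verts G) (\<lambda>v. real (q t v) + real (r t v) / real d) 1"
    and xs: "xs = [length vs, lifetime G, \<Delta>, k, d] @
       concat (map (\<lambda>t. concat (map (\<lambda>v. [q t v, r t v]) vs)) [1..<lifetime G + 1])"
begin

abbreviation n where "n \<equiv> length vs"
abbreviation \<tau> where "\<tau> \<equiv> lifetime G"
abbreviation x where "x \<equiv> input xs"
abbreviation w where "w \<equiv> \<tau> - \<Delta> + 1"
abbreviation P where "P a b s \<equiv> {vs ! a, vs ! b} \<in> layer G s"
abbreviation Q where "Q t v \<equiv> q (Suc t) (vs ! v)"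
abbreviation F where "F t v \<equiv> r (Suc t) (vs ! v)"

definition pos where "pos t v = 5 + 2 * n * t + 2 * v"

lemma tg: "temporal_graph G" using G unfolding temporal_unit_interval_graph_def by simp

lemma xs_alt: "xs = [n, \<tau>, \<Delta>, k, d] @
    concat (map (\<lambda>t. concat (map (\<lambda>(i, j). [i, j]) (map (\<lambda>v. (q (Suc t) v, r (Suc t) v)) vs))) [0..<\<tau>])"
proof -
  have "[1..<\<tau> + 1] = map Suc [0..<\<tau>]" by (simp add: map_Suc_upt)
  then show ?thesis unfolding xs by (simp add: comp_def del: upt_Suc)
qed

lemma x_params: "x 0 = n" "x 1 = \<tau>" "x 2 = \<Delta>" "x 3 = k"
  unfolding input_def by (simp_all add: xs_alt)

lemma length_xs: "length xs = 5 + 2 * n * \<tau>"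
  unfolding xs_alt by (simp add: length_concat_upt length_concat_pairs del: map_map)

lemma x_pos:
  assumes "t < \<tau>" and "v < n"
  shows "x (pos t v) = Q t v" and "x (pos t v + 1) = F t v"
proof -
  let ?g = "\<lambda>t. concat (map (\<lambda>(i, j). [i, j]) (map (\<lambda>v. (q (Suc t) v, r (Suc t) v)) vs))"
  have len: "length (?g t) = 2 * n" for t by (simp add: length_concat_pairs del: map_map)
  have "xs ! (5 + ((\<Sum>s<t. length (?g s)) + i)) = ?g t ! i" if "i < 2 * n" for i
    unfolding xs_alt using nth_concat_upt[of t \<tau> i ?g] assms(1) that len
    by (subst nth_append) simp
  then have nth: "xs ! (5 + 2 * n * t + i) = ?g t ! i" if "i < 2 * n" for i
    using that unfolding len by (simp add: algebra_simps)
  have "n * t + n \<le> n * \<tau>" using assms(1) mult_le_mono2[of "Suc t" \<tau> n] by simp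
  then have "pos t v + 1 < length xs" unfolding length_xs pos_def using assms(2) by simp
  then show "x (pos t v) = Q t v" "x (pos t v + 1) = F t v"
    using nth[of "2 * v"] nth[of "2 * v + 1"] assms(2)
      nth_concat_pairs[of v "map (\<lambda>v. (q (Suc t) v, r (Suc t) v)) vs"]
    unfolding input_def pos_def by (simp_all add: add.assoc del: map_map)
qed

lemma P_iff:
  assumes "t < \<tau>" and "u < n" "v < n" "u \<noteq> v"
  shows "P u v (Suc t) \<longleftrightarrow>
    (if Q t v < Q t u then (Q t u - Q t v - 1) + (F t u - F t v)
     else if Q t u < Q t v then (Q t v - Q t u - 1) + (F t v - F t u) else 0) = 0"
proof -
  have t: "Suc t \<in> {1..\<tau>}" using assms(1) by simp
  have m: "vs ! u \<in> verts G" "vs ! v \<in> verts G" "vs ! u \<noteq> vs ! v"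
    using assms vs nth_mem nth_eq_iff_index_eq by blast+
  then have b: "F t u < d" "F t v < d" using qr[OF t] by blast+
  have "P u v (Suc t) \<longleftrightarrow> \<bar>(real (Q t u) + real (F t u) / real d) - (real (Q t v) + real (F t v) / real d)\<bar> \<le> 1"
    using qr[OF t] m doubleton_interval_edges[of 1 "vs ! u" "vs ! v" "verts G"
      "\<lambda>v. real (q (Suc t) v) + real (r (Suc t) v) / real d"] by simp
  then show ?thesis unfolding interval_close_iff[OF b] .
qed

lemma P_Q: "t < \<tau> \<Longrightarrow> u < n \<Longrightarrow> v < n \<Longrightarrow> u \<noteq> v \<Longrightarrow> P u v (Suc t) \<Longrightarrow> Q t u \<le> Q t v + 1"
  using P_iff[of t u v] by (auto split: if_splits)

lemma Q_P: "t < \<tau> \<Longrightarrow> u < n \<Longrightarrow> v < n \<Longrightarrow> u \<noteq> v \<Longrightarrow> Q t u = Q t v \<Longrightarrow> P u v (Suc t)"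
  using P_iff[of t u v] by simp

text \<open>
  Intervals of length 1 that intersect have left end points whose integer parts differ by at most 1.
  For each window, a vertex may choose a layer of the window and round up the integer part of its
  end point in this layer by \<open>0\<close> or \<open>1\<close>; \<open>J\<close> is a common bound on the results. Adjacent vertices
  have a common sequence of choices.
\<close>

definition opt :: "nat \<Rightarrow> nat \<Rightarrow> nat \<Rightarrow> nat \<Rightarrow> nat" where
  "opt J v i c = (i + c div 2) * J + Q (i + c div 2) v + c mod 2"

primrec pth :: "nat \<Rightarrow> nat \<Rightarrow> nat \<Rightarrow> nat \<Rightarrow> nat list" where
  "pth J v 0 z = []"
| "pth J v (Suc i) z = pth J v i (z div (2 * \<Delta>)) @ [opt J v i (z mod (2 * \<Delta>))]"

definition pths :: "nat \<Rightarrow> nat \<Rightarrow> nat list set" where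
  "pths J v = pth J v w ` {..<(2 * \<Delta>) ^ w}"

definition bounded :: "nat \<Rightarrow> bool" where
  "bounded J \<longleftrightarrow> (\<forall>t<\<tau>. \<forall>v<n. Q t v + 2 \<le> J)"

lemma length_pth [simp]: "length (pth J v i z) = i"
  by (induction i arbitrary: z) auto

lemma opt_layer: "i < w \<Longrightarrow> c < 2 * \<Delta> \<Longrightarrow> i + c div 2 < \<tau>"
  using \<Delta> by auto

lemma opt_div_mod:
  assumes "bounded J" and "i < w" and "c < 2 * \<Delta>" and "v < n"
  shows "opt J v i c div J = i + c div 2" and "opt J v i c mod J = Q (i + c div 2) v + c mod 2"
proof -
  have "Q (i + c div 2) v + c mod 2 < J"
    using assms opt_layer[OF assms(2,3)] unfolding bounded_def by fastforce
  then show "opt J v i c div J = i + c div 2" "opt J v i c mod J = Q (i + c div 2) v + c mod 2"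
    unfolding opt_def by (auto simp: add.assoc)
qed

lemma opt_less:
  assumes "bounded J" and "i < w" and "c < 2 * \<Delta>" and "v < n"
  shows "opt J v i c < \<tau> * J"
proof -
  have t: "i + c div 2 < \<tau>" by (rule opt_layer[OF assms(2,3)])
  then have "Q (i + c div 2) v + c mod 2 < J" using assms(1,4) unfolding bounded_def by fastforce
  then have "opt J v i c < (i + c div 2) * J + J" unfolding opt_def by simp
  also have "\<dots> = Suc (i + c div 2) * J" by simp
  also have "\<dots> \<le> \<tau> * J" using t by (intro mult_le_mono1) simp
  finally show ?thesis .
qed

lemma opt_inj:
  assumes "bounded J" and "i < w" and "v < n" and "c < 2 * \<Delta>" "c' < 2 * \<Delta>" and "opt J v i c = opt J v i c'"
  shows "c = c'"
proof -
  have "c div 2 = c' div 2" 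
    using opt_div_mod(1)[OF assms(1,2,4,3)] opt_div_mod(1)[OF assms(1,2,5,3)] assms(6) by simp
  moreover have "c mod 2 = c' mod 2"
    using opt_div_mod(2)[OF assms(1,2,4,3)] opt_div_mod(2)[OF assms(1,2,5,3)] assms(6) calculation
    by simp
  ultimately show ?thesis by (metis div_mult_mod_eq)
qed

lemma pth_inj:
  assumes "bounded J" and "v < n"
  shows "i \<le> w \<Longrightarrow> z < (2 * \<Delta>) ^ i \<Longrightarrow> z' < (2 * \<Delta>) ^ i \<Longrightarrow> pth J v i z = pth J v i z' \<Longrightarrow> z = z'"
proof (induction i arbitrary: z z')
  case (Suc i)
  have m: "z mod (2 * \<Delta>) < 2 * \<Delta>" "z' mod (2 * \<Delta>) < 2 * \<Delta>" using \<Delta> by simp_all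
  have "z div (2 * \<Delta>) < (2 * \<Delta>) ^ i" "z' div (2 * \<Delta>) < (2 * \<Delta>) ^ i"
    using Suc.prems(2,3) by (simp_all add: less_mult_imp_div_less mult.commute)
  then have "z div (2 * \<Delta>) = z' div (2 * \<Delta>)" using Suc by simp
  moreover have "z mod (2 * \<Delta>) = z' mod (2 * \<Delta>)"
    using opt_inj[OF assms(1) _ assms(2) m, of i] Suc.prems by simp
  ultimately show ?case by (metis div_mult_mod_eq)
qed simp

lemma nth_pth:
  "i < l \<Longrightarrow> z < (2 * \<Delta>) ^ l \<Longrightarrow> \<exists>c<2 * \<Delta>. pth J v l z ! i = opt J v i c"
proof (induction l arbitrary: z)
  case (Suc l)
  have "z div (2 * \<Delta>) < (2 * \<Delta>) ^ l"
    using Suc.prems(2) by (simp add: less_mult_imp_div_less mult.commute)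
  moreover have "z mod (2 * \<Delta>) < 2 * \<Delta>" using \<Delta> by simp
  ultimately show ?case using Suc by (cases "i = l") (auto simp: nth_append)
qed simp

lemma ex_pth:
  "(\<And>i. i < l \<Longrightarrow> \<exists>c<2 * \<Delta>. f i = opt J v i c) \<Longrightarrow> \<exists>z<(2 * \<Delta>) ^ l. pth J v l z = map f [0..<l]"
proof (induction l)
  case (Suc l)
  then obtain z c where z: "z < (2 * \<Delta>) ^ l" "pth J v l z = map f [0..<l]"
    and c: "c < 2 * \<Delta>" "f l = opt J v l c" by (metis less_SucI lessI)
  have "z * (2 * \<Delta>) + c < Suc z * (2 * \<Delta>)" using c by simp
  also have "\<dots> \<le> (2 * \<Delta>) ^ l * (2 * \<Delta>)" using z(1) by (intro mult_le_mono1) simp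
  finally have "z * (2 * \<Delta>) + c < (2 * \<Delta>) ^ Suc l" by (simp add: mult.commute)
  moreover have "pth J v (Suc l) (z * (2 * \<Delta>) + c) = map f [0..<Suc l]"
    using z c by simp
  ultimately show ?case by blast
qed simp

lemma assoc_common_path:
  assumes a: "assoc G \<Delta> vs u v" and uv: "u < n" "v < n"
  shows "pths J u \<inter> pths J v \<noteq> {}"
proof -
  have ne: "u \<noteq> v" using assoc_irrefl[OF tg \<Delta>(1)] a by blast
  have "\<exists>s. (\<exists>c<2 * \<Delta>. s = opt J u i c) \<and> (\<exists>c<2 * \<Delta>. s = opt J v i c)" if i: "i < w" for i
  proof -
    have "\<exists>j\<in>{Suc i..Suc i + \<Delta> - 1}. P u v j"
      using a[unfolded assoc_def association_edges_iff, THEN bspec, of "Suc i"] i by auto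
    then obtain j where j: "Suc i \<le> j" "j \<le> i + \<Delta>" "P u v j" by auto
    define t where "t = j - 1"
    have t: "i \<le> t" "t - i < \<Delta>" "t < \<tau>" "P u v (Suc t)" "P v u (Suc t)"
      using j i \<Delta> unfolding t_def by (auto simp: insert_commute)
    define X where "X = max (Q t u) (Q t v)"
    have X: "X - Q t u \<le> 1" "X - Q t v \<le> 1" "Q t u \<le> X" "Q t v \<le> X"
      using P_Q[OF t(3) uv ne t(4)] P_Q[OF t(3) uv(2,1) ne[symmetric] t(5)] unfolding X_def by auto
    have "t * J + X = opt J y i (2 * (t - i) + (X - Q t y))" if "X - Q t y \<le> 1" "Q t y \<le> X" for y
    proof -
      have "(2 * (t - i) + (X - Q t y)) div 2 = t - i" "(2 * (t - i) + (X - Q t y)) mod 2 = X - Q t y"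
        using that(1) by (cases "X - Q t y = 0"; simp add: le_Suc_eq)+
      then show ?thesis unfolding opt_def using t(1) that(2) by simp
    qed
    moreover have "2 * (t - i) + (X - Q t y) < 2 * \<Delta>" if "X - Q t y \<le> 1" for y using t(2) that by linarith
    ultimately show ?thesis using X by blast
  qed
  then obtain f where f: "\<And>i. i < w \<Longrightarrow> (\<exists>c<2 * \<Delta>. f i = opt J u i c) \<and> (\<exists>c<2 * \<Delta>. f i = opt J v i c)"
    by metis
  then obtain z z' where "z < (2 * \<Delta>) ^ w" "pth J u w z = map f [0..<w]"
    "z' < (2 * \<Delta>) ^ w" "pth J v w z' = map f [0..<w]"
    using ex_pth[of w f J u] ex_pth[of w f J v] by blast
  then show ?thesis unfolding pths_def by (metis IntI emptyE imageI lessThan_iff)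
qed

text \<open>
  Vertices that share a sequence of choices fall into \<open>2 ^ w\<close> classes according to their roundings,
  and two members of the same class have equal integer parts in a layer of every window.
\<close>

lemma large_bucket_clique:
  assumes J: "bounded J" and S: "S \<subseteq> {..<n}" "\<And>u. u \<in> S \<Longrightarrow> p \<in> pths J u"
    and card: "k * (2 * \<Delta>) ^ w \<le> card S" and k: "1 \<le> k"
  shows "temporal_clique \<Delta> G k"
proof -
  have fin: "finite S" using S(1) finite_subset by blast
  have lay: "\<exists>c<2 * \<Delta>. p ! i div J = i + c div 2 \<and> p ! i mod J = Q (p ! i div J) u + c mod 2"
    if u: "u \<in> S" and i: "i < w" for u i
  proof -
    obtain z where "z < (2 * \<Delta>) ^ w" "p = pth J u w z" using S(2)[OF u] unfolding pths_def by auto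
    then obtain c where "c < 2 * \<Delta>" "p ! i = opt J u i c" using nth_pth[OF i] by blast
    moreover have "u < n" using S(1) u by blast
    ultimately show ?thesis using opt_div_mod[OF J i, of c u] by (intro exI[of _ c]) simp
  qed
  define g where "g u = map (\<lambda>i. Q (p ! i div J) u = p ! i mod J) [0..<w]" for u
  define C where "C = {l :: bool list. set l \<subseteq> UNIV \<and> length l = w}"
  have "card C = 2 ^ w" "finite C"
    unfolding C_def using card_lists_length_eq[of "UNIV :: bool set" w]
      finite_lists_length_eq[of "UNIV :: bool set" w] by simp_all
  moreover have "(k - 1) * 2 ^ w < card S"
  proof -
    have "(k - 1) * 2 ^ w < k * 2 ^ w" using k by simp
    also have "\<dots> \<le> k * (2 * \<Delta>) ^ w" using \<Delta> by (intro mult_le_mono2 power_mono) auto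
    finally show ?thesis using card by (rule less_le_trans)
  qed
  moreover have "g ` S \<subseteq> C" unfolding g_def C_def by auto
  ultimately obtain c where c: "k - 1 < card {u \<in> S. g u = c}"
    using large_fiber[OF fin, of C g "k - 1"] by auto
  let ?X = "{u \<in> S. g u = c}"
  have "assoc G \<Delta> vs u v" if uv: "u \<in> ?X" "v \<in> ?X" "u \<noteq> v" for u v
    unfolding assoc_def association_edges_iff
  proof
    fix i' assume "i' \<in> {1..\<tau> - \<Delta> + 1}"
    then obtain i where i: "i' = Suc i" "i < w" by (cases i') auto
    let ?t = "p ! i div J"
    obtain a where a: "a < 2 * \<Delta>" "?t = i + a div 2" "p ! i mod J = Q ?t u + a mod 2"
      using lay[of u i] uv i by blast
    obtain b where b: "p ! i mod J = Q ?t v + b mod 2" using lay[of v i] uv i by blast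
    have t: "?t < \<tau>" unfolding a(2) by (rule opt_layer[OF i(2) a(1)])
    have "g u = g v" using uv by simp
    then have eq: "(Q ?t u = p ! i mod J) = (Q ?t v = p ! i mod J)"
      using arg_cong[of "g u" "g v" "\<lambda>l. l ! i"] i(2) unfolding g_def by (simp del: upt_Suc)
    have cancel: "U = V" if "X = U + e" "X = V + f" "e < 2" "f < 2" "(U = X) = (V = X)"
      for U V X e f :: nat using that by presburger
    have "Q ?t u = Q ?t v" by (rule cancel[OF a(3) b _ _ eq]) simp_all
    then have "P u v (Suc ?t)" using Q_P[OF t] uv S(1) by blast
    moreover have "Suc ?t \<in> {i'..i' + \<Delta> - 1}" unfolding i(1) a(2) using a(1) by auto
    ultimately show "\<exists>j\<in>{i'..i' + \<Delta> - 1}. P u v j" by blast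
  qed
  then have "vclique (assoc G \<Delta> vs) ?X" unfolding vclique_def by blast
  moreover have "k \<le> card ?X" using c k by simp
  moreover have "?X \<subseteq> {..<n}" using S(1) by blast
  ultimately show ?thesis unfolding temporal_clique_iff[OF vs] by blast
qed

end

section \<open>A trie over the sequences of choices\<close>

abbreviation (input) r_J :: nat where "r_J \<equiv> 8"
abbreviation (input) r_S :: nat where "r_S \<equiv> 9"
abbreviation (input) r_cap :: nat where "r_cap \<equiv> 26"
abbreviation (input) r_free :: nat where "r_free \<equiv> 27"
abbreviation (input) r_lo :: nat where "r_lo \<equiv> 28"
abbreviation (input) r_cnt :: nat where "r_cnt \<equiv> 29"
abbreviation (input) r_hi :: nat where "r_hi \<equiv> 30"
abbreviation (input) r_node :: nat where "r_node \<equiv> 31"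
abbreviation (input) r_off :: nat where "r_off \<equiv> 32"
abbreviation (input) r_ptr :: nat where "r_ptr \<equiv> 33"
abbreviation (input) r_oi :: nat where "r_oi \<equiv> 34"
abbreviation (input) r_td :: nat where "r_td \<equiv> 35"
abbreviation (input) r_slot :: nat where "r_slot \<equiv> 36"
abbreviation (input) r_offi :: nat where "r_offi \<equiv> 37"
abbreviation (input) r_ptri :: nat where "r_ptri \<equiv> 38"
abbreviation (input) r_nn :: nat where "r_nn \<equiv> 39"
abbreviation (input) r_b :: nat where "r_b \<equiv> 40"
abbreviation (input) r_bc :: nat where "r_bc \<equiv> 41"
abbreviation (input) r_leaf :: nat where "r_leaf \<equiv> 42"
abbreviation (input) r_last :: nat where "r_last \<equiv> 43"
abbreviation (input) r_bad :: nat where "r_bad \<equiv> 44"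
abbreviation (input) r_pu :: nat where "r_pu \<equiv> 45"
abbreviation (input) r_pv :: nat where "r_pv \<equiv> 46"
abbreviation (input) r_far :: nat where "r_far \<equiv> 47"

abbreviation (input) a_front :: nat where "a_front \<equiv> 8"
abbreviation (input) a_trie :: nat where "a_trie \<equiv> 9"
abbreviation (input) a_cnt :: nat where "a_cnt \<equiv> 10"
abbreviation (input) a_bucket :: nat where "a_bucket \<equiv> 11"
abbreviation (input) a_opt :: nat where "a_opt \<equiv> 12"

text \<open>
  \<open>N p\<close> is the node of the path \<open>p\<close>, and \<open>0\<close> if there is none. Nodes are multiples of the stride
  \<open>S\<close>, and the child of \<open>N p\<close> in direction \<open>s < S\<close> is stored at index \<open>N p + s\<close>.
\<close>

definition trie :: "nat \<Rightarrow> nat \<Rightarrow> arrays \<Rightarrow> (nat list \<Rightarrow> nat) \<Rightarrow> bool" where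
  "trie S free A N \<longleftrightarrow> 0 < S \<and> N [] = S \<and> S dvd free \<and>
     (\<forall>p. N p < free \<and> S dvd N p) \<and>
     (\<forall>p p'. N p = N p' \<longrightarrow> N p \<noteq> 0 \<longrightarrow> p = p') \<and>
     (\<forall>p s. N p \<noteq> 0 \<longrightarrow> s < S \<longrightarrow> A a_trie (N p + s) = N (p @ [s])) \<and>
     (\<forall>p s. N (p @ [s]) \<noteq> 0 \<longrightarrow> N p \<noteq> 0) \<and>
     (\<forall>a\<ge>free. A a_trie a = 0)"

definition buckets :: "nat \<Rightarrow> nat \<Rightarrow> arrays \<Rightarrow> (nat list \<Rightarrow> nat) \<Rightarrow> (nat list \<Rightarrow> nat list) \<Rightarrow> bool" where
  "buckets cap free A N bl \<longleftrightarrow>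
     (\<forall>p. N p \<noteq> 0 \<longrightarrow> A a_cnt (N p) = length (bl p) \<and> (\<forall>i<length (bl p). A a_bucket (N p + i) = bl p ! i)) \<and>
     (\<forall>p. N p = 0 \<longrightarrow> bl p = []) \<and> (\<forall>p. length (bl p) \<le> cap) \<and> (\<forall>a\<ge>free. A a_cnt a = 0)"

definition extends :: "(nat list \<Rightarrow> nat) \<Rightarrow> (nat list \<Rightarrow> nat) \<Rightarrow> bool" where
  "extends N N' \<longleftrightarrow> (\<forall>p. N p \<noteq> 0 \<longrightarrow> N' p = N p)"

lemma extends_refl [simp]: "extends N N"
  unfolding extends_def by simp

lemma extends_trans: "extends N N' \<Longrightarrow> extends N' N'' \<Longrightarrow> extends N N''"
  unfolding extends_def by simp

lemma stride_add_eq: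
  fixes S :: nat
  assumes "S dvd a" "S dvd b" and "i < S" "j < S"
  shows "a + i = b + j \<longleftrightarrow> a = b \<and> i = j"
  using assms row_index_eq[of i S j "a div S" "b div S"] by auto

lemma trie_cong: "trie S free A N \<Longrightarrow> A' a_trie = A a_trie \<Longrightarrow> trie S free A' N"
  unfolding trie_def by simp

lemma buckets_cong:
  "buckets cap free A N bl \<Longrightarrow> A' a_cnt = A a_cnt \<Longrightarrow> A' a_bucket = A a_bucket \<Longrightarrow> buckets cap free A' N bl"
  unfolding buckets_def by simp

lemma trie_new:
  assumes T: "trie S free A N" and p: "N p \<noteq> 0" and s: "s < S" and new: "N (p @ [s]) = 0"
    and A': "A' a_trie = (A a_trie)(N p + s := free)"
  shows "trie S (free + S) A' (N(p @ [s] := free))"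
proof -
  have t: "0 < S" "N [] = S" "S dvd free" "\<And>p. N p < free" "\<And>p. S dvd N p"
    "\<And>p p'. N p = N p' \<Longrightarrow> N p \<noteq> 0 \<Longrightarrow> p = p'"
    "\<And>p s. N p \<noteq> 0 \<Longrightarrow> s < S \<Longrightarrow> A a_trie (N p + s) = N (p @ [s])"
    "\<And>p s. N (p @ [s]) \<noteq> 0 \<Longrightarrow> N p \<noteq> 0" "\<And>a. free \<le> a \<Longrightarrow> A a_trie a = 0"
    using T unfolding trie_def by blast+
  let ?N = "N(p @ [s] := free)"
  have free: "0 < free" using t(4)[of p] by simp
  have entry: "A' a_trie (?N p' + s') = ?N (p' @ [s'])" if N': "?N p' \<noteq> 0" and s': "s' < S" for p' s'
  proof (cases "p' = p @ [s]")
    case True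
    have "free + s' = N p + s \<longleftrightarrow> free = N p \<and> s' = s" by (rule stride_add_eq[OF t(3) t(5) s' s])
    then have "A' a_trie (free + s') = 0" using A' t(4)[of p] t(9)[of "free + s'"] by simp
    moreover have "N ((p @ [s]) @ [s']) = 0" using t(8)[of "p @ [s]" s'] new by blast
    ultimately show ?thesis using True by simp
  next
    case False
    then have np: "N p' \<noteq> 0" using N' by simp
    have "N p' + s' = N p + s \<longleftrightarrow> N p' = N p \<and> s' = s" by (rule stride_add_eq[OF t(5) t(5) s' s])
    also have "\<dots> \<longleftrightarrow> p' = p \<and> s' = s" using t(6) np by blast
    finally show ?thesis using A' False t(7)[OF np s'] by auto
  qed
  have bound: "?N q < free + S" "S dvd ?N q" for q using t(1,3) t(4)[of q] t(5)[of q] by auto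
  have inj: "q = q'" if "?N q = ?N q'" "?N q \<noteq> 0" for q q'
    using that t(4)[of q] t(4)[of q'] t(6)[of q q'] by (auto split: if_splits)
  have prefix: "?N q \<noteq> 0" if "?N (q @ [s']) \<noteq> 0" for q s'
    using that p free t(8)[of q s'] by (auto split: if_splits)
  have zero: "A' a_trie a = 0" if "free + S \<le> a" for a
  proof -
    have "N p + s < free + S" using t(4)[of p] s by simp
    then show ?thesis using A' that t(9)[of a] by simp
  qed
  show ?thesis unfolding trie_def
  proof (intro conjI allI impI)
    show "?N [] = S" using t(2) by simp
    show "S dvd free + S" using t(3) by simp
  qed (fact t(1) bound inj entry prefix zero)+
qed

lemma buckets_new:
  assumes "buckets cap free A N bl" and "N p = 0" and "A' a_cnt = A a_cnt" "A' a_bucket = A a_bucket"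
  shows "buckets cap (free + S) A' (N(p := free)) bl"
  using assms unfolding buckets_def by auto

lemma buckets_insert:
  assumes T: "trie S free A N" and B: "buckets cap free A N bl" and p: "N p \<noteq> 0"
    and len: "length (bl p) < cap" and cap: "cap \<le> S"
    and A': "A' a_bucket = (A a_bucket)(N p + length (bl p) := v)" "A' a_cnt = (A a_cnt)(N p := length (bl p) + 1)"
  shows "buckets cap free A' N (bl(p := bl p @ [v]))"
proof -
  have t: "\<And>p. N p < free" "\<And>p. S dvd N p" "\<And>p p'. N p = N p' \<Longrightarrow> N p \<noteq> 0 \<Longrightarrow> p = p'"
    using T unfolding trie_def by blast+
  let ?bl = "bl(p := bl p @ [v])"
  have "A' a_cnt (N q) = length (?bl q) \<and> (\<forall>i<length (?bl q). A' a_bucket (N q + i) = ?bl q ! i)"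
    if q: "N q \<noteq> 0" for q
  proof (cases "q = p")
    case True
    then show ?thesis using B q A' unfolding buckets_def by (auto simp: nth_append less_Suc_eq)
  next
    case False
    then have ne: "N q \<noteq> N p" using t(3) q by blast
    have "N q + i \<noteq> N p + length (bl p)" if "i < length (bl q)" for i
    proof -
      have "i < S" "length (bl p) < S" using that len cap B unfolding buckets_def
        by (meson less_le_trans order_trans)+
      then show ?thesis
        using stride_add_eq[of S "N q" "N p" i "length (bl p)"] t(2) ne by simp
    qed
    then show ?thesis using B q A' False ne unfolding buckets_def by auto
  qed
  moreover have "A' a_cnt a = 0" if "free \<le> a" for a
    using that t(1)[of p] B A' unfolding buckets_def by auto
  ultimately show ?thesis using B p len unfolding buckets_def by auto
qed

definition visit_child :: cmd where
  "visit_child =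
     (r_slot ::= Reg r_node .+ Ar a_opt (Reg r_h) ;;
      Cond (Ar a_trie (Reg r_slot)) (r_a ::= Lit 0)
        (Put a_trie (Reg r_slot) (Reg r_free) ;; r_free ::= Reg r_free .+ Reg r_S) ;;
      Put a_front (Reg r_hi) (Ar a_trie (Reg r_slot)) ;;
      r_hi ::= Reg r_hi .+ Lit 1)"

lemma visit_child_frame [simp]:
  "mods visit_child = {r_slot, r_a, r_free, r_hi}" "amods visit_child = {a_trie, a_front}"
  by (simp_all add: visit_child_def insert_commute)

lemma runs_visit_child:
  assumes T: "trie (R r_S) (R r_free) A N" and B: "buckets cap (R r_free) A N bl"
    and p: "R r_node = N p" "N p \<noteq> 0" and s: "A a_opt (R r_h) = s" "s < R r_S"
  shows "runs x visit_child R A 6 (\<lambda>R' A'. \<exists>N'. trie (R r_S) (R' r_free) A' N' \<and>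
    buckets cap (R' r_free) A' N' bl \<and> extends N N' \<and> N' (p @ [s]) \<noteq> 0 \<and>
    A' a_front = (A a_front)(R r_hi := N' (p @ [s])) \<and> R' r_hi = Suc (R r_hi))"
proof -
  let ?R = "R(r_slot := N p + s)"
  let ?rest = "Put a_front (Reg r_hi) (Ar a_trie (Reg r_slot)) ;; r_hi ::= Reg r_hi .+ Lit 1"
  have e: "A a_trie (N p + s) = N (p @ [s])" using T p(2) s(2) unfolding trie_def by blast
  have "runs x (Cond (Ar a_trie (Reg r_slot)) (r_a ::= Lit 0)
        (Put a_trie (Reg r_slot) (Reg r_free) ;; r_free ::= Reg r_free .+ Reg r_S)) ?R A 3
     (\<lambda>R' A'. \<exists>N'. trie (R r_S) (R' r_free) A' N' \<and> buckets cap (R' r_free) A' N' bl \<and> extends N N' \<and>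
        N' (p @ [s]) \<noteq> 0 \<and> A' a_trie (N p + s) = N' (p @ [s]))"
  proof (rule runs_Cond[where t = 2], goal_cases)
    case 1
    then have "N (p @ [s]) \<noteq> 0" using e by simp
    then show ?case using T B e unfolding runs_Asg by (intro conjI exI[of _ N]) simp_all
  next
    case 2
    then have new: "N (p @ [s]) = 0" using e by simp
    let ?N = "N(p @ [s] := R r_free)" and ?A = "A(a_trie := (A a_trie)(N p + s := R r_free))"
    have "trie (R r_S) (R r_free + R r_S) ?A ?N" by (rule trie_new[OF T p(2) s(2) new]) simp
    moreover have "buckets cap (R r_free + R r_S) ?A ?N bl" by (rule buckets_new[OF B new]) simp_all
    moreover have "extends N ?N" using new unfolding extends_def by simp
    moreover have "R r_free \<noteq> 0" using T unfolding trie_def by (metis not_less0)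
    ultimately show ?case unfolding runs_Put_Sq runs_Asg by (simp, intro exI[of _ ?N]) simp
  qed simp
  then have "runs x (Cond (Ar a_trie (Reg r_slot)) (r_a ::= Lit 0)
        (Put a_trie (Reg r_slot) (Reg r_free) ;; r_free ::= Reg r_free .+ Reg r_S) ;; ?rest) ?R A 5
    (\<lambda>R' A'. \<exists>N'. trie (R r_S) (R' r_free) A' N' \<and>
    buckets cap (R' r_free) A' N' bl \<and> extends N N' \<and> N' (p @ [s]) \<noteq> 0 \<and>
    A' a_front = (A a_front)(R r_hi := N' (p @ [s])) \<and> R' r_hi = Suc (R r_hi))"
  proof (rule runs_Sq[where t' = 2], goal_cases)
    case (1 R1 A1)
    then obtain N' where N': "trie (R r_S) (R1 r_free) A1 N'" "buckets cap (R1 r_free) A1 N' bl" "extends N N'"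
        "N' (p @ [s]) \<noteq> 0" "A1 a_trie (N p + s) = N' (p @ [s])" by blast
    have fr: "A1 a_front = A a_front" "R1 r_hi = R r_hi" "R1 r_slot = N p + s" using 1(2,3) by simp_all
    let ?A = "A1(a_front := (A1 a_front)(R r_hi := N' (p @ [s])))"
    have "trie (R r_S) (R1 r_free) ?A N'" by (rule trie_cong[OF N'(1)]) simp
    moreover have "buckets cap (R1 r_free) ?A N' bl" by (rule buckets_cong[OF N'(2)]) simp_all
    ultimately show ?case unfolding runs_Put_Sq runs_Asg using N'(3-5) fr
      by (simp, intro exI[of _ N']) simp
  qed simp
  then show ?thesis unfolding visit_child_def runs_Asg_Sq using p s by simp
qed

definition load_choices :: cmd where
  "load_choices =
     (r_off ::= Reg r_offi ;;
      r_ptr ::= Reg r_ptri ;;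
      r_oi ::= Lit 0 ;;
      For r_h r_Delta
        (Put a_opt (Reg r_oi) (Reg r_off .+ Inp (Reg r_ptr)) ;;
         Put a_opt (Reg r_oi .+ Lit 1) (Reg r_off .+ Inp (Reg r_ptr) .+ Lit 1) ;;
         r_oi ::= Reg r_oi .+ Lit 2 ;;
         r_off ::= Reg r_off .+ Reg r_J ;;
         r_ptr ::= Reg r_ptr .+ Reg r_nn))"

lemma load_choices_frame [simp]:
  "mods load_choices = {r_off, r_ptr, r_oi, r_h}" "amods load_choices = {a_opt}"
  by (simp_all add: load_choices_def insert_commute)

definition grow :: cmd where
  "grow =
     For r_z r_cnt
       (r_node ::= Ar a_front (Reg r_lo .+ Reg r_z) ;;
        For r_h r_td visit_child)"

lemma grow_frame [simp]:
  "mods grow = {r_z, r_node, r_h, r_slot, r_a, r_free, r_hi}" "amods grow = {a_trie, a_front}"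
  by (simp_all add: grow_def insert_commute)

lemma runs_grow:
  assumes T: "trie (R r_S) (R r_free) A N" and B: "buckets cap (R r_free) A N bl"
    and m: "R r_td = m" "0 < m" and c: "R r_cnt = c" "R r_hi = R r_lo + c"
    and opt: "\<And>h. h < m \<Longrightarrow> A a_opt h = opt h \<and> opt h < R r_S"
    and front: "\<And>z. z < c \<Longrightarrow> A a_front (R r_lo + z) = N (pf z) \<and> N (pf z) \<noteq> 0"
  shows "runs x grow R A (2 + c * (5 + 8 * m)) (\<lambda>R' A'. \<exists>N'. trie (R r_S) (R' r_free) A' N' \<and>
    buckets cap (R' r_free) A' N' bl \<and> extends N N' \<and> R' r_hi = R r_lo + c + c * m \<and>
    (\<forall>y<c * m. A' a_front (R r_lo + c + y) = N' (pf (y div m) @ [opt (y mod m)]) \<and>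
      N' (pf (y div m) @ [opt (y mod m)]) \<noteq> 0))"
proof -
  let ?J = "\<lambda>j R' A'. \<exists>N'. trie (R r_S) (R' r_free) A' N' \<and>
    buckets cap (R' r_free) A' N' bl \<and> extends N N' \<and> R' r_hi = R r_lo + c + j \<and>
    (\<forall>y<c. A' a_front (R r_lo + y) = A a_front (R r_lo + y)) \<and>
    (\<forall>y<j. A' a_front (R r_lo + c + y) = N' (pf (y div m) @ [opt (y mod m)]) \<and>
      N' (pf (y div m) @ [opt (y mod m)]) \<noteq> 0)"
  show ?thesis unfolding grow_def
  proof (rule runs_For[where I = "\<lambda>z. ?J (z * m)" and f = "\<lambda>_. 3 + 8 * m"], goal_cases)
    case 4
    then show ?case using T B c by (intro exI[of _ N]) simp
  next
    case (5 z R1 A1)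
    have z: "z < c" using 5(1) c by simp
    have eqs: "R1 r_S = R r_S" "R1 r_lo = R r_lo" "R1 r_td = m" "A1 a_opt = A a_opt"
      using 5(4,5) m by simp_all
    have node: "A1 a_front (R r_lo + z) = N (pf z)" using 5(2) front[OF z] z by auto
    let ?R = "R1(r_node := N (pf z))"
    have "runs x (For r_h r_td visit_child) ?R A1 (2 + 8 * m) (\<lambda>R' A'. ?J (Suc z * m) R' A')"
    proof (rule runs_For[where I = "\<lambda>h. ?J (z * m + h)" and f = "\<lambda>_. 6"], goal_cases)
      case 4
      then show ?case using 5(2) by simp
    next
      case inner: (5 h R2 A2)
      have h: "h < m" using inner(1) eqs by simp
      have eqs2: "R2 r_S = R r_S" "R2 r_node = N (pf z)" "A2 a_opt = A a_opt"
        using inner(4,5) eqs by simp_all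
      obtain N' where N': "trie (R r_S) (R2 r_free) A2 N'" "buckets cap (R2 r_free) A2 N' bl" "extends N N'"
        "R2 r_hi = R r_lo + c + (z * m + h)" "\<forall>y<c. A2 a_front (R r_lo + y) = A a_front (R r_lo + y)"
        "\<forall>y<z * m + h. A2 a_front (R r_lo + c + y) = N' (pf (y div m) @ [opt (y mod m)]) \<and>
          N' (pf (y div m) @ [opt (y mod m)]) \<noteq> 0"
        using inner(2) by blast
      have n: "N' (pf z) = N (pf z)" "N' (pf z) \<noteq> 0"
        using N'(3) front[OF z] unfolding extends_def by auto
      have dm: "(z * m + h) div m = z" "(z * m + h) mod m = h" using h by simp_all
      have "runs x visit_child R2 A2 6 (\<lambda>R' A'. \<exists>N''. trie (R2 r_S) (R' r_free) A' N'' \<and>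
        buckets cap (R' r_free) A' N'' bl \<and> extends N' N'' \<and> N'' (pf z @ [opt h]) \<noteq> 0 \<and>
        A' a_front = (A2 a_front)(R2 r_hi := N'' (pf z @ [opt h])) \<and> R' r_hi = Suc (R2 r_hi))"
        by (rule runs_visit_child) (use N' eqs2 n opt[OF h] inner(3) in auto)
      then show ?case
      proof (rule runs_conseq, goal_cases)
        case (2 R3 A3)
        then obtain N'' where N'': "trie (R2 r_S) (R3 r_free) A3 N''"
          "buckets cap (R3 r_free) A3 N'' bl" "extends N' N''" "N'' (pf z @ [opt h]) \<noteq> 0"
          "A3 a_front = (A2 a_front)(R2 r_hi := N'' (pf z @ [opt h]))" "R3 r_hi = Suc (R2 r_hi)" by blast
        have "A3 a_front (R r_lo + c + y) = N'' (pf (y div m) @ [opt (y mod m)]) \<and>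
          N'' (pf (y div m) @ [opt (y mod m)]) \<noteq> 0" if "y < z * m + Suc h" for y
        proof (cases "y = z * m + h")
          case True
          then show ?thesis using N''(4,5) N'(4) dm by simp
        next
          case False
          then have "y < z * m + h" using that by simp
          then show ?thesis using N'(4,6) N''(3,5) unfolding extends_def by auto
        qed
        moreover have "\<forall>y<c. A3 a_front (R r_lo + y) = A a_front (R r_lo + y)"
          using N'(4,5) N''(5) by auto
        ultimately show ?case using N''(1,2,6) N'(4) eqs2(1) extends_trans[OF N'(3) N''(3)]
          by (intro exI[of _ N'']) simp
      qed simp
    next
      case (7 R' A')
      then show ?case using eqs by (simp add: add.commute)
    qed (use eqs in auto)
    then have "runs x (For r_h r_td visit_child) ?R A1 (2 + 8 * m)
        (\<lambda>R' A'. ?J (Suc z * m) (R'(r_z := Suc z)) A')"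
      by (rule runs_conseq) auto
    moreover have "ev x (Ar a_front (Reg r_lo .+ Reg r_z)) R1 A1 = N (pf z)" using node eqs 5(3) by simp
    ultimately show ?case unfolding runs_Asg_Sq by simp
  next
    case (7 R' A')
    then show ?case using c by auto
  qed (use c in auto)
qed

definition next_level :: cmd where
  "next_level =
     (load_choices ;;
      r_hi ::= Reg r_lo .+ Reg r_cnt ;;
      grow ;;
      r_lo ::= Reg r_lo .+ Reg r_cnt ;;
      r_cnt ::= Reg r_hi .- Reg r_lo ;;
      r_offi ::= Reg r_offi .+ Reg r_J ;;
      r_ptri ::= Reg r_ptri .+ Reg r_nn)"

lemma next_level_frame [simp]:
  "mods next_level = {r_off, r_ptr, r_oi, r_h, r_z, r_node, r_slot, r_a, r_free, r_hi, r_lo, r_cnt, r_offi, r_ptri}"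
  "amods next_level = {a_opt, a_trie, a_front}"
  by (simp_all add: next_level_def insert_commute)

definition visit_paths :: cmd where
  "visit_paths =
     (Put a_front (Lit 0) (Reg r_S) ;;
      r_lo ::= Lit 0 ;;
      r_cnt ::= Lit 1 ;;
      r_offi ::= Lit 0 ;;
      r_ptri ::= Lit 5 .+ Reg r_v .+ Reg r_v ;;
      For r_i r_w next_level)"

lemma visit_paths_frame [simp]:
  "mods visit_paths = {r_i, r_off, r_ptr, r_oi, r_h, r_z, r_node, r_slot, r_a, r_free, r_hi, r_lo, r_cnt, r_offi, r_ptri}"
  "amods visit_paths = {a_opt, a_trie, a_front}"
  by (simp_all add: visit_paths_def insert_commute)

definition measure_gap :: cmd where
  "measure_gap =
     Cond (Inp (Reg r_pu) .- Inp (Reg r_pv))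
       (r_far ::= (Inp (Reg r_pu) .- Inp (Reg r_pv) .- Lit 1) .+ (Inp (Reg r_pu .+ Lit 1) .- Inp (Reg r_pv .+ Lit 1)))
       (Cond (Inp (Reg r_pv) .- Inp (Reg r_pu))
         (r_far ::= (Inp (Reg r_pv) .- Inp (Reg r_pu) .- Lit 1) .+ (Inp (Reg r_pv .+ Lit 1) .- Inp (Reg r_pu .+ Lit 1)))
         (r_far ::= Lit 0))"

definition test_pair :: cmd where
  "test_pair =
     (r_last ::= Lit 0 ;;
      r_bad ::= Lit 0 ;;
      r_pu ::= Lit 5 .+ Reg r_u .+ Reg r_u ;;
      r_pv ::= Lit 5 .+ Reg r_v .+ Reg r_v ;;
      For r_t r_tau
        (measure_gap ;;
         Cond (Reg r_far) (r_a ::= Lit 0)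
           (r_bad ::= Reg r_bad .+ (Reg r_t .+ Lit 1 .- Reg r_last .- Reg r_Delta) ;;
            r_last ::= Reg r_t .+ Lit 1) ;;
         r_pu ::= Reg r_pu .+ Reg r_nn ;;
         r_pv ::= Reg r_pv .+ Reg r_nn))"

lemma test_pair_frame [simp]:
  "mods measure_gap = {r_far}" "amods measure_gap = {}"
  "mods test_pair = {r_last, r_bad, r_pu, r_pv, r_t, r_far, r_a}" "amods test_pair = {}"
  by (simp_all add: measure_gap_def test_pair_def insert_commute)

definition check_pair :: cmd where
  "check_pair =
     (r_x ::= Ar a_row (Reg r_u) .+ Reg r_v ;;
      Cond (Ar a_adj (Reg r_x)) (r_a ::= Lit 0)
        (test_pair ;;
         Cond (Reg r_bad .+ (Reg r_w .- Reg r_last)) (r_a ::= Lit 0) add_edge))"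

lemma check_pair_frame [simp]:
  "mods check_pair = {r_x, r_last, r_bad, r_pu, r_pv, r_t, r_far, r_a}"
  "amods check_pair = {a_adj, a_nb, a_deg}"
  by (simp_all add: check_pair_def insert_commute)

definition scan_bucket :: cmd where
  "scan_bucket = For r_b r_bc (r_u ::= Ar a_bucket (Reg r_leaf .+ Reg r_b) ;; check_pair)"

lemma scan_bucket_frame [simp]:
  "mods scan_bucket = {r_b, r_u, r_x, r_last, r_bad, r_pu, r_pv, r_t, r_far, r_a}"
  "amods scan_bucket = {a_adj, a_nb, a_deg}"
  by (simp_all add: scan_bucket_def insert_commute)

definition visit_leaf :: cmd where
  "visit_leaf =
     (r_leaf ::= Ar a_front (Reg r_lo .+ Reg r_z) ;;
      r_bc ::= Ar a_cnt (Reg r_leaf) ;;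
      scan_bucket ;;
      Cond (Reg r_cap .- Reg r_bc)
        (Put a_bucket (Reg r_leaf .+ Reg r_bc) (Reg r_v) ;;
         Put a_cnt (Reg r_leaf) (Reg r_bc .+ Lit 1))
        (r_found ::= Lit 1))"

lemma visit_leaf_frame [simp]:
  "mods visit_leaf = {r_leaf, r_bc, r_b, r_u, r_x, r_last, r_bad, r_pu, r_pv, r_t, r_far, r_a, r_found}"
  "amods visit_leaf = {a_adj, a_nb, a_deg, a_bucket, a_cnt}"
  by (simp_all add: visit_leaf_def insert_commute)

context interval_input
begin

abbreviation cap where "cap \<equiv> k * (2 * \<Delta>) ^ w"

definition ctx :: "nat \<Rightarrow> regs \<Rightarrow> bool" where
  "ctx J R \<longleftrightarrow> bounded J \<and> R r_n = n \<and> R r_tau = \<tau> \<and> R r_Delta = \<Delta> \<and> R r_k = k \<and> R r_w = w \<and> R r_J = J \<and>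
     R r_S = cap + \<tau> * J \<and> R r_cap = cap \<and> R r_nn = 2 * n \<and> R r_td = 2 * \<Delta>"

lemma ctx_cong:
  assumes "ctx J R" and "\<And>v. v \<in> {r_n, r_tau, r_Delta, r_k, r_w, r_J, r_S, r_cap, r_nn, r_td} \<Longrightarrow> R' v = R v"
  shows "ctx J R'"
  using assms unfolding ctx_def by simp

lemma runs_load_choices:
  assumes c: "ctx J R" and i: "i < w" and v: "v < n" and R: "R r_offi = i * J" "R r_ptri = pos i v"
  shows "runs x load_choices R A (5 + 7 * \<Delta>) (\<lambda>R' A'. \<forall>c<2 * \<Delta>. A' a_opt c = opt J v i c)"
proof -
  have R': "R r_Delta = \<Delta>" "R r_J = J" "R r_nn = 2 * n" using c unfolding ctx_def by auto
  let ?body = "Put a_opt (Reg r_oi) (Reg r_off .+ Inp (Reg r_ptr)) ;;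
         Put a_opt (Reg r_oi .+ Lit 1) (Reg r_off .+ Inp (Reg r_ptr) .+ Lit 1) ;;
         r_oi ::= Reg r_oi .+ Lit 2 ;;
         r_off ::= Reg r_off .+ Reg r_J ;;
         r_ptr ::= Reg r_ptr .+ Reg r_nn"
  have "runs x (For r_h r_Delta ?body) (R(r_off := i * J, r_ptr := pos i v, r_oi := 0)) A (2 + 7 * \<Delta>)
    (\<lambda>R' A'. \<forall>c<2 * \<Delta>. A' a_opt c = opt J v i c)"
  proof (rule runs_For[where f = "\<lambda>_. 5" and I = "\<lambda>j R' A'. R' r_oi = 2 * j \<and> R' r_off = (i + j) * J \<and>
      R' r_ptr = pos (i + j) v \<and> (\<forall>c<2 * j. A' a_opt c = opt J v i c)"], goal_cases)
    case (5 j R1 A1)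
    have j: "j < \<Delta>" using 5(1) R' by simp
    then have q: "x (pos (i + j) v) = Q (i + j) v" using x_pos(1)[OF _ v] i \<Delta> by simp
    have o: "opt J v i (2 * j) = (i + j) * J + Q (i + j) v" "opt J v i (Suc (2 * j)) = Suc ((i + j) * J + Q (i + j) v)"
      unfolding opt_def by simp_all
    have "R1 r_J = J" "R1 r_nn = 2 * n" using 5(4) R' by simp_all
    then show ?case using 5(2) q o
      by (simp add: runs_Put_Sq runs_Asg_Sq runs_Asg less_Suc_eq algebra_simps pos_def)
  next
    case (7 R' A')
    then show ?case using R' by simp
  qed (use R' in auto)
  then show ?thesis unfolding load_choices_def runs_Asg_Sq using R by simp
qed

lemma runs_next_level:
  assumes c: "ctx J R" and i: "i < w" and v: "v < n" and R: "R r_offi = i * J" "R r_ptri = pos i v"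
    and T: "trie (R r_S) (R r_free) A N" and B: "buckets cap (R r_free) A N bl"
    and cnt: "R r_cnt = (2 * \<Delta>) ^ i"
    and front: "\<And>z. z < (2 * \<Delta>) ^ i \<Longrightarrow> A a_front (R r_lo + z) = N (pth J v i z) \<and> N (pth J v i z) \<noteq> 0"
  shows "runs x next_level R A (32 * (2 * \<Delta>) ^ w) (\<lambda>R' A'. R' r_offi = Suc i * J \<and> R' r_ptri = pos (Suc i) v \<and>
    R' r_cnt = (2 * \<Delta>) ^ Suc i \<and> (\<exists>N'. trie (R r_S) (R' r_free) A' N' \<and> buckets cap (R' r_free) A' N' bl \<and>
      (\<forall>z<(2 * \<Delta>) ^ Suc i. A' a_front (R' r_lo + z) = N' (pth J v (Suc i) z) \<and> N' (pth J v (Suc i) z) \<noteq> 0)))"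
proof -
  let ?m = "2 * \<Delta>" and ?c = "(2 * \<Delta>) ^ i"
  let ?d = "r_lo ::= Reg r_lo .+ Reg r_cnt ;; r_cnt ::= Reg r_hi .- Reg r_lo ;;
      r_offi ::= Reg r_offi .+ Reg r_J ;; r_ptri ::= Reg r_ptri .+ Reg r_nn"
  let ?Q = "\<lambda>R' A'. R' r_offi = Suc i * J \<and> R' r_ptri = pos (Suc i) v \<and>
    R' r_cnt = ?m ^ Suc i \<and> (\<exists>N'. trie (R r_S) (R' r_free) A' N' \<and> buckets cap (R' r_free) A' N' bl \<and>
      (\<forall>z<?m ^ Suc i. A' a_front (R' r_lo + z) = N' (pth J v (Suc i) z) \<and> N' (pth J v (Suc i) z) \<noteq> 0))"
  have cx: "R r_J = J" "R r_nn = 2 * n" "R r_S = cap + \<tau> * J" "R r_td = ?m" "bounded J"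
    using c unfolding ctx_def by auto
  have "runs x next_level R A ((5 + 7 * \<Delta>) + (1 + ((2 + ?c * (5 + 8 * ?m)) + 4))) ?Q"
    unfolding next_level_def
  proof (rule runs_Sq[OF runs_load_choices[OF c i v R], where t' = "1 + ((2 + ?c * (5 + 8 * ?m)) + 4)"],
      goal_cases)
    case (1 R1 A1)
    let ?R1 = "R1(r_hi := R r_lo + ?c)"
    have f1: "R1 r_S = R r_S" "R1 r_free = R r_free" "R1 r_td = ?m" "R1 r_cnt = ?c" "R1 r_lo = R r_lo"
      "R1 r_J = J" "R1 r_nn = 2 * n" "R1 r_offi = i * J" "R1 r_ptri = pos i v"
      using 1(2) cx R cnt by simp_all
    have a1: "A1 a_front = A a_front" using 1(3) by simp
    have grow: "runs x grow ?R1 A1 (2 + ?c * (5 + 8 * ?m)) (\<lambda>R' A'. \<exists>N'. trie (R r_S) (R' r_free) A' N' \<and>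
      buckets cap (R' r_free) A' N' bl \<and> extends N N' \<and> R' r_hi = R r_lo + ?c + ?c * ?m \<and>
      (\<forall>y<?c * ?m. A' a_front (R r_lo + ?c + y) = N' (pth J v i (y div ?m) @ [opt J v i (y mod ?m)]) \<and>
        N' (pth J v i (y div ?m) @ [opt J v i (y mod ?m)]) \<noteq> 0))"
    proof (rule runs_conseq[OF runs_grow[where N = N and bl = bl and cap = cap and m = ?m and c = ?c and
            opt = "opt J v i" and pf = "pth J v i"]], goal_cases)
      case 1
      show ?case using trie_cong[OF T] f1 \<open>\<And>a. a \<notin> amods load_choices \<Longrightarrow> A1 a = A a\<close> by simp
    next
      case 2
      show ?case using buckets_cong[OF B] f1 \<open>\<And>a. a \<notin> amods load_choices \<Longrightarrow> A1 a = A a\<close> by simp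
    next
      case (7 h)
      then show ?case using 1(1) opt_less[OF cx(5) i _ v, of h] f1(1) cx(3) by simp
    next
      case (8 z)
      then show ?case using front[of z] a1 f1 by simp
    next
      case (10 R' A')
      then show ?case using f1 by simp
    qed (use \<Delta> f1 in auto)
    have "runs x (grow ;; ?d) ?R1 A1 ((2 + ?c * (5 + 8 * ?m)) + 4) ?Q"
    proof (rule runs_Sq[OF grow, where t' = 4], goal_cases)
      case (1 R2 A2)
      have f2: "R2 r_lo = R r_lo" "R2 r_cnt = ?c" "R2 r_J = J" "R2 r_nn = 2 * n" "R2 r_offi = i * J" "R2 r_ptri = pos i v"
        using 1(2) f1 by simp_all
      obtain N' where N': "trie (R r_S) (R2 r_free) A2 N'" "buckets cap (R2 r_free) A2 N' bl"
        "R2 r_hi = R r_lo + ?c + ?c * ?m"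
        "\<forall>y<?c * ?m. A2 a_front (R r_lo + ?c + y) = N' (pth J v i (y div ?m) @ [opt J v i (y mod ?m)]) \<and>
          N' (pth J v i (y div ?m) @ [opt J v i (y mod ?m)]) \<noteq> 0" using 1(1) by blast
      have "\<forall>z<?m ^ Suc i. A2 a_front (R r_lo + ?c + z) = N' (pth J v (Suc i) z) \<and> N' (pth J v (Suc i) z) \<noteq> 0"
        using N'(4) by (simp add: mult.commute)
      then have "\<exists>N'. trie (R r_S) (R2 r_free) A2 N' \<and> buckets cap (R2 r_free) A2 N' bl \<and>
        (\<forall>z<?m ^ Suc i. A2 a_front (R r_lo + ?c + z) = N' (pth J v (Suc i) z) \<and> N' (pth J v (Suc i) z) \<noteq> 0)"
        using N'(1,2) by blast
      moreover have "R2 r_hi - (R r_lo + ?c) = ?m ^ Suc i" using N'(3) by simp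
      moreover have "pos i v + 2 * n = pos (Suc i) v" unfolding pos_def by simp
      ultimately show ?case unfolding runs_Asg_Sq runs_Asg using f2
        by (simp del: pth.simps power_Suc)
    qed simp
    then show ?case unfolding runs_Asg_Sq using f1 by simp
  qed simp
  moreover have "(5 + 7 * \<Delta>) + (1 + ((2 + ?c * (5 + 8 * ?m)) + 4)) \<le> 32 * ?m ^ w"
  proof -
    have "?m ^ Suc i \<le> ?m ^ w" using i \<Delta> by (intro power_increasing) auto
    moreover have "?c \<le> ?m ^ Suc i" using \<Delta> by simp
    moreover have "?m \<le> ?m ^ w" using \<Delta> by (intro self_le_power) auto
    moreover have "?c * (5 + 8 * ?m) = 5 * ?c + 8 * ?m ^ Suc i" by (simp add: algebra_simps)
    ultimately show ?thesis using \<Delta>(1) by linarith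
  qed
  ultimately show ?thesis by (rule runs_conseq)
qed

lemma runs_visit_paths:
  assumes c: "ctx J R" and v: "R r_v = v" "v < n"
    and T: "trie (R r_S) (R r_free) A N" and B: "buckets cap (R r_free) A N bl"
  shows "runs x visit_paths R A (7 + 34 * ((2 * \<Delta>) ^ w * (2 * \<Delta>) ^ w)) (\<lambda>R' A'. R' r_cnt = (2 * \<Delta>) ^ w \<and>
    (\<exists>N'. trie (R r_S) (R' r_free) A' N' \<and> buckets cap (R' r_free) A' N' bl \<and>
      (\<forall>z<(2 * \<Delta>) ^ w. A' a_front (R' r_lo + z) = N' (pth J v w z) \<and> N' (pth J v w z) \<noteq> 0)))"
proof -
  let ?m = "2 * \<Delta>"
  let ?R = "R(r_lo := 0, r_cnt := 1, r_offi := 0, r_ptri := pos 0 v)"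
  let ?A = "A(a_front := (A a_front)(0 := R r_S))"
  have w: "R r_w = w" "R r_S = cap + \<tau> * J" using c unfolding ctx_def by auto
  have N: "N [] = R r_S" "0 < R r_S" using T unfolding trie_def by auto
  have "runs x (For r_i r_w next_level) ?R ?A (2 + 34 * (?m ^ w * ?m ^ w)) (\<lambda>R' A'. R' r_cnt = ?m ^ w \<and>
    (\<exists>N'. trie (R r_S) (R' r_free) A' N' \<and> buckets cap (R' r_free) A' N' bl \<and>
      (\<forall>z<?m ^ w. A' a_front (R' r_lo + z) = N' (pth J v w z) \<and> N' (pth J v w z) \<noteq> 0)))"
  proof (rule runs_For[where f = "\<lambda>_. 32 * ?m ^ w" and I = "\<lambda>i R' A'. R' r_offi = i * J \<and> R' r_ptri = pos i v \<and>
      R' r_cnt = ?m ^ i \<and> (\<exists>N'. trie (R r_S) (R' r_free) A' N' \<and> buckets cap (R' r_free) A' N' bl \<and>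
      (\<forall>z<?m ^ i. A' a_front (R' r_lo + z) = N' (pth J v i z) \<and> N' (pth J v i z) \<noteq> 0))"], goal_cases)
    case 4
    have "trie (R r_S) (R r_free) ?A N" by (rule trie_cong[OF T]) simp
    moreover have "buckets cap (R r_free) ?A N bl" by (rule buckets_cong[OF B]) simp_all
    ultimately show ?case using N by (simp, intro exI[of _ N]) simp
  next
    case (5 i R1 A1)
    have i: "i < w" using 5(1) w by simp
    have c1: "ctx J R1" by (rule ctx_cong[OF c]) (use 5(4) in auto)
    have S1: "R1 r_S = R r_S" using 5(4) by simp
    obtain N' where "trie (R1 r_S) (R1 r_free) A1 N'" "buckets cap (R1 r_free) A1 N' bl"
      "\<And>z. z < ?m ^ i \<Longrightarrow> A1 a_front (R1 r_lo + z) = N' (pth J v i z) \<and> N' (pth J v i z) \<noteq> 0"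
      using 5(2) S1 by auto
    note lev = runs_next_level[OF c1 i v(2) _ _ this(1,2) _ this(3)]
    show ?case by (rule runs_conseq[OF lev]) (use 5(2) S1 in \<open>simp_all del: pth.simps power_Suc\<close>)
  next
    case 6
    have "w \<le> 2 ^ w" by (rule less_imp_le[OF less_exp])
    also have "(2::nat) ^ w \<le> ?m ^ w" using \<Delta> by (intro power_mono) auto
    finally have "w * (32 * ?m ^ w + 2) \<le> ?m ^ w * (32 * ?m ^ w + 2)" by (rule mult_le_mono1)
    moreover have "?m ^ w * 1 \<le> ?m ^ w * ?m ^ w" using \<Delta> by (intro mult_le_mono2) simp
    moreover have "?m ^ w * (32 * ?m ^ w + 2) = 32 * (?m ^ w * ?m ^ w) + 2 * (?m ^ w * 1)"
      by (simp add: algebra_simps)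
    ultimately have "2 + w * (32 * ?m ^ w + 2) \<le> 2 + 34 * (?m ^ w * ?m ^ w)" by linarith
    then show ?case using w by simp
  next
    case (7 R' A')
    then show ?case using w by simp
  qed auto
  then show ?thesis unfolding visit_paths_def runs_Put_Sq runs_Asg_Sq using v by (simp add: pos_def add.commute)
qed

lemma runs_measure_gap:
  assumes t: "t < \<tau>" and uv: "u < n" "v < n" "u \<noteq> v" and R: "R r_pu = pos t u" "R r_pv = pos t v"
  shows "runs x measure_gap R A 3 (\<lambda>R' A'. R' r_far = 0 \<longleftrightarrow> P u v (Suc t))"
proof -
  have e: "x (pos t u) = Q t u" "x (pos t v) = Q t v" "x (pos t u + 1) = F t u" "x (pos t v + 1) = F t v"
    using x_pos t uv by simp_all
  show ?thesis unfolding measure_gap_def P_iff[OF t uv]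
  proof (rule runs_Cond[where t = 2], goal_cases)
    case 2
    then show ?case
      by (intro runs_Cond[where t = 1]) (use R e in \<open>auto simp: runs_Asg\<close>)
  qed (use R e in \<open>auto simp: runs_Asg\<close>)
qed

lemma runs_test_pair:
  assumes c: "ctx J R" and uv: "R r_u = u" "R r_v = v" "u < n" "v < n" "u \<noteq> v"
  shows "runs x test_pair R A (6 + 10 * \<tau>)
    (\<lambda>R' A'. R' r_bad + (w - R' r_last) = 0 \<longleftrightarrow> assoc G \<Delta> vs u v)"
proof -
  let ?P = "\<lambda>s. P u v s"
  have cx: "R r_tau = \<tau>" "R r_Delta = \<Delta>" "R r_nn = 2 * n" using c unfolding ctx_def by auto
  let ?R = "R(r_last := 0, r_bad := 0, r_pu := pos 0 u, r_pv := pos 0 v)"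
  let ?b2 = "r_pu ::= Reg r_pu .+ Reg r_nn ;; r_pv ::= Reg r_pv .+ Reg r_nn"
  let ?b1 = "Cond (Reg r_far) (r_a ::= Lit 0)
           (r_bad ::= Reg r_bad .+ (Reg r_t .+ Lit 1 .- Reg r_last .- Reg r_Delta) ;;
            r_last ::= Reg r_t .+ Lit 1)"
  let ?I = "\<lambda>t R'. R' r_last = lastp ?P t \<and> (R' r_bad = 0 \<longleftrightarrow> gapless \<Delta> ?P t) \<and> R' r_pu = pos t u \<and> R' r_pv = pos t v"
  have "runs x (For r_t r_tau (measure_gap ;; ?b1 ;; ?b2)) ?R A (2 + 10 * \<tau>) (\<lambda>R' A'. ?I \<tau> R')"
  proof (rule runs_For[where f = "\<lambda>_. 8" and I = "\<lambda>t R' A'. ?I t R'"], goal_cases)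
    case (5 t R1 A1)
    have t: "t < \<tau>" using 5(1) cx by simp
    have gap: "runs x measure_gap R1 A1 3 (\<lambda>R' A'. R' r_far = 0 \<longleftrightarrow> P u v (Suc t))"
      by (rule runs_measure_gap[OF t uv(3-5)]) (use 5(2) in simp_all)
    show ?case
    proof (rule runs_Sq[OF gap, where t' = 5], goal_cases)
      case (1 R2 A2)
      have eq: "R2 r_last = lastp ?P t" "R2 r_bad = 0 \<longleftrightarrow> gapless \<Delta> ?P t" "R2 r_pu = pos t u" "R2 r_pv = pos t v"
        "R2 r_t = t" "R2 r_nn = 2 * n" "R2 r_Delta = \<Delta>"
        using 1(2) 5(2-4) cx by simp_all
      have "runs x ?b1 R2 A2 3 (\<lambda>R' A'. R' r_last = lastp ?P (Suc t) \<and> (R' r_bad = 0 \<longleftrightarrow> gapless \<Delta> ?P (Suc t)))"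
        by (rule runs_Cond[where t = 2]) (use eq 1(1) in \<open>auto simp: runs_Asg runs_Asg_Sq\<close>)
      then show ?case
      proof (rule runs_Sq[where t' = 2], goal_cases)
        case (1 R3 A3)
        then show ?case using eq by (simp add: runs_Asg runs_Asg_Sq pos_def del: lastp.simps gapless.simps)
      qed simp
    qed simp
  next
    case (7 R' A')
    then show ?case using cx by simp
  qed (use cx in auto)
  then have "runs x (For r_t r_tau (measure_gap ;; ?b1 ;; ?b2)) ?R A (2 + 10 * \<tau>)
    (\<lambda>R' A'. R' r_bad + (w - R' r_last) = 0 \<longleftrightarrow> assoc G \<Delta> vs u v)"
    by (rule runs_conseq) (use assoc_iff_gapless[OF \<Delta>, of vs u v] in auto)
  then show ?thesis unfolding test_pair_def runs_Asg_Sq using uv by (simp add: pos_def add.commute)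
qed

definition partial_graph :: "arrays \<Rightarrow> (nat \<Rightarrow> nat \<Rightarrow> bool) \<Rightarrow> bool" where
  "partial_graph A E \<longleftrightarrow> rows n A \<and> represents_graph n A E \<and> symp E \<and> (\<forall>a b. E a b \<longrightarrow> assoc G \<Delta> vs a b)"

lemma partial_graph_cong:
  assumes "partial_graph A E" and "\<And>a. a \<in> {a_row, a_adj, a_nb, a_deg} \<Longrightarrow> A' a = A a"
  shows "partial_graph A' E"
proof -
  have "represents_graph n A' E"
    by (rule represents_graph_cong[of n A E]) (use assms in \<open>auto simp: partial_graph_def\<close>)
  then show ?thesis using assms unfolding partial_graph_def rows_def by simp
qed

lemma runs_check_pair:
  assumes c: "ctx J R" and uv: "R r_u = u" "R r_v = v" "u < n" "v < n" "u \<noteq> v" and E: "partial_graph A E"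
  shows "runs x check_pair R A (15 + 10 * \<tau>) (\<lambda>R' A'. \<exists>E'. partial_graph A' E' \<and>
    (\<forall>a b. E a b \<longrightarrow> E' a b) \<and> (assoc G \<Delta> vs u v \<longrightarrow> E' u v))"
proof -
  let ?Q = "\<lambda>R' A'. \<exists>E'. partial_graph A' E' \<and> (\<forall>a b. E a b \<longrightarrow> E' a b) \<and> (assoc G \<Delta> vs u v \<longrightarrow> E' u v)"
  let ?R = "R(r_x := u * n + v)"
  let ?c2 = "Cond (Reg r_bad .+ (Reg r_w .- Reg r_last)) (r_a ::= Lit 0) add_edge"
  have Ed: "rows n A" "represents_graph n A E" "symp E" "\<And>a b. E a b \<Longrightarrow> assoc G \<Delta> vs a b"
    using E unfolding partial_graph_def by auto
  have row: "A a_row u = u * n" using Ed(1) uv unfolding rows_def by simp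
  have adj: "A a_adj (u * n + v) = of_bool (E u v)" using Ed(2) uv unfolding represents_graph_def by simp
  have c': "ctx J ?R" by (rule ctx_cong[OF c]) auto
  have "runs x (Cond (Ar a_adj (Reg r_x)) (r_a ::= Lit 0) (test_pair ;; ?c2)) ?R A (14 + 10 * \<tau>) ?Q"
  proof (rule runs_Cond[where t = "13 + 10 * \<tau>"], goal_cases)
    case 1
    then have "E u v" using adj by simp
    then have "?Q R A" using E by blast
    then show ?case by (simp add: runs_Asg)
  next
    case 2
    then have nE: "\<not> E u v" using adj by simp
    have test: "runs x test_pair ?R A (6 + 10 * \<tau>)
        (\<lambda>R' A'. R' r_bad + (w - R' r_last) = 0 \<longleftrightarrow> assoc G \<Delta> vs u v)"
      by (rule runs_test_pair[OF c']) (use uv in simp_all)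
    show ?case
    proof (rule runs_Sq[OF test, where t' = 7], goal_cases)
      case (1 R1 A1)
      have A1: "A1 = A" using 1(3) by auto
      have r1: "R1 r_w = w" "R1 r_u = u" "R1 r_v = v" using 1(2) uv c unfolding ctx_def by simp_all
      show ?case
      proof (rule runs_Cond[where t = 6], goal_cases)
        case c1: 1
        then have "R1 r_bad + (w - R1 r_last) \<noteq> 0" using r1 by simp
        then have "\<not> assoc G \<Delta> vs u v" unfolding 1(1)[symmetric] .
        then have "?Q R1 A1" using E A1 by blast
        then show ?case by (simp add: runs_Asg)
      next
        case c2: 2
        then have as: "assoc G \<Delta> vs u v" using 1(1) r1 by simp
        have "runs x add_edge R1 A1 6 (\<lambda>R' A'. R' = R1 \<and> represents_graph n A' (plus_edge E (R1 r_u) (R1 r_v)))"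
          by (rule runs_add_edge) (use Ed A1 r1 uv nE in auto)
        then show ?case
        proof (rule runs_conseq, goal_cases)
          case (2 R2 A2)
          have "rows n A2" using 2(3)[of a_row] Ed(1) A1 unfolding rows_def by simp
          then have "partial_graph A2 (plus_edge E u v)"
            using 2(1) r1 symp_plus_edge[OF Ed(3)] Ed(4) as assoc_sym[of G \<Delta> vs u v]
            unfolding partial_graph_def plus_edge_def by auto
          moreover have "plus_edge E u v u v" "\<And>a b. E a b \<Longrightarrow> plus_edge E u v a b"
            unfolding plus_edge_def by auto
          ultimately show ?case by blast
        qed simp
      qed simp
    qed simp
  qed simp
  then show ?thesis unfolding check_pair_def runs_Asg_Sq using row uv by simp
qed

lemma runs_scan_bucket:
  assumes c: "ctx J R" and v: "R r_v = v" "v < n" and E: "partial_graph A E"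
    and l: "R r_bc = length l" "\<And>i. i < length l \<Longrightarrow> A a_bucket (R r_leaf + i) = l ! i"
    and lv: "\<And>u. u \<in> set l \<Longrightarrow> u < v"
  shows "runs x scan_bucket R A (2 + length l * (18 + 10 * \<tau>)) (\<lambda>R' A'. \<exists>E'. partial_graph A' E' \<and>
    (\<forall>a b. E a b \<longrightarrow> E' a b) \<and> (\<forall>u\<in>set l. assoc G \<Delta> vs u v \<longrightarrow> E' u v))"
  unfolding scan_bucket_def
proof (rule runs_For[where f = "\<lambda>_. 16 + 10 * \<tau>" and I = "\<lambda>j R' A'. \<exists>E'. partial_graph A' E' \<and>
    (\<forall>a b. E a b \<longrightarrow> E' a b) \<and> (\<forall>i<j. assoc G \<Delta> vs (l ! i) v \<longrightarrow> E' (l ! i) v)"], goal_cases)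
  case (5 j R1 A1)
  have j: "j < length l" using 5(1) l by simp
  obtain E1 where E1: "partial_graph A1 E1" "\<And>a b. E a b \<Longrightarrow> E1 a b"
    "\<And>i. i < j \<Longrightarrow> assoc G \<Delta> vs (l ! i) v \<Longrightarrow> E1 (l ! i) v" using 5(2) by blast
  let ?R = "R1(r_u := l ! j)"
  have c1: "ctx J ?R" by (rule ctx_cong[OF c]) (use 5(4) in auto)
  have u: "l ! j < v" using lv j by simp
  have v1: "R1 r_v = v" "R1 r_leaf = R r_leaf" using 5(4) v by simp_all
  have "runs x check_pair ?R A1 (15 + 10 * \<tau>) (\<lambda>R' A'. \<exists>E'. partial_graph A' E' \<and>
    (\<forall>a b. E1 a b \<longrightarrow> E' a b) \<and> (assoc G \<Delta> vs (l ! j) v \<longrightarrow> E' (l ! j) v))"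
    by (rule runs_check_pair[OF c1 _ _ _ _ _ E1(1)]) (use u v v1 in auto)
  then have "runs x check_pair ?R A1 (15 + 10 * \<tau>) (\<lambda>R' A'. \<exists>E'. partial_graph A' E' \<and>
    (\<forall>a b. E a b \<longrightarrow> E' a b) \<and> (\<forall>i<Suc j. assoc G \<Delta> vs (l ! i) v \<longrightarrow> E' (l ! i) v))"
  proof (rule runs_conseq, goal_cases)
    case (2 R' A')
    then show ?case using E1(2,3) by (metis less_Suc_eq)
  qed simp
  moreover have "ev x (Ar a_bucket (Reg r_leaf .+ Reg r_b)) R1 A1 = l ! j"
    using v1 5(3,5) l(2)[OF j] by simp
  ultimately show ?case unfolding runs_Asg_Sq by simp
next
  case (7 R' A')
  then show ?case using l(1) by (metis in_set_conv_nth)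
qed (use E l in auto)

end

definition visit :: cmd where
  "visit = (visit_paths ;; For r_z r_cnt visit_leaf)"

lemma visit_frame [simp]:
  "mods visit = mods visit_paths \<union> mods visit_leaf"
  "amods visit = amods visit_paths \<union> amods visit_leaf"
  by (auto simp: visit_def)

definition max_loop :: cmd where
  "max_loop =
     (r_p ::= Lit 5 ;;
      r_J ::= Lit 0 ;;
      For r_t r_tau
        (For r_v r_n
          (r_J ::= Reg r_J .+ (Inp (Reg r_p) .- Reg r_J) ;;
           r_p ::= Reg r_p .+ Lit 2)) ;;
      r_J ::= Reg r_J .+ Lit 2)"

definition stride_loop :: cmd where
  "stride_loop = (r_S ::= Reg r_cap ;; For r_t r_tau (r_S ::= Reg r_S .+ Reg r_J))"

lemma setup_frames [simp]:
  "mods max_loop = {r_p, r_J, r_t, r_v}" "amods max_loop = {}"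
  "mods stride_loop = {r_S, r_t}" "amods stride_loop = {}"
  by (simp_all add: max_loop_def stride_loop_def insert_commute)

definition interval_main :: cmd where
  "interval_main =
     (r_w ::= Reg r_tau .+ Lit 1 .- Reg r_Delta ;;
      power_prog ;;
      degree_bound ;;
      setup_rows ;;
      max_loop ;;
      r_cap ::= Reg r_D .+ Reg r_y .+ Reg r_y ;;
      stride_loop ;;
      r_nn ::= Reg r_n .+ Reg r_n ;;
      r_td ::= Reg r_Delta .+ Reg r_Delta ;;
      r_free ::= Reg r_S .+ Reg r_S ;;
      r_found ::= Lit 0 ;;
      For r_v r_n visit ;;
      Cond (Reg r_found) (r_a ::= Lit 0) search_all ;;
      r_found ::= Lit 1 .- (Lit 1 .- Reg r_found))"

context interval_input
begin

declare pth.simps [simp del]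

lemma runs_visit_leaf:
  assumes c: "ctx J R" and v: "R r_v = v" "v < n" and k: "1 \<le> k" and E: "partial_graph A E"
    and T: "trie (R r_S) (R r_free) A N" and B: "buckets cap (R r_free) A N bl"
    and p: "A a_front (R r_lo + R r_z) = N p" "N p \<noteq> 0"
    and bl: "distinct (bl p)" "\<And>u. u \<in> set (bl p) \<Longrightarrow> u < v \<and> p \<in> pths J u"
  shows "runs x visit_leaf R A (7 + cap * (18 + 10 * \<tau>)) (\<lambda>R' A'. trie (R r_S) (R r_free) A' N \<and>
    (\<exists>E'. partial_graph A' E' \<and> (\<forall>a b. E a b \<longrightarrow> E' a b) \<and> (\<forall>u\<in>set (bl p). assoc G \<Delta> vs u v \<longrightarrow> E' u v)) \<and>
    (R' r_found = R r_found \<and> buckets cap (R r_free) A' N (bl(p := bl p @ [v])) \<or>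
     R' r_found \<noteq> 0 \<and> temporal_clique \<Delta> G k \<and> buckets cap (R r_free) A' N bl))"
proof -
  let ?l = "length (bl p)"
  have cx: "R r_cap = cap" "R r_S = cap + \<tau> * J" "bounded J" using c unfolding ctx_def by auto
  have l: "A a_cnt (N p) = ?l" "\<And>i. i < ?l \<Longrightarrow> A a_bucket (N p + i) = bl p ! i" "?l \<le> cap"
    using B p(2) unfolding buckets_def by auto
  let ?R = "R(r_leaf := N p, r_bc := ?l)"
  let ?G = "\<lambda>A'. \<exists>E'. partial_graph A' E' \<and> (\<forall>a b. E a b \<longrightarrow> E' a b) \<and>
      (\<forall>u\<in>set (bl p). assoc G \<Delta> vs u v \<longrightarrow> E' u v)"
  let ?fin = "Cond (Reg r_cap .- Reg r_bc)
        (Put a_bucket (Reg r_leaf .+ Reg r_bc) (Reg r_v) ;;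
         Put a_cnt (Reg r_leaf) (Reg r_bc .+ Lit 1))
        (r_found ::= Lit 1)"
  let ?Q = "\<lambda>R' A'. trie (R r_S) (R r_free) A' N \<and> ?G A' \<and>
    (R' r_found = R r_found \<and> buckets cap (R r_free) A' N (bl(p := bl p @ [v])) \<or>
     R' r_found \<noteq> 0 \<and> temporal_clique \<Delta> G k \<and> buckets cap (R r_free) A' N bl)"
  have c': "ctx J ?R" by (rule ctx_cong[OF c]) auto
  have "runs x scan_bucket ?R A (2 + ?l * (18 + 10 * \<tau>)) (\<lambda>R' A'. ?G A')"
    by (rule runs_scan_bucket[OF c' _ v(2) E]) (use v l bl in auto)
  then have scan: "runs x scan_bucket ?R A (2 + cap * (18 + 10 * \<tau>)) (\<lambda>R' A'. ?G A')"
    by (rule runs_conseq) (use l(3) mult_le_mono1[OF l(3), of "18 + 10 * \<tau>"] in simp_all)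
  have "runs x (scan_bucket ;; ?fin) ?R A (2 + cap * (18 + 10 * \<tau>) + 3) ?Q"
  proof (rule runs_Sq[OF scan, where t' = 3], goal_cases)
    case (1 R1 A1)
    have r1: "R1 r_cap = cap" "R1 r_bc = ?l" "R1 r_leaf = N p" "R1 r_v = v" "R1 r_found = R r_found"
      using 1(2) cx v by simp_all
    have a1: "A1 a_trie = A a_trie" "A1 a_cnt = A a_cnt" "A1 a_bucket = A a_bucket" using 1(3) by simp_all
    have T1: "trie (R r_S) (R r_free) A1 N" by (rule trie_cong[OF T]) (simp add: a1)
    have B1: "buckets cap (R r_free) A1 N bl" by (rule buckets_cong[OF B]) (simp_all add: a1)
    obtain E' where E': "partial_graph A1 E'" "(\<forall>a b. E a b \<longrightarrow> E' a b) \<and>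
      (\<forall>u\<in>set (bl p). assoc G \<Delta> vs u v \<longrightarrow> E' u v)" using 1(1) by blast
    show ?case
    proof (rule runs_Cond[where t = 2], goal_cases)
      case c1: 1
      then have less: "?l < cap" using r1 by simp
      let ?A = "A1(a_bucket := (A1 a_bucket)(N p + ?l := v), a_cnt := (A1 a_cnt)(N p := ?l + 1))"
      have "buckets cap (R r_free) ?A N (bl(p := bl p @ [v]))"
        by (rule buckets_insert[OF T1 B1 p(2) less]) (use cx(2) in simp_all)
      moreover have "trie (R r_S) (R r_free) ?A N" by (rule trie_cong[OF T1]) simp
      moreover have "partial_graph ?A E'" by (rule partial_graph_cong[OF E'(1)]) auto
      ultimately have "?Q R1 ?A" using E'(2) r1(5) by blast
      then show ?case unfolding runs_Put_Sq runs_Put using r1 by simp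
    next
      case c2: 2
      then have full: "cap \<le> ?l" using r1 by simp
      have "temporal_clique \<Delta> G k"
      proof (rule large_bucket_clique[OF cx(3)])
        show "set (bl p) \<subseteq> {..<n}" using bl(2) v(2) by fastforce
        show "cap \<le> card (set (bl p))" using full distinct_card[OF bl(1)] by simp
      qed (use bl(2) k in auto)
      then have "?Q (R1(r_found := 1)) A1" using E' T1 B1
        by (intro conjI disjI2 exI[of _ E']) simp_all
      then show ?case unfolding runs_Asg by simp
    qed simp
  qed simp
  then have "runs x (scan_bucket ;; ?fin) ?R A (5 + cap * (18 + 10 * \<tau>)) ?Q"
    by (rule runs_conseq) simp_all
  moreover have "ev x (Ar a_front (Reg r_lo .+ Reg r_z)) R A = N p"
    "ev x (Ar a_cnt (Reg r_leaf)) (R(r_leaf := N p)) A = ?l" using p l(1) by simp_all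
  ultimately show ?thesis unfolding visit_leaf_def runs_Asg_Sq by simp
qed

text \<open>As long as no bucket is full, all pairs among the first \<open>v\<close> vertices have been considered.\<close>

definition visited :: "nat \<Rightarrow> nat \<Rightarrow> regs \<Rightarrow> arrays \<Rightarrow> bool" where
  "visited J v R A \<longleftrightarrow> (\<exists>N bl E. trie (R r_S) (R r_free) A N \<and> buckets cap (R r_free) A N bl \<and>
     partial_graph A E \<and> (R r_found \<noteq> 0 \<longrightarrow> temporal_clique \<Delta> G k) \<and>
     (\<forall>p. distinct (bl p) \<and> (\<forall>u\<in>set (bl p). u < v \<and> p \<in> pths J u)) \<and>
     (R r_found = 0 \<longrightarrow> (\<forall>u<v. \<forall>p\<in>pths J u. u \<in> set (bl p)) \<and>
        (\<forall>u<v. \<forall>u'<u. assoc G \<Delta> vs u' u \<longrightarrow> E u' u)))"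

lemma runs_visit_leaves:
  assumes c: "ctx J R" and v: "R r_v = v" "v < n" and k: "1 \<le> k" and E: "partial_graph A E"
    and T: "trie (R r_S) (R r_free) A N" and B: "buckets cap (R r_free) A N bl"
    and cnt: "R r_cnt = (2 * \<Delta>) ^ w"
    and front: "\<And>z. z < (2 * \<Delta>) ^ w \<Longrightarrow> A a_front (R r_lo + z) = N (pth J v w z) \<and> N (pth J v w z) \<noteq> 0"
    and found: "R r_found \<noteq> 0 \<Longrightarrow> temporal_clique \<Delta> G k"
    and bl: "\<And>p. distinct (bl p)" "\<And>u p. u \<in> set (bl p) \<Longrightarrow> u < v \<and> p \<in> pths J u"
    and all: "R r_found = 0 \<Longrightarrow> \<forall>u<v. \<forall>p\<in>pths J u. u \<in> set (bl p)"
      "R r_found = 0 \<Longrightarrow> \<forall>u<v. \<forall>u'<u. assoc G \<Delta> vs u' u \<longrightarrow> E u' u"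
  shows "runs x (For r_z r_cnt visit_leaf) R A (2 + (2 * \<Delta>) ^ w * (9 + cap * (18 + 10 * \<tau>)))
    (visited J (Suc v))"
proof -
  let ?Y = "(2 * \<Delta>) ^ w" and ?p = "pth J v w"
  have J: "bounded J" using c unfolding ctx_def by simp
  have inj: "z = z'" if "z < ?Y" "z' < ?Y" "?p z = ?p z'" for z z'
    using pth_inj[OF J v(2) _ that] by simp
  have pv: "?p z \<in> pths J v" if "z < ?Y" for z using that unfolding pths_def by blast
  let ?I = "\<lambda>j R' A'. trie (R r_S) (R r_free) A' N \<and> (\<exists>b E'. buckets cap (R r_free) A' N b \<and>
     partial_graph A' E' \<and> (\<forall>a b. E a b \<longrightarrow> E' a b) \<and> (R' r_found \<noteq> 0 \<longrightarrow> temporal_clique \<Delta> G k) \<and>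
     (\<forall>p. distinct (b p) \<and> (\<forall>u\<in>set (b p). u < Suc v \<and> p \<in> pths J u)) \<and>
     (\<forall>z. j \<le> z \<longrightarrow> z < ?Y \<longrightarrow> b (?p z) = bl (?p z)) \<and>
     (\<forall>z<j. \<forall>u\<in>set (bl (?p z)). assoc G \<Delta> vs u v \<longrightarrow> E' u v) \<and>
     (R' r_found = 0 \<longrightarrow> R r_found = 0 \<and> (\<forall>z<j. v \<in> set (b (?p z))) \<and> (\<forall>p. set (bl p) \<subseteq> set (b p))))"
  show ?thesis
  proof (rule runs_For[where f = "\<lambda>_. 7 + cap * (18 + 10 * \<tau>)" and I = ?I], goal_cases)
    case 4
    have "\<forall>p. distinct (bl p) \<and> (\<forall>u\<in>set (bl p). u < Suc v \<and> p \<in> pths J u)"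
      using bl less_SucI by blast
    then show ?case using T B E found by (intro conjI exI[of _ bl] exI[of _ E]) auto
  next
    case (5 j R1 A1)
    have j: "j < ?Y" using 5(1) cnt by simp
    from 5(2) obtain b E1 where raw: "trie (R r_S) (R r_free) A1 N" "buckets cap (R r_free) A1 N b"
      "partial_graph A1 E1" "\<forall>a b. E a b \<longrightarrow> E1 a b" "R1 r_found \<noteq> 0 \<longrightarrow> temporal_clique \<Delta> G k"
      "\<forall>p. distinct (b p) \<and> (\<forall>u\<in>set (b p). u < Suc v \<and> p \<in> pths J u)"
      "\<forall>z. j \<le> z \<longrightarrow> z < ?Y \<longrightarrow> b (?p z) = bl (?p z)"
      "\<forall>z<j. \<forall>u\<in>set (bl (?p z)). assoc G \<Delta> vs u v \<longrightarrow> E1 u v"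
      "R1 r_found = 0 \<longrightarrow> R r_found = 0 \<and> (\<forall>z<j. v \<in> set (b (?p z))) \<and> (\<forall>p. set (bl p) \<subseteq> set (b p))"
      by (elim conjE exE) (rule that)
    note b = raw(1-3) raw(4)[rule_format] raw(5)[THEN mp] raw(6)[THEN spec, THEN conjunct1]
      raw(6)[THEN spec, THEN conjunct2, THEN bspec] raw(7)[rule_format] raw(8)[rule_format] raw(9)[THEN mp]
    have c1: "ctx J R1" by (rule ctx_cong[OF c]) (use 5(4) in auto)
    have r1: "R1 r_v = v" "R1 r_S = R r_S" "R1 r_free = R r_free" "R1 r_lo = R r_lo" using 5(4) v by simp_all
    have bj: "b (?p j) = bl (?p j)" using b(8) j by simp
    have "runs x visit_leaf R1 A1 (7 + cap * (18 + 10 * \<tau>)) (\<lambda>R' A'. trie (R1 r_S) (R1 r_free) A' N \<and>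
      (\<exists>E'. partial_graph A' E' \<and> (\<forall>a b. E1 a b \<longrightarrow> E' a b) \<and>
        (\<forall>u\<in>set (b (?p j)). assoc G \<Delta> vs u v \<longrightarrow> E' u v)) \<and>
      (R' r_found = R1 r_found \<and> buckets cap (R1 r_free) A' N (b(?p j := b (?p j) @ [v])) \<or>
       R' r_found \<noteq> 0 \<and> temporal_clique \<Delta> G k \<and> buckets cap (R1 r_free) A' N b))"
    proof (rule runs_visit_leaf[OF c1 r1(1) v(2) k b(3)])
      show "A1 a_front (R1 r_lo + R1 r_z) = N (?p j)" using front[OF j] 5(3,5) r1 by simp
      show "N (?p j) \<noteq> 0" using front[OF j] by simp
      show "distinct (b (?p j))" by (rule b(6))
      show "\<And>u. u \<in> set (b (?p j)) \<Longrightarrow> u < v \<and> ?p j \<in> pths J u" using bj bl(2) by simp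
    qed (use b(1,2) r1 in simp_all)
    then show ?case
    proof (rule runs_conseq, goal_cases)
      case (2 R2 A2)
      obtain E2 where E2: "partial_graph A2 E2" "\<And>a b. E1 a b \<Longrightarrow> E2 a b"
        "\<And>u. u \<in> set (bl (?p j)) \<Longrightarrow> assoc G \<Delta> vs u v \<Longrightarrow> E2 u v" using 2(1) bj by auto
      have mono: "\<forall>a b. E a b \<longrightarrow> E2 a b" using b(4) E2(2) by blast
      have seen: "\<forall>z<Suc j. \<forall>u\<in>set (bl (?p z)). assoc G \<Delta> vs u v \<longrightarrow> E2 u v"
        using b(9) E2(2,3) less_Suc_eq by metis
      have T2: "trie (R r_S) (R r_free) A2 N" using 2(1) r1 by simp
      have upd: "(R2(r_z := Suc j)) r_found = R2 r_found" by simp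
      consider (ins) "R2 r_found = R1 r_found" "buckets cap (R r_free) A2 N (b(?p j := b (?p j) @ [v]))"
        | (full) "R2 r_found \<noteq> 0" "temporal_clique \<Delta> G k" "buckets cap (R r_free) A2 N b"
        using 2(1) r1(3) by auto
      then show ?case
      proof cases
        case ins
        let ?b = "b(?p j := b (?p j) @ [v])"
        have nv: "v \<notin> set (b (?p j))" using bj bl(2) by fastforce
        have 1: "\<forall>p. distinct (?b p) \<and> (\<forall>u\<in>set (?b p). u < Suc v \<and> p \<in> pths J u)"
          using b(6,7) nv pv[OF j] by auto
        have 2: "\<forall>z. Suc j \<le> z \<longrightarrow> z < ?Y \<longrightarrow> ?b (?p z) = bl (?p z)"
        proof (intro allI impI)
          fix z assume z: "Suc j \<le> z" "z < ?Y"
          then have "?p z \<noteq> ?p j" using inj[OF z(2) j] by auto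
          then show "?b (?p z) = bl (?p z)" using b(8)[of z] z by simp
        qed
        have 3: "R2 r_found = 0 \<longrightarrow> R r_found = 0 \<and> (\<forall>z<Suc j. v \<in> set (?b (?p z))) \<and>
            (\<forall>p. set (bl p) \<subseteq> set (?b p))"
        proof
          assume "R2 r_found = 0"
          then have *: "R r_found = 0" "\<And>z. z < j \<Longrightarrow> v \<in> set (b (?p z))" "\<And>p. set (bl p) \<subseteq> set (b p)"
            using b(10) ins(1) by auto
          have "v \<in> set (?b (?p z))" if "z < Suc j" for z
            using *(2)[of z] that by (cases "z = j") auto
          moreover have "set (bl p) \<subseteq> set (?b p)" for p using *(3)[of p] by auto
          ultimately show "R r_found = 0 \<and> (\<forall>z<Suc j. v \<in> set (?b (?p z))) \<and> (\<forall>p. set (bl p) \<subseteq> set (?b p))"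
            using *(1) by blast
        qed
        have 4: "R2 r_found \<noteq> 0 \<longrightarrow> temporal_clique \<Delta> G k" using ins(1) b(5) by simp
        show ?thesis unfolding upd
          by (intro conjI exI[of _ ?b] exI[of _ E2]; fact T2 ins(2) E2(1) mono 4 1 2 seen 3)
      next
        case full
        have 1: "R2 r_found \<noteq> 0 \<longrightarrow> temporal_clique \<Delta> G k" using full(2) by blast
        have 2: "\<forall>z. Suc j \<le> z \<longrightarrow> z < ?Y \<longrightarrow> b (?p z) = bl (?p z)" using b(8) by simp
        have 3: "R2 r_found = 0 \<longrightarrow> R r_found = 0 \<and> (\<forall>z<Suc j. v \<in> set (b (?p z))) \<and>
            (\<forall>p. set (bl p) \<subseteq> set (b p))" using full(1) by blast
        show ?thesis unfolding upd
          by (intro conjI exI[of _ b] exI[of _ E2]; fact T2 full(3) E2(1) mono 1 raw(6) 2 seen 3)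
      qed
    qed simp
  next
    case 6
    then show ?case using cnt by simp
  next
    case (7 R' A')
    from 7(1)[unfolded cnt] obtain b E' where raw: "trie (R r_S) (R r_free) A' N"
      "buckets cap (R r_free) A' N b" "partial_graph A' E'"
      "\<forall>a b. E a b \<longrightarrow> E' a b" "R' r_found \<noteq> 0 \<longrightarrow> temporal_clique \<Delta> G k"
      "\<forall>p. distinct (b p) \<and> (\<forall>u\<in>set (b p). u < Suc v \<and> p \<in> pths J u)"
      "\<forall>z. ?Y \<le> z \<longrightarrow> z < ?Y \<longrightarrow> b (?p z) = bl (?p z)"
      "\<forall>z<?Y. \<forall>u\<in>set (bl (?p z)). assoc G \<Delta> vs u v \<longrightarrow> E' u v"
      "R' r_found = 0 \<longrightarrow> R r_found = 0 \<and> (\<forall>z<?Y. v \<in> set (b (?p z))) \<and> (\<forall>p. set (bl p) \<subseteq> set (b p))"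
      by (elim conjE exE) (rule that)
    note b = raw(1-3) raw(4)[rule_format] raw(5)[THEN mp] raw(6) raw(8)[rule_format] raw(9)[THEN mp]
    have r: "R' r_S = R r_S" "R' r_free = R r_free" using 7(3) by simp_all
    have 1: "\<forall>u<Suc v. \<forall>p\<in>pths J u. u \<in> set (b p)" if f: "R' r_found = 0"
    proof (intro allI impI ballI)
      fix u p assume u: "u < Suc v" "p \<in> pths J u"
      note b8 = b(8)[OF f]
      show "u \<in> set (b p)"
      proof (cases "u = v")
        case True
        then show ?thesis using u(2) b8 unfolding pths_def by auto
      next
        case False
        then have "u \<in> set (bl p)" using u all(1) b8 by simp
        then show ?thesis using b8 by blast
      qed
    qed
    have 2: "\<forall>u<Suc v. \<forall>u'<u. assoc G \<Delta> vs u' u \<longrightarrow> E' u' u" if f: "R' r_found = 0"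
    proof (intro allI impI)
      fix u u' assume u: "u < Suc v" "u' < u" "assoc G \<Delta> vs u' u"
      have f0: "R r_found = 0" using b(8)[OF f] by blast
      show "E' u' u"
      proof (cases "u = v")
        case True
        then obtain p where p: "p \<in> pths J u'" "p \<in> pths J v"
          using assoc_common_path[OF u(3), of J] u v(2) by auto
        then obtain z where "z < ?Y" "p = ?p z" unfolding pths_def by auto
        moreover have "u' \<in> set (bl p)" using all(1)[OF f0] p(1) u True by blast
        ultimately show ?thesis using b(7) u(3) True by blast
      next
        case False
        then show ?thesis using all(2)[OF f0] u b(4) by simp
      qed
    qed
    show ?case unfolding visited_def using b(1-3,5,6) r 1 2
      by (intro exI[of _ N] exI[of _ b] exI[of _ E']) simp
  qed (use cnt in auto)
qed

lemma runs_visit: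
  assumes c: "ctx J R" and v: "R r_v = v" "v < n" and k: "2 \<le> k" and vis: "visited J v R A"
  shows "runs x visit R A (80 * (k * ((2 * \<Delta>) ^ w) ^ 3)) (visited J (Suc v))"
proof -
  let ?Y = "(2 * \<Delta>) ^ w"
  from vis obtain N bl E where raw: "trie (R r_S) (R r_free) A N" "buckets cap (R r_free) A N bl"
     "partial_graph A E" "R r_found \<noteq> 0 \<longrightarrow> temporal_clique \<Delta> G k"
     "\<forall>p. distinct (bl p) \<and> (\<forall>u\<in>set (bl p). u < v \<and> p \<in> pths J u)"
     "R r_found = 0 \<longrightarrow> (\<forall>u<v. \<forall>p\<in>pths J u. u \<in> set (bl p)) \<and>
        (\<forall>u<v. \<forall>u'<u. assoc G \<Delta> vs u' u \<longrightarrow> E u' u)"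
    unfolding visited_def by (elim conjE exE) (rule that)
  note V = raw(1-3) raw(4)[THEN mp] raw(5)[THEN spec, THEN conjunct1]
    raw(5)[THEN spec, THEN conjunct2, THEN bspec] raw(6)[THEN mp, THEN conjunct1] raw(6)[THEN mp, THEN conjunct2]
  have "runs x visit R A ((7 + 34 * (?Y * ?Y)) + (2 + ?Y * (9 + cap * (18 + 10 * \<tau>)))) (visited J (Suc v))"
    unfolding visit_def
  proof (rule runs_Sq[OF runs_visit_paths[OF c v V(1,2)], where t' = "2 + ?Y * (9 + cap * (18 + 10 * \<tau>))"],
      goal_cases)
    case (1 R1 A1)
    from 1(1) obtain N' where raw': "trie (R r_S) (R1 r_free) A1 N'" "buckets cap (R1 r_free) A1 N' bl"
      "\<forall>z<?Y. A1 a_front (R1 r_lo + z) = N' (pth J v w z) \<and> N' (pth J v w z) \<noteq> 0"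
      by (elim conjE exE) (rule that)
    note N' = raw'(1,2) raw'(3)[rule_format]
    have r1: "R1 r_S = R r_S" "R1 r_v = v" "R1 r_found = R r_found" using 1(2) v by simp_all
    have c1: "ctx J R1" by (rule ctx_cong[OF c]) (use 1(2) in auto)
    have E1: "partial_graph A1 E" by (rule partial_graph_cong[OF V(3)]) (use 1(3) in auto)
    show ?case
    proof (rule runs_visit_leaves[OF c1 r1(2) v(2) _ E1, where N = N' and bl = bl])
      show "trie (R1 r_S) (R1 r_free) A1 N'" using N'(1) r1 by simp
      show "R1 r_cnt = ?Y" by (rule conjunct1[OF 1(1)])
      show "1 \<le> k" using k by simp
    qed (unfold r1(3), rule N'(2), erule N'(3), erule V(4), rule V(5), erule V(6), erule V(7), erule V(8))
  qed simp
  moreover have "(7 + 34 * (?Y * ?Y)) + (2 + ?Y * (9 + cap * (18 + 10 * \<tau>))) \<le> 80 * (k * ?Y ^ 3)"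
  proof -
    have Y1: "1 \<le> ?Y" using \<Delta> by simp
    have tau: "\<tau> \<le> ?Y" by (rule lifetime_le_power[OF \<Delta>])
    let ?y3 = "?Y * (?Y * ?Y)"
    have a: "?Y * ?Y \<le> ?y3" "?Y \<le> ?y3" "1 \<le> ?y3" using Y1 by (simp_all add: Suc_le_eq)
    have kk: "?y3 \<le> k * ?y3" using k by simp
    have "?Y * cap * \<tau> \<le> ?Y * cap * ?Y" using tau by (rule mult_le_mono2)
    also have "\<dots> = k * ?y3" by (simp add: algebra_simps)
    finally have b1: "?Y * cap * \<tau> \<le> k * ?y3" .
    have "?Y * cap * 1 \<le> ?Y * cap * ?Y" using Y1 by (rule mult_le_mono2)
    also have "\<dots> = k * ?y3" by (simp add: algebra_simps)
    finally have b2: "?Y * cap \<le> k * ?y3" by simp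
    have "?Y * (9 + cap * (18 + 10 * \<tau>)) = 9 * ?Y + 18 * (?Y * cap) + 10 * (?Y * cap * \<tau>)"
      by (simp add: algebra_simps)
    then have "(7 + 34 * (?Y * ?Y)) + (2 + ?Y * (9 + cap * (18 + 10 * \<tau>))) \<le> 80 * (k * ?y3)"
      using a kk b1 b2 by linarith
    then show ?thesis by (simp only: power3_eq_cube mult.assoc)
  qed
  ultimately show ?thesis by (rule runs_conseq)
qed

lemma runs_max_loop:
  assumes R: "R r_tau = \<tau>" "R r_n = n"
  shows "runs x max_loop R A (5 + \<tau> * (4 + 4 * n)) (\<lambda>R' A'. bounded (R' r_J))"
proof -
  let ?i = "r_J ::= Reg r_J .+ (Inp (Reg r_p) .- Reg r_J) ;; r_p ::= Reg r_p .+ Lit 2"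
  have "runs x (For r_t r_tau (For r_v r_n ?i)) (R(r_p := 5, r_J := 0)) A (2 + \<tau> * (4 + 4 * n))
    (\<lambda>R' A'. \<forall>t<\<tau>. \<forall>v<n. Q t v \<le> R' r_J)"
  proof (rule runs_For[where f = "\<lambda>_. 2 + 4 * n" and I = "\<lambda>t R' A'. R' r_p = pos t 0 \<and>
      (\<forall>s<t. \<forall>v<n. Q s v \<le> R' r_J)"], goal_cases)
    case (5 t R1 A1)
    have t: "t < \<tau>" using 5(1) R by simp
    have n1: "R1 r_n = n" using 5(4) R by simp
    have "runs x (For r_v r_n ?i) R1 A1 (2 + 4 * n) (\<lambda>R' A'. R' r_p = pos (Suc t) 0 \<and>
      (\<forall>s<Suc t. \<forall>v<n. Q s v \<le> R' r_J))"
    proof (rule runs_For[where f = "\<lambda>_. 2" and I = "\<lambda>v R' A'. R' r_p = pos t v \<and>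
        (\<forall>s<t. \<forall>v<n. Q s v \<le> R' r_J) \<and> (\<forall>u<v. Q t u \<le> R' r_J)"], goal_cases)
      case inner: (5 v R2 A2)
      have v: "v < n" using inner(1) n1 by simp
      have "x (R2 r_p) = Q t v" using x_pos(1)[OF t v] inner(2) by simp
      then show ?case using inner(2)
        by (auto simp: runs_Asg runs_Asg_Sq pos_def less_Suc_eq intro: trans_le_add1)
    next
      case (7 R' A')
      then show ?case using n1 by (auto simp: pos_def less_Suc_eq)
    qed (use 5(2) n1 in auto)
    then show ?case by (rule runs_conseq) auto
  next
    case (7 R' A')
    then show ?case using R by simp
  qed (use R in \<open>auto simp: pos_def algebra_simps\<close>)
  then have "runs x (For r_t r_tau (For r_v r_n ?i) ;; r_J ::= Reg r_J .+ Lit 2) (R(r_p := 5, r_J := 0)) A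
      (3 + \<tau> * (4 + 4 * n)) (\<lambda>R' A'. bounded (R' r_J))"
    by (rule runs_Sq[where t' = 1]) (auto simp: runs_Asg bounded_def)
  then show ?thesis unfolding max_loop_def runs_Asg_Sq ev.simps by simp
qed

lemma runs_stride_loop:
  "runs x stride_loop R A (3 + 3 * R r_tau) (\<lambda>R' A'. R' r_S = R r_cap + R r_tau * R r_J)"
proof -
  have "runs x (For r_t r_tau (r_S ::= Reg r_S .+ Reg r_J)) (R(r_S := R r_cap)) A (2 + 3 * R r_tau)
     (\<lambda>R' A'. R' r_S = R r_cap + R r_tau * R r_J)"
    by (rule runs_For[where f = "\<lambda>_. 1" and I = "\<lambda>j R' A'. R' r_S = R r_cap + j * R r_J"])
      (auto simp: runs_Asg)
  then show ?thesis unfolding stride_loop_def runs_Asg_Sq ev.simps by simp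
qed

lemma visited_0:
  assumes "R r_S = cap + \<tau> * J" and "R r_free = 2 * R r_S" and "R r_found = 0" and k: "1 \<le> k"
    and "rows n A" and A: "\<And>a i. a \<noteq> a_row \<Longrightarrow> A a i = 0"
  shows "visited J 0 R A"
proof -
  let ?N = "\<lambda>p :: nat list. if p = [] then R r_S else 0"
  have S: "0 < R r_S" using assms(1) k \<Delta> by simp
  have "trie (R r_S) (R r_free) A ?N" unfolding trie_def using S assms(2) A by auto
  moreover have "buckets cap (R r_free) A ?N (\<lambda>_. [])" unfolding buckets_def using A by auto
  moreover have "partial_graph A (\<lambda>_ _. False)"
    unfolding partial_graph_def using represents_graph_empty[of A n] A assms(5) by (auto simp: symp_def)
  ultimately show ?thesis unfolding visited_def using assms(3)
    by (intro exI[of _ ?N] exI[of _ "\<lambda>_. []"] exI[of _ "\<lambda>_ _. False"]) simp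
qed

end

context interval_input
begin

lemma runs_finish:
  assumes vis: "visited J n R A" and R: "R r_n = n" "R r_k = k" "R r_D = (k - 2) * (2 * \<Delta>) ^ w" and k: "2 \<le> k"
  shows "runs x (Cond (Reg r_found) (r_a ::= Lit 0) search_all ;; r_found ::= Lit 1 .- (Lit 1 .- Reg r_found)) R A
    (4 + 33 * (n * 2 ^ ((k - 2) * (2 * \<Delta>) ^ w)))
    (\<lambda>R' A'. R' r_found = (if temporal_clique \<Delta> G k then 1 else 0))"
proof -
  let ?D = "(k - 2) * (2 * \<Delta>) ^ w"
  from vis obtain N bl E where raw: "trie (R r_S) (R r_free) A N" "buckets cap (R r_free) A N bl"
     "partial_graph A E" "R r_found \<noteq> 0 \<longrightarrow> temporal_clique \<Delta> G k"
     "\<forall>p. distinct (bl p) \<and> (\<forall>u\<in>set (bl p). u < n \<and> p \<in> pths J u)"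
     "R r_found = 0 \<longrightarrow> (\<forall>u<n. \<forall>p\<in>pths J u. u \<in> set (bl p)) \<and>
        (\<forall>u<n. \<forall>u'<u. assoc G \<Delta> vs u' u \<longrightarrow> E u' u)"
    unfolding visited_def by (elim conjE exE) (rule that)
  have "runs x (Cond (Reg r_found) (r_a ::= Lit 0) search_all) R A (3 + 33 * (n * 2 ^ ?D))
    (\<lambda>R' A'. R' r_found \<noteq> 0 \<longleftrightarrow> temporal_clique \<Delta> G k)"
  proof (rule runs_Cond[where t = "2 + 33 * (n * 2 ^ ?D)"], goal_cases)
    case 1
    then show ?case using raw(4) by (simp add: runs_Asg)
  next
    case 2
    then have f: "R r_found = 0" by simp
    have E: "rows n A" "represents_graph n A E" "symp E" "\<And>a b. E a b \<Longrightarrow> assoc G \<Delta> vs a b"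
      using raw(3) unfolding partial_graph_def by auto
    have full: "\<And>u u'. u < n \<Longrightarrow> u' < u \<Longrightarrow> assoc G \<Delta> vs u' u \<Longrightarrow> E u' u" using raw(6) f by blast
    have "represents_graph n A (assoc G \<Delta> vs)"
    proof (rule represents_graph_cong[OF E(2)])
      fix u v assume uv: "u < n" "v < n"
      show "E u v \<longleftrightarrow> assoc G \<Delta> vs u v"
      proof
        assume a: "assoc G \<Delta> vs u v"
        then have "u \<noteq> v" using assoc_irrefl[OF tg \<Delta>(1)] by blast
        then consider "u < v" | "v < u" by linarith
        then show "E u v"
          using full[OF uv(2) _ a] full[OF uv(1) _ a[unfolded assoc_sym[of G \<Delta> vs u v]]] E(3)
          by cases (auto dest: sympD)
      qed (rule E(4))
    qed simp
    then have "runs x search_all R A (2 + R r_n * (33 * 2 ^ R r_D))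
      (\<lambda>R' A'. R' r_found \<noteq> 0 \<longleftrightarrow> R r_found \<noteq> 0 \<or> (\<exists>v<R r_n. hit (R r_n) (R r_D) (R r_k) (assoc G \<Delta> vs) v))"
      by (intro runs_search_all[OF symp_assoc]) (use R k E(1) in simp_all)
    moreover have "(\<exists>v<n. hit n ?D k (assoc G \<Delta> vs) v) \<longleftrightarrow> temporal_clique \<Delta> G k"
      unfolding temporal_clique_iff[OF vs]
    proof (rule search_criterion[OF symp_assoc])
      fix v assume "v < n" "?D < card {u. u < n \<and> assoc G \<Delta> vs v u}"
      then show "\<exists>S\<subseteq>{..<n}. k \<le> card S \<and> vclique (assoc G \<Delta> vs) S"
        using large_degree_temporal_clique[OF G \<Delta> k vs, of v] temporal_clique_iff[OF vs] by blast
    qed (use assoc_irrefl[OF tg \<Delta>(1)] k in auto)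
    ultimately have "runs x search_all R A (2 + n * (33 * 2 ^ ?D))
        (\<lambda>R' A'. R' r_found \<noteq> 0 \<longleftrightarrow> temporal_clique \<Delta> G k)"
      using R f by (simp only: simp_thms)
    then show ?case by (rule runs_conseq) simp_all
  qed simp
  then show ?thesis
    by (rule runs_Sq[where t' = 1]) (auto simp: runs_Asg)
qed

lemma runs_interval_main:
  assumes R: "R r_n = n" "R r_tau = \<tau>" "R r_Delta = \<Delta>" "R r_k = k" and k: "2 \<le> k" "k \<le> n"
  shows "runs x interval_main R (\<lambda>_ _. 0)
    (140 * (n * (k * ((2 * \<Delta>) ^ w) ^ 3 + 2 ^ ((k - 2) * (2 * \<Delta>) ^ w))))
    (\<lambda>R' A'. R' r_found = (if temporal_clique \<Delta> G k then 1 else 0))"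
proof -
  define Y where "Y = (2 * \<Delta>) ^ w"
  define D where "D = (k - 2) * Y"
  define B where "B = k * Y ^ 3"
  let ?A = "\<lambda>_ _. 0 :: nat"
  let ?F = "\<lambda>R' (A' :: arrays). R' r_found = (if temporal_clique \<Delta> G k then 1 else 0)"
  let ?fin = "Cond (Reg r_found) (r_a ::= Lit 0) search_all ;; r_found ::= Lit 1 .- (Lit 1 .- Reg r_found)"
  let ?c6 = "For r_v r_n visit ;; ?fin"
  let ?c5 = "r_nn ::= Reg r_n .+ Reg r_n ;; r_td ::= Reg r_Delta .+ Reg r_Delta ;;
      r_free ::= Reg r_S .+ Reg r_S ;; r_found ::= Lit 0 ;; ?c6"
  let ?c4 = "r_cap ::= Reg r_D .+ Reg r_y .+ Reg r_y ;; stride_loop ;; ?c5"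
  let ?c3 = "max_loop ;; ?c4"
  let ?c2 = "setup_rows ;; ?c3"
  let ?c1 = "degree_bound ;; ?c2"
  let ?t6 = "(2 + n * (80 * B + 2)) + (4 + 33 * (n * 2 ^ D))"
  let ?t4 = "1 + ((3 + 3 * \<tau>) + (4 + ?t6))"
  let ?t3 = "(5 + \<tau> * (4 + 4 * n)) + ?t4"
  let ?t2 = "(3 + 4 * n) + ?t3"
  let ?t1 = "(4 + 3 * (k - 2)) + ?t2"
  let ?t0 = "1 + ((3 + w * (6 + 3 * \<Delta>)) + ?t1)"
  have DY: "D + Y + Y = cap"
  proof -
    obtain j where "k = j + 2" using k(1) by (metis add.commute le_Suc_ex)
    then show ?thesis unfolding D_def Y_def by (simp add: algebra_simps)
  qed
  have wD: "\<tau> + 1 - \<Delta> = w" using \<Delta> by simp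
  have c6: "runs x ?c6 R1 A1 ?t6 ?F"
    if c: "ctx J R1" and D1: "R1 r_D = D" and r: "R1 r_free = 2 * R1 r_S" "R1 r_found = 0"
      and rw: "rows n A1" and z: "\<And>a i. a \<noteq> a_row \<Longrightarrow> A1 a i = 0" for J R1 A1
  proof -
    have r1: "R1 r_n = n" "R1 r_k = k" "R1 r_S = cap + \<tau> * J" using c unfolding ctx_def by auto
    have v0: "visited J 0 R1 A1" by (rule visited_0[OF r1(3) r _ rw z]) (use k in simp_all)
    have upd: "visited J v (R2(r_v := a)) A2 \<longleftrightarrow> visited J v R2 A2" for v a R2 A2
      unfolding visited_def by simp
    have loop: "runs x (For r_v r_n visit) R1 A1 (2 + n * (80 * B + 2)) (\<lambda>R' A'. visited J n R' A')"
    proof (rule runs_For[where I = "visited J" and f = "\<lambda>_. 80 * B"], goal_cases)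
      case 4
      then show ?case unfolding upd by (rule v0)
    next
      case (5 v R2 A2)
      have c2: "ctx J R2" by (rule ctx_cong[OF c]) (use 5(4) in auto)
      show ?case unfolding upd B_def Y_def
        by (rule runs_visit[OF c2 5(3) _ k(1) 5(2)]) (use 5(1) r1 in simp)
    next
      case 6
      then show ?case using r1 by simp
    next
      case (7 R' A')
      then show ?case using r1 by simp
    qed auto
    show ?thesis
    proof (rule runs_Sq[OF loop, where t' = "4 + 33 * (n * 2 ^ D)"], goal_cases)
      case (1 R2 A2)
      have "R2 r_n = n" "R2 r_k = k" "R2 r_D = (k - 2) * (2 * \<Delta>) ^ w"
        using 1(2) r1 D1 unfolding D_def Y_def by simp_all
      from runs_finish[OF 1(1) this k(1)] show ?case unfolding D_def Y_def .
    qed simp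
  qed
  have c4: "runs x ?c4 R1 A1 ?t4 ?F"
    if b: "bounded (R1 r_J)" and r: "R1 r_n = n" "R1 r_tau = \<tau>" "R1 r_Delta = \<Delta>" "R1 r_k = k" "R1 r_w = w"
        "R1 r_y = Y" "R1 r_D = D"
      and rw: "rows n A1" and z: "\<And>a i. a \<noteq> a_row \<Longrightarrow> A1 a i = 0" for R1 A1
  proof -
    let ?R = "R1(r_cap := cap)"
    have "runs x (stride_loop ;; ?c5) ?R A1 ((3 + 3 * \<tau>) + (4 + ?t6)) ?F"
    proof (rule runs_Sq[OF runs_stride_loop, where t' = "4 + ?t6"], goal_cases)
      case (1 R2 A2)
      have A2: "A2 = A1" using 1(3) by auto
      have r2: "R2 r_n = n" "R2 r_tau = \<tau>" "R2 r_Delta = \<Delta>" "R2 r_k = k" "R2 r_w = w" "R2 r_D = D"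
        "R2 r_J = R1 r_J" "R2 r_cap = cap" "R2 r_S = cap + \<tau> * R1 r_J"
        using 1(1,2) r by simp_all
      let ?R2 = "R2(r_nn := n + n, r_td := \<Delta> + \<Delta>, r_free := R2 r_S + R2 r_S, r_found := 0)"
      have "ctx (R1 r_J) ?R2" unfolding ctx_def using b r2 by simp
      then have "runs x ?c6 ?R2 A2 ?t6 ?F" unfolding A2 by (rule c6) (use r2 rw z in simp_all)
      then show ?case unfolding runs_Asg_Sq using r2 by simp
    qed (use r in simp)
    then show ?thesis unfolding runs_Asg_Sq using r DY by simp
  qed
  have c3: "runs x ?c3 R1 A1 ?t3 ?F"
    if r: "R1 r_n = n" "R1 r_tau = \<tau>" "R1 r_Delta = \<Delta>" "R1 r_k = k" "R1 r_w = w" "R1 r_y = Y" "R1 r_D = D"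
      and rw: "rows n A1" and z: "\<And>a i. a \<noteq> a_row \<Longrightarrow> A1 a i = 0" for R1 A1
  proof (rule runs_Sq[OF runs_max_loop[OF r(2,1)], where t' = ?t4], goal_cases)
    case (1 R2 A2)
    have A2: "A2 = A1" using 1(3) by auto
    show ?case unfolding A2 by (rule c4[of R2 A1, OF 1(1)]) (use 1(2) r rw z in simp_all)
  qed simp
  have c2: "runs x ?c2 R1 ?A ?t2 ?F"
    if r: "R1 r_n = n" "R1 r_tau = \<tau>" "R1 r_Delta = \<Delta>" "R1 r_k = k" "R1 r_w = w" "R1 r_y = Y" "R1 r_D = D" for R1
  proof (rule runs_Sq[OF runs_setup_rows, where t' = ?t3], goal_cases)
    case (1 R2 A2)
    show ?case by (rule c3) (use 1 r in simp_all)
  qed (use r in simp)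
  have c1: "runs x ?c1 R1 ?A ?t1 ?F"
    if r: "R1 r_n = n" "R1 r_tau = \<tau>" "R1 r_Delta = \<Delta>" "R1 r_k = k" "R1 r_w = w" "R1 r_y = Y" for R1
  proof (rule runs_Sq[OF runs_degree_bound, where t' = ?t2], goal_cases)
    case (1 R2 A2)
    have A2: "A2 = ?A" using 1(3) by auto
    show ?case unfolding A2 by (rule c2) (use 1 r D_def in simp_all)
  qed (use r in simp)
  have "runs x (power_prog ;; ?c1) (R(r_w := w)) ?A ((3 + w * (6 + 3 * \<Delta>)) + ?t1) ?F"
  proof (rule runs_Sq[OF runs_power_prog, where t' = ?t1], goal_cases)
    case (1 R2 A2)
    have A2: "A2 = ?A" using 1(3) by auto
    show ?case unfolding A2 by (rule c1) (use 1 R Y_def in simp_all)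
  qed (use R in simp)
  then have "runs x interval_main R ?A ?t0 ?F" unfolding interval_main_def runs_Asg_Sq using R wD by simp
  moreover have "?t0 \<le> 140 * (n * (B + 2 ^ D))"
  proof -
    have Y1: "1 \<le> Y" unfolding Y_def using \<Delta> by simp
    have "Y * 1 \<le> Y ^ 3" using Y1 by (simp add: power3_eq_cube)
    then have YB: "Y \<le> B" "k \<le> B" unfolding B_def using k(1) Y1
      by (auto intro: order_trans[OF _ mult_le_mono1[of 1 k]])
    have nB: "1 * B \<le> n * B" using k by (intro mult_le_mono1) simp
    have tau: "\<tau> \<le> Y" unfolding Y_def by (rule lifetime_le_power[OF \<Delta>])
    define W where "W = w * (6 + 3 * \<Delta>)"
    have "W = 6 * w + 3 * (w * \<Delta>)" unfolding W_def by (simp add: algebra_simps)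
    also have "\<dots> \<le> 6 * (w * \<Delta>) + 3 * (w * \<Delta>)"
      using mult_le_mono2[OF \<Delta>(1), of w] by (intro add_le_mono mult_le_mono2) (simp_all only: mult_1_right)
    also have "\<dots> = 9 * (w * \<Delta>)" by simp
    also have "\<dots> \<le> 9 * Y"
      unfolding Y_def by (rule mult_le_mono2[OF windows_le_power[OF \<Delta>(1)]]) simp
    finally have w: "W \<le> 9 * Y" .
    have "n * \<tau> \<le> n * B" using tau YB by (intro mult_le_mono2) simp
    then have tn: "\<tau> * (4 + 4 * n) \<le> 4 * \<tau> + 4 * (n * B)" by (simp add: algebra_simps)
    have "n * 1 \<le> n * B" using YB(1) Y1 by (intro mult_le_mono2) simp
    then have n: "n \<le> n * B" by simp
    have e1: "n * (80 * B + 2) = 80 * (n * B) + 2 * n" by (simp add: algebra_simps)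
    have e2: "140 * (n * (B + 2 ^ D)) = 140 * (n * B) + 140 * (n * 2 ^ D)" by (simp add: algebra_simps)
    show ?thesis unfolding e1 e2 W_def[symmetric] using YB nB tau w tn n Y1 by linarith
  qed
  ultimately show ?thesis unfolding B_def D_def Y_def by (rule runs_conseq)
qed

end

definition locate_intervals :: "nat \<Rightarrow> com" where
  "locate_intervals T =
     Seq (Const (T + 1) 1) (Seq (Load (T + 2) (T + 1)) (Seq (Const T 0) (Seq (Load (T + 3) T) (Seq (Const T 5)
       (While (T + 2) (Seq (Add T T (T + 3)) (Seq (Add T T (T + 3)) (Sub (T + 2) (T + 2) (T + 1)))))))))"

lemma (in interval_input) exec_locate_intervals:
  "\<exists>R t. exec (locate_intervals T) (init_state xs) t (R, x) \<and> t \<le> 6 + 4 * \<tau> \<and> R T = length xs"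
proof -
  let ?P = "Seq (Add T T (T + 3)) (Seq (Add T T (T + 3)) (Sub (T + 2) (T + 2) (T + 1)))"
  let ?I = "\<lambda>j R. R T = 5 + 2 * n * j \<and> R (T + 1) = 1 \<and> R (T + 2) = \<tau> - j \<and> R (T + 3) = n"
  define Z where "Z = (\<lambda>_::nat. 0::nat)"
  let ?R = "Z(T + 1 := 1, T + 2 := \<tau>, T := 0, T + 3 := n, T := 5)"
  have init: "init_state xs = (Z, x)" unfolding init_state_def input_def Z_def by auto
  have "\<exists>R'. exec (While (T + 2) ?P) (?R, x) ((\<tau> - 0) * Suc 3 + 1) (R', x) \<and> ?I \<tau> R'"
  proof (rule exec_While_count[where I = ?I and m = \<tau> and c = 3])
    fix j R assume j: "j < \<tau>" and I: "?I j R"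
    show "\<exists>R'. exec ?P (R, x) 3 (R', x) \<and> ?I (Suc j) R'"
      using I j by (simp add: numeral_eq_Suc exec_Seq_simps exec_simps)
  qed simp_all
  then obtain R' where R': "exec (While (T + 2) ?P) (?R, x) (\<tau> * 4 + 1) (R', x)" "?I \<tau> R'" by auto
  have "exec (locate_intervals T) (init_state xs) (Suc (Suc (Suc (Suc (Suc (\<tau> * 4 + 1)))))) (R', x)"
  proof -
    have "x ((Z(T + 1 := 1)) (T + 1)) = \<tau>" using x_params(2) by simp
    moreover have "x ((Z(T + 1 := 1, T + 2 := \<tau>, T := 0)) T) = n" using x_params(1) by simp
    ultimately show ?thesis using R'(1) by (simp only: locate_intervals_def init exec_Seq_simps)
  qed
  then show ?thesis using R'(2) length_xs
    by (intro exI[of _ R'] exI[of _ "Suc (Suc (Suc (Suc (Suc (\<tau> * 4 + 1)))))"]) simp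
qed

lemma cube_le_power2: "D ^ 3 \<le> 4 * (2::nat) ^ D"
proof (cases "D \<le> 4")
  case True
  then have "D \<in> {0, 1, 2, 3, 4}" by auto
  then show ?thesis by auto
next
  case False
  then have "4 \<le> D" by simp
  then show ?thesis
  proof (induction D rule: dec_induct)
    case (step D)
    have "4 * D \<le> D * D" using step(1) by (rule mult_le_mono1)
    moreover have "4 * (D * D) \<le> D * (D * D)" using step(1) by (rule mult_le_mono1)
    moreover have "Suc D ^ 3 = D * (D * D) + 3 * (D * D) + 3 * D + 1"
      by (simp add: power3_eq_cube algebra_simps)
    moreover have "D ^ 3 = D * (D * D)" by (simp add: power3_eq_cube)
    ultimately have "Suc D ^ 3 \<le> 2 * D ^ 3" using step(1) by linarith
    then show ?case using step by simp
  qed simp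
qed

theorem interval_encoding_solvable:
  "\<exists>P T. solves_temporal_clique P interval_encoding T \<and>
        (\<lambda>(\<Delta>, \<tau>, k, n, N). real (T (\<Delta>, \<tau>, k, n, N)))
          \<in> O[principal {(\<Delta>, \<tau>, k, n, N). 1 \<le> \<Delta> \<and> \<Delta> \<le> \<tau> \<and> 3 \<le> k \<and> 1 \<le> n}](\<lambda>(\<Delta>, \<tau>, k, n, N). clique_time \<Delta> \<tau> k n) \<and>
        (\<forall>\<Delta> \<tau>. 1 \<le> \<Delta> \<and> \<Delta> \<le> \<tau> \<longrightarrow>
          (\<lambda>(k, n, N). real (T (\<Delta>, \<tau>, k, n, N)))
            \<in> O[principal {(k, n, N). 1 \<le> n}](\<lambda>(k, n, N). clique_time \<Delta> \<tau> k n))"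
proof -
  let ?c = "with_params interval_main"
  define K where "K = 10 + 147 * ccost ?c"
  let ?P = "Seq (locate_intervals 60) (ccom 60 ?c)"
  define T where "T = (\<lambda>(\<Delta>, \<tau>, k, n, N :: nat). K * ((n + 1) *
    ((k + 1) * ((2 * \<Delta>) ^ (\<tau> - \<Delta> + 1)) ^ 3 + 2 ^ ((k - 2) * (2 * \<Delta>) ^ (\<tau> - \<Delta> + 1)))))"
  have wf: "wfc 60 ?c"
    unfolding with_params_def interval_main_def power_prog_def degree_bound_def setup_rows_def
      max_loop_def stride_loop_def visit_def visit_paths_def next_level_def load_choices_def grow_def
      visit_child_def visit_leaf_def scan_bucket_def check_pair_def test_pair_def measure_gap_def
      add_edge_def search_all_def search_def inside_table_def extend_weights_def by simp
  have "solves_temporal_clique ?P interval_encoding T"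
    unfolding solves_temporal_clique_def
  proof (intro allI impI, elim conjE)
    fix G :: "nat temporal_graph" and \<Delta> k xs
    assume G: "temporal_unit_interval_graph G" and \<Delta>: "1 \<le> \<Delta>" "\<Delta> \<le> lifetime G" and "interval_encoding G \<Delta> k xs"
    then obtain vs d q r where e: "distinct vs" "set vs = verts G"
      "\<forall>t\<in>{1..lifetime G}. (\<forall>v\<in>verts G. r t v < d) \<and>
        layer G t = interval_edges (verts G) (\<lambda>v. real (q t v) + real (r t v) / real d) 1"
      "xs = [length vs, lifetime G, \<Delta>, k, d] @
       concat (map (\<lambda>t. concat (map (\<lambda>v. [q t v, r t v]) vs)) [1..<lifetime G + 1])"
      unfolding interval_encoding_def by (elim exE conjE) (rule that)
    interpret interval_input G \<Delta> k xs vs d q r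
      by unfold_locales (use G \<Delta> e in blast)+
    let ?Y = "(2 * \<Delta>) ^ w"
    let ?X = "n * (k * ?Y ^ 3 + 2 ^ ((k - 2) * ?Y))"
    let ?Z = "(n + 1) * ((k + 1) * ?Y ^ 3 + 2 ^ ((k - 2) * ?Y))"
    let ?y = "if temporal_clique \<Delta> G k then 1 else 0 :: nat"
    have card: "card (verts G) = n" using vs distinct_card by metis
    have "runs x ?c R (\<lambda>_ _. 0) (7 + 140 * ?X) (\<lambda>R' A'. R' 0 = ?y)" for R
    proof (rule runs_with_params[OF _ x_params(2-4)])
      show "finite (verts G)" using vs(2) by (metis List.finite_set)
    qed (use card x_params(1) runs_interval_main in simp_all)
    from exec_located[OF wf _ exec_locate_intervals this]
    obtain t R M where tRM: "exec ?P (init_state xs) t (R, M)"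
      "t \<le> 6 + 4 * \<tau> + ccost ?c * (7 + 140 * ?X)" "R 0 = ?y" by auto
    have "1 * 1 \<le> ?Z" using \<Delta> by (intro mult_le_mono) (auto simp: Suc_le_eq)
    moreover have XZ: "?X \<le> ?Z" by (intro mult_le_mono add_le_mono) auto
    ultimately have "7 + 140 * ?X \<le> 147 * ?Z" by linarith
    then have "ccost ?c * (7 + 140 * ?X) \<le> ccost ?c * (147 * ?Z)" by (rule mult_le_mono2)
    moreover have "\<tau> \<le> ?Z"
    proof -
      have "\<tau> \<le> ?Y" by (rule lifetime_le_power[OF \<Delta>])
      also have "?Y \<le> ?Y ^ 3" using \<Delta> by (intro self_le_power) auto
      also have "\<dots> \<le> 1 * ((k + 1) * ?Y ^ 3 + 2 ^ ((k - 2) * ?Y))" by simp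
      also have "\<dots> \<le> ?Z" by (rule mult_le_mono1) simp
      finally show ?thesis .
    qed
    moreover have "K * ?Z = 10 * ?Z + ccost ?c * (147 * ?Z)" unfolding K_def by (simp only: algebra_simps)
    ultimately have "t \<le> K * ?Z" using tRM(2) \<open>1 * 1 \<le> ?Z\<close> by linarith
    then have "t \<le> T (\<Delta>, \<tau>, k, card (verts G), length xs)" unfolding T_def card by simp
    then show "\<exists>t R M. exec ?P (init_state xs) t (R, M) \<and>
           t \<le> T (\<Delta>, \<tau>, k, card (verts G), length xs) \<and> R 0 = ?y"
      using tRM(1,3) by blast
  qed
  moreover have "(\<lambda>(\<Delta>, \<tau>, k, n, N). real (T (\<Delta>, \<tau>, k, n, N)))
      \<in> O[principal {(\<Delta>, \<tau>, k, n, N). 1 \<le> \<Delta> \<and> \<Delta> \<le> \<tau> \<and> 3 \<le> k \<and> 1 \<le> n}](\<lambda>(\<Delta>, \<tau>, k, n, N). clique_time \<Delta> \<tau> k n)"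
  proof (rule bigoI[where c = "real (34 * K)"], unfold eventually_principal, clarify)
    fix \<Delta> \<tau> k n N :: nat assume a: "1 \<le> \<Delta>" "\<Delta> \<le> \<tau>" "3 \<le> k" "1 \<le> n"
    define Y where "Y = (2 * \<Delta>) ^ (\<tau> - \<Delta> + 1)"
    define D where "D = (k - 2) * Y"
    have "(k + 1) * Y ^ 3 \<le> (4 * (k - 2) ^ 3) * Y ^ 3"
    proof (rule mult_le_mono1)
      have "k - 2 \<le> (k - 2) ^ 3" using a(3) by (intro self_le_power) auto
      then show "k + 1 \<le> 4 * (k - 2) ^ 3" using a(3) by linarith
    qed
    also have "\<dots> = 4 * D ^ 3" unfolding D_def by (simp add: power_mult_distrib)
    also have "\<dots> \<le> 16 * 2 ^ D" using cube_le_power2[of D] by simp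
    finally have "(k + 1) * Y ^ 3 + 2 ^ D \<le> 17 * 2 ^ D" by simp
    then have "(n + 1) * ((k + 1) * Y ^ 3 + 2 ^ D) \<le> (2 * n) * (17 * 2 ^ D)"
      using a(4) by (intro mult_le_mono) auto
    then have "K * ((n + 1) * ((k + 1) * Y ^ 3 + 2 ^ D)) \<le> K * ((2 * n) * (17 * 2 ^ D))" by (rule mult_le_mono2)
    also have "\<dots> = 34 * K * (2 ^ D * n)" by (simp add: algebra_simps)
    finally have "T (\<Delta>, \<tau>, k, n, N) \<le> 34 * K * (2 ^ D * n)" unfolding T_def Y_def D_def by simp
    then have "real (T (\<Delta>, \<tau>, k, n, N)) \<le> real (34 * K * (2 ^ D * n))" by (rule of_nat_mono)
    also have "\<dots> = real (34 * K) * (2 ^ D * real n)" by simp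
    finally show "norm (real (T (\<Delta>, \<tau>, k, n, N))) \<le> real (34 * K) * norm (clique_time \<Delta> \<tau> k n)"
      unfolding clique_time_def D_def Y_def by simp
  qed
  moreover have "(\<lambda>(k, n, N). real (T (\<Delta>, \<tau>, k, n, N)))
      \<in> O[principal {(k, n, N). 1 \<le> n}](\<lambda>(k, n, N). clique_time \<Delta> \<tau> k n)" if a: "1 \<le> \<Delta>" "\<Delta> \<le> \<tau>" for \<Delta> \<tau>
  proof -
    define Y where "Y = (2 * \<Delta>) ^ (\<tau> - \<Delta> + 1)"
    have Y1: "1 \<le> Y" unfolding Y_def using a by simp
    let ?C = "K * (2 * (3 * Y ^ 3 + 1))"
    show ?thesis
    proof (rule bigoI[where c = "real ?C"], unfold eventually_principal, clarify)
      fix k n N :: nat assume n: "1 \<le> n"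
      define D where "D = (k - 2) * Y"
      have "k + 1 \<le> 3 * 2 ^ (k - 2)" using less_exp[of "k - 2"] by linarith
      also have "\<dots> \<le> 3 * 2 ^ D" unfolding D_def using Y1 by (intro mult_le_mono2 power_increasing) auto
      finally have "(k + 1) * Y ^ 3 \<le> 3 * 2 ^ D * Y ^ 3" by (rule mult_le_mono1)
      then have "(k + 1) * Y ^ 3 + 2 ^ D \<le> 3 * 2 ^ D * Y ^ 3 + 2 ^ D" by simp
      also have "\<dots> = (3 * Y ^ 3 + 1) * 2 ^ D" by (simp add: algebra_simps)
      finally have "(n + 1) * ((k + 1) * Y ^ 3 + 2 ^ D) \<le> (2 * n) * ((3 * Y ^ 3 + 1) * 2 ^ D)"
        using n by (intro mult_le_mono) auto
      then have "K * ((n + 1) * ((k + 1) * Y ^ 3 + 2 ^ D)) \<le> K * ((2 * n) * ((3 * Y ^ 3 + 1) * 2 ^ D))"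
        by (rule mult_le_mono2)
      also have "\<dots> = ?C * (2 ^ D * n)" by (simp add: algebra_simps)
      finally have "T (\<Delta>, \<tau>, k, n, N) \<le> ?C * (2 ^ D * n)" unfolding T_def Y_def D_def by simp
      then have "real (T (\<Delta>, \<tau>, k, n, N)) \<le> real (?C * (2 ^ D * n))" by (rule of_nat_mono)
      also have "\<dots> = real ?C * (2 ^ D * real n)" by simp
      finally show "norm (real (T (\<Delta>, \<tau>, k, n, N))) \<le> real ?C * norm (clique_time \<Delta> \<tau> k n)"
        unfolding clique_time_def D_def Y_def by simp
    qed
  qed
  ultimately show ?thesis by blast
qed

theorem theorem5:
  shows
    "(\<exists>P T. solves_temporal_clique P interval_encoding T \<and>
        (\<lambda>(\<Delta>, \<tau>, k, n, N). real (T (\<Delta>, \<tau>, k, n, N)))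
          \<in> O[principal {(\<Delta>, \<tau>, k, n, N). 1 \<le> \<Delta> \<and> \<Delta> \<le> \<tau> \<and> 3 \<le> k \<and> 1 \<le> n}](\<lambda>(\<Delta>, \<tau>, k, n, N). clique_time \<Delta> \<tau> k n) \<and>
        (\<forall>\<Delta> \<tau>. 1 \<le> \<Delta> \<and> \<Delta> \<le> \<tau> \<longrightarrow>
          (\<lambda>(k, n, N). real (T (\<Delta>, \<tau>, k, n, N)))
            \<in> O[principal {(k, n, N). 1 \<le> n}](\<lambda>(k, n, N). clique_time \<Delta> \<tau> k n))) \<and>
     (\<exists>P T. solves_temporal_clique P edge_encoding T \<and>
        (\<lambda>(\<Delta>, \<tau>, k, n, N). real (T (\<Delta>, \<tau>, k, n, N)))
          \<in> O[principal {(\<Delta>, \<tau>, k, n, N). 1 \<le> \<Delta> \<and> \<Delta> \<le> \<tau>}](\<lambda>(\<Delta>, \<tau>, k, n, N). clique_time \<Delta> \<tau> k n + real N))"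
  by (rule conjI[OF interval_encoding_solvable edge_encoding_solvable])

end
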